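(* Let $a>0$ be a real number and $k\ge 1$ an integer. There exists a function $c_X(d_1,d_2)$, defined for integers $d_1\ge k$ and $d_2\ge k$ (and depending on $a$ and $k$), such that for all integers $d_1,d_2\ge k$ and $t\ge1$ $$ EX(d_1,d_2,t)=c_X(d_1,d_2)\,t+O_{a,k}(1), $$ and $$ \begin{aligned} c_X(d_1,d_2)={}&\frac{\Gamma(d_1-k+ka)\,\Gamma(d_2-k+ka)\,\Gamma(d_1+d_2-2k+2ka+3)}{\Gamma(d_1-k+ka+2)\,\Gamma(d_2-k+ka+2)\,\Gamma(d_1+d_2-2k+2ka+a+2)}\\ &\times ka(a+1)\frac{\Gamma(ka+a+1)}{\Gamma(ka)}\left(1+\theta(d_1,d_2)\frac{(d_1-k+ka+1)(d_2-k+ka+1)}{(d_1+d_2-2k+2ka+1)(d_1+d_2-2k+2ka+2)}\right), \end{aligned} $$ where $\theta(d_1,d_2)$ is a real number satisfying $$ -4+\frac2{1+ka}\le\theta(d_1,d_2)\le a\,\frac{\Gamma(ka+1)\Gamma(2ka+a+3)}{\Gamma(2ka+2)\Gamma(ka+a+2)}. $$ When both $d_1$ and $d_2$ grow, the asymptotic behaviour of $c_X$ is $$ c_X(d_1,d_2)=ka(a+1)\frac{\Gamma(ka+a+1)}{\Gamma(ka)}\,\frac{(d_1+d_2)^{1-a}}{d_1^2d_2^2}\left(1+O_{a,k}\left(\frac1{d_1}+\frac1{d_2}+\frac{d_1d_2}{(d_1+d_2)^2}\right)\right). $$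
   Context: The Buckley--Osthus random graph. Fix a real number $a>0$ and an integer $k\ge1$ (constants). Graphs are undirected, and loops and multiple edges are allowed; a loop contributes $2$ to the degree of its node. First stage: the random graph $H_{a,1}^{(t)}$ has nodes $1,\dots,t$ and $t$ edges. $H_{a,1}^{(1)}$ is the graph with one node and one loop. For $t\ge2$, $H_{a,1}^{(t)}$ is obtained from $H_{a,1}^{(t-1)}$ by adding a new node $t$ and one new edge between $t$ and a random node $\gamma\in\{1,\dots,t\}$, where, conditionally on the graph $H_{a,1}^{(t-1)}$, $$\Pr(\gamma=s)=\frac{\deg_{t-1}(s)-1+a}{(a+1)t-1}\ \text{ for } 1\le s\le t-1,\qquad \Pr(\gamma=t)=\frac{a}{(a+1)t-1},$$ and $\deg_{t-1}(s)$ is the degree of $s$ in $H_{a,1}^{(t-1)}$. Second stage: $H_{a,k}^{(t)}$ is obtained from $H_{a,1}^{(kt)}$ by identifying the nodes $1,\dots,k$ into one node, the nodes $k+1,\dots,2k$ into a second node, and so on, which gives $t$ nodes; all $kt$ edges are kept (possibly becoming multiple edges and multiple loops). $X(d_1,d_2,t)$ is the total number of edges of $H_{a,k}^{(t)}$ linking a node of degree $d_1$ and a node of degree $d_2$; when $d_1=d_2$ every such edge is counted twice, and loops are not counted. That is, $X(d_1,d_2,t)=\sum_{s_1\ne s_2}N(s_1,s_2)$, the sum being over ordered pairs of distinct nodes $(s_1,s_2)$ of $H_{a,k}^{(t)}$ with $\deg s_1=d_1$, $\deg s_2=d_2$, where $N(s_1,s_2)$ is the number of edges between $s_1$ and $s_2$.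 $E$ denotes expectation and $\Gamma$ is Euler's Gamma function. $O_{a,k}(\cdot)$ denotes a quantity bounded in absolute value by a constant depending only on $a$ and $k$ times the argument; in particular the $O_{a,k}(1)$ term is bounded uniformly over all $d_1,d_2\ge k$ and $t\ge1$. *)

theory Defs
  imports "HOL-Probability.Probability" "HOL-Library.Multiset"
begin

text \<open>
  An undirected edge is the two-element multiset of its endpoints, so that a loop at \<open>s\<close> is
  \<open>{#s, s#}\<close>; a multigraph is the multiset of its edges. The node set is not stored:
  the graphs below with time parameter \<open>t\<close> have node set \<open>{1..t}\<close>.
\<close>

type_synonym mgraph = "nat multiset multiset"

text \<open>The multiplicity of \<open>s\<close> among all edge endpoints: a loop contributes 2.\<close>

definition deg :: "mgraph \<Rightarrow> nat \<Rightarrow> nat" where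
  "deg G s = count (\<Sum>\<^sub># G) s"

definition num_edges :: "mgraph \<Rightarrow> nat \<Rightarrow> nat \<Rightarrow> nat" where
  "num_edges G s1 s2 = count G {#s1, s2#}"

definition attach_prob :: "real \<Rightarrow> nat \<Rightarrow> mgraph \<Rightarrow> nat \<Rightarrow> real" where
  "attach_prob a t G s =
     (if 1 \<le> s \<and> s < t then (real (deg G s) - 1 + a) / ((a + 1) * real t - 1)
      else if s = t then a / ((a + 1) * real t - 1)
      else 0)"

text \<open>
  \<open>embed_pmf\<close> is meaningful only for a genuine probability mass function; the lemma
  \<open>pmf_attach_pmf\<close> below shows that this is so for every graph that occurs.
\<close>

definition attach_pmf :: "real \<Rightarrow> nat \<Rightarrow> mgraph \<Rightarrow> nat pmf" where
  "attach_pmf a t G = embed_pmf (attach_prob a t G)"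

text \<open>The process starts at \<open>t = 1\<close>; the value at \<open>t = 0\<close> is a dummy.\<close>

fun H1 :: "real \<Rightarrow> nat \<Rightarrow> mgraph pmf" where
  "H1 a 0 = return_pmf {#}"
| "H1 a (Suc 0) = return_pmf {#{#1, 1#}#}"
| "H1 a (Suc (Suc n)) =
     bind_pmf (H1 a (Suc n)) (\<lambda>G.
       map_pmf (\<lambda>s. add_mset {#Suc (Suc n), s#} G) (attach_pmf a (Suc (Suc n)) G))"

text \<open>Nodes \<open>k(j - 1) + 1, \<dots>, kj\<close> become node \<open>j\<close>.\<close>

definition block :: "nat \<Rightarrow> nat \<Rightarrow> nat" where
  "block k i = (i - 1) div k + 1"

definition merge_nodes :: "nat \<Rightarrow> mgraph \<Rightarrow> mgraph" where
  "merge_nodes k G = image_mset (image_mset (block k)) G"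

definition H :: "real \<Rightarrow> nat \<Rightarrow> nat \<Rightarrow> mgraph pmf" where
  "H a k t = map_pmf (merge_nodes k) (H1 a (k * t))"

text \<open>The pairs are ordered, so for \<open>d1 = d2\<close> every non-loop edge is counted twice.\<close>

definition X :: "nat \<Rightarrow> nat \<Rightarrow> nat \<Rightarrow> mgraph \<Rightarrow> nat" where
  "X d1 d2 t G =
     (\<Sum>(s1, s2) \<in> {(s1, s2). s1 \<in> {1..t} \<and> s2 \<in> {1..t} \<and> s1 \<noteq> s2 \<and>
                             deg G s1 = d1 \<and> deg G s2 = d2}.
        num_edges G s1 s2)"

text \<open>For \<open>a > 0\<close> the support of \<open>H a k t\<close> is finite, so integrability is no issue.\<close>

definition expected_X :: "real \<Rightarrow> nat \<Rightarrow> nat \<Rightarrow> nat \<Rightarrow> nat \<Rightarrow> real" where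
  "expected_X a k d1 d2 t = measure_pmf.expectation (H a k t) (\<lambda>G. real (X d1 d2 t G))"

definition wf_graph :: "nat \<Rightarrow> mgraph \<Rightarrow> bool" where
  "wf_graph t G \<longleftrightarrow>
     (\<Sum>s\<in>{1..t}. deg G s) = 2 * t \<and> (\<forall>s\<in>{1..t}. 1 \<le> deg G s) \<and> (\<forall>s. s \<notin> {1..t} \<longrightarrow> deg G s = 0)"

lemma deg_add_mset [simp]: "deg (add_mset e G) s = count e s + deg G s"
  by (simp add: deg_def)

lemma attach_prob_nonneg:
  assumes "a > 0" "wf_graph (t - 1) G" "t \<ge> 2"
  shows "attach_prob a t G s \<ge> 0"
proof -
  have "(a + 1) * real t - 1 > 0"
  proof -
    have "(a + 1) * real t \<ge> 1 * real t" using assms(1) by (intro mult_right_mono) auto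
    thus ?thesis using assms(3) by linarith
  qed
  moreover have "real (deg G s) \<ge> 1" if "1 \<le> s" "s < t"
    using assms(2) that unfolding wf_graph_def by force
  ultimately show ?thesis
    using assms(1) unfolding attach_prob_def by force
qed

lemma attach_prob_sum:
  assumes "a > 0" "wf_graph (t - 1) G" "t \<ge> 2"
  shows "(\<Sum>s\<in>{1..t}. attach_prob a t G s) = 1"
proof -
  let ?D = "(a + 1) * real t - 1"
  have D: "?D > 0"
  proof -
    have "(a + 1) * real t \<ge> 1 * real t" using assms(1) by (intro mult_right_mono) auto
    thus ?thesis using assms(3) by linarith
  qed
  have ins: "{1..t} = insert t {1..t - 1}" using assms(3) by auto
  have nin: "t \<notin> {1..t - 1}" using assms(3) by auto
  have sd: "(\<Sum>s\<in>{1..t - 1}. real (deg G s)) = 2 * (real t - 1)"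
  proof -
    have "(\<Sum>s\<in>{1..t - 1}. real (deg G s)) = real (2 * (t - 1))"
      using assms(2) unfolding wf_graph_def by (metis of_nat_sum)
    thus ?thesis using assms(3) by (simp add: of_nat_diff)
  qed
  have "(\<Sum>s\<in>{1..t - 1}. attach_prob a t G s)
      = (\<Sum>s\<in>{1..t - 1}. (real (deg G s) + (a - 1)) / ?D)"
    by (intro sum.cong) (auto simp: attach_prob_def algebra_simps)
  also have "\<dots> = ((\<Sum>s\<in>{1..t - 1}. real (deg G s)) + (real t - 1) * (a - 1)) / ?D"
    using assms(3) by (simp add: sum_divide_distrib [symmetric] sum.distrib of_nat_diff)
  also have "\<dots> = (2 * (real t - 1) + (real t - 1) * (a - 1)) / ?D"
    by (simp only: sd)
  finally have s1: "(\<Sum>s\<in>{1..t - 1}. attach_prob a t G s)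
      = (2 * (real t - 1) + (real t - 1) * (a - 1)) / ?D" .
  have s2: "attach_prob a t G t = a / ?D" by (simp add: attach_prob_def)
  have "(\<Sum>s\<in>{1..t}. attach_prob a t G s)
      = (a + (2 * (real t - 1) + (real t - 1) * (a - 1))) / ?D"
    unfolding ins using nin s1 s2 by (simp add: add_divide_distrib)
  also have "a + (2 * (real t - 1) + (real t - 1) * (a - 1)) = ?D"
    by (simp add: algebra_simps)
  finally show ?thesis using D by simp
qed

lemma pmf_attach_pmf_wf:
  assumes "a > 0" "wf_graph (t - 1) G" "t \<ge> 2"
  shows "pmf (attach_pmf a t G) s = attach_prob a t G s"
proof -
  have z: "attach_prob a t G s = 0" if "s \<notin> {1..t}" for s
    using that assms(3) by (auto simp: attach_prob_def)
  have "(\<integral>\<^sup>+ s. ennreal (attach_prob a t G s) \<partial>count_space UNIV)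
      = (\<Sum>s\<in>{1..t}. ennreal (attach_prob a t G s))"
    using z by (intro nn_integral_count_space') auto
  also have "\<dots> = ennreal (\<Sum>s\<in>{1..t}. attach_prob a t G s)"
    using attach_prob_nonneg [OF assms] by (intro sum_ennreal) auto
  also have "\<dots> = 1"
    by (subst attach_prob_sum [OF assms]) simp
  finally show ?thesis
    unfolding attach_pmf_def
    using attach_prob_nonneg [OF assms] by (intro pmf_embed_pmf) auto
qed

lemma wf_graph_H1:
  assumes "a > 0" "G \<in> set_pmf (H1 a (Suc n))"
  shows "wf_graph (Suc n) G"
  using assms(2)
proof (induction n arbitrary: G)
  case 0
  then show ?case by (auto simp: wf_graph_def deg_def)
next
  case (Suc n)
  then obtain G0 s where G0: "G0 \<in> set_pmf (H1 a (Suc n))"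
    and s: "s \<in> set_pmf (attach_pmf a (Suc (Suc n)) G0)"
    and G: "G = add_mset {#Suc (Suc n), s#} G0"
    by auto
  have wf: "wf_graph (Suc n) G0" by (rule Suc.IH [OF G0])
  have "attach_prob a (Suc (Suc n)) G0 s \<noteq> 0"
    using s pmf_attach_pmf_wf [of a "Suc (Suc n)" G0 s] wf assms(1)
    by (auto simp: set_pmf_eq)
  hence rng: "s \<in> {1..Suc (Suc n)}"
    by (auto simp: attach_prob_def split: if_splits)
  have d0: "deg G0 (Suc (Suc n)) = 0" using wf by (auto simp: wf_graph_def)
  have sum0: "(\<Sum>x\<in>{1..Suc (Suc n)}. deg G0 x) = 2 * Suc n"
    using wf d0 by (simp add: wf_graph_def)
  have sum1: "(\<Sum>x\<in>{1..Suc (Suc n)}. count {#Suc (Suc n), s#} x) = 2"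
  proof -
    have "(\<Sum>x\<in>{1..Suc (Suc n)}. count {#Suc (Suc n), s#} x)
        = (\<Sum>x\<in>{1..Suc (Suc n)}. (if x = Suc (Suc n) then 1 else 0) + (if x = s then 1 else 0))"
      by (intro sum.cong) auto
    also have "\<dots> = 2"
      unfolding sum.distrib using rng by (simp only: sum.delta finite_atLeastAtMost) auto
    finally show ?thesis .
  qed
  have "(\<Sum>x\<in>{1..Suc (Suc n)}. deg G x) = 2 * Suc (Suc n)"
    unfolding G deg_add_mset sum.distrib sum0 sum1 by simp
  moreover have "1 \<le> deg G x" if "x \<in> {1..Suc (Suc n)}" for x
  proof (cases "x = Suc (Suc n)")
    case False
    hence "1 \<le> deg G0 x" using wf that by (auto simp: wf_graph_def)
    thus ?thesis by (simp add: G)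
  qed (simp add: G)
  moreover have "deg G x = 0" if "x \<notin> {1..Suc (Suc n)}" for x
    using wf that rng by (auto simp: wf_graph_def G)
  ultimately show ?case by (auto simp: wf_graph_def)
qed

theorem pmf_attach_pmf:
  assumes "a > 0" "t \<ge> 2" "G \<in> set_pmf (H1 a (t - 1))"
  shows "pmf (attach_pmf a t G) s = attach_prob a t G s"
proof -
  have "Suc (t - 2) = t - 1" using assms(2) by simp
  hence "wf_graph (t - 1) G" using wf_graph_H1 [of a G "t - 2"] assms by simp
  thus ?thesis using pmf_attach_pmf_wf assms by blast
qed

end

theory Submission
  imports Defs "HOL-Real_Asymp.Real_Asymp"
begin

text \<open>
  Merging the nodes block by block as the process runs gives a Markov chain in which a complete
  block of degree \<open>d\<close> is chosen with probability proportional to its weight \<open>d - k + ka\<close>. Hence the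
  expected numbers of blocks of degree \<open>d\<close> and of edges between blocks of degrees \<open>d1\<close>, \<open>d2\<close> satisfy
  linear recurrences whose source comes from the block under construction. The true expectations are
  compared with linear-in-time solutions of the limiting recurrences: the recurrences do not
  increase a weighted supremum norm, the residuals are \<open>O(1 / time)\<close>, and the damping
  \<open>(w1 + w2) / time\<close> turns this into an error \<open>O(1)\<close> uniformly in the degrees.

  After division by the right Gamma factors the recurrence for \<open>c_X\<close> says that a
  function of the two weights \<open>x, y\<close> is the weighted mean, with weights \<open>x\<close> and \<open>y\<close>, of its values at
  \<open>(x - 1, y)\<close> and \<open>(x, y - 1)\<close>. The function
  \<open>(x + y + 1) (x + y + 2) / ((x + 1) (y + 1))\<close> has the same mean value property, and \<open>\<theta>\<close> is the difference.
  So \<open>\<theta>\<close> lies between its extreme boundary values, which are controlled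
  by a one-dimensional recurrence.
\<close>

section \<open>Degrees in merged multigraphs and the first stage\<close>

text \<open>Every new edge has an endpoint in the unfinished block, whose attachment weight differs
  from that of complete blocks. Only complete blocks are therefore classified by degree; edges from
  the unfinished block wait in a separate count and are released when that block closes, once in
  \<open>k\<close> steps. Uniformity in the degrees is the difficulty. For large degrees the
  coefficient \<open>1 - w / D n\<close> is negative; there the true expectations vanish at late
  times and the comparison solutions are bounded, because the limits decay at least like the
  reciprocal weight. Elsewhere the two comparisons differ. For edges the predecessors enter with
  \<open>w d1 - 1\<close> and \<open>w d2 - 1\<close> against a loss of \<open>w d1 + w d2\<close>,
  and this gap, bounded below uniformly in the degrees, absorbs residuals of order
  \<open>1 / D n\<close>. The degree counts must be controlled after multiplication by
  \<open>w d\<close>, since that product feeds the edge counts; with this scaling gain and loss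
  balance exactly and no gap is left. What saves the argument is that their residuals live on
  boundedly many degrees.\<close>

lemma Union_mset_image_mset_image_mset: "\<Sum>\<^sub># (image_mset (image_mset f) G) = image_mset f (\<Sum>\<^sub># G)"
  by (induction G) auto

lemma deg_merge_nodes:
  assumes "finite S" and "\<And>s. s \<notin> S \<Longrightarrow> deg G s = 0"
  shows "deg (merge_nodes k G) j = (\<Sum>s\<in>{s \<in> S. block k s = j}. deg G s)"
proof -
  have "deg (merge_nodes k G) j
      = (\<Sum>s\<in>block k -` {j} \<inter> set_mset (\<Sum>\<^sub># G). deg G s)"
    by (simp add: deg_def merge_nodes_def Union_mset_image_mset_image_mset count_image_mset)
  also have "\<dots> = (\<Sum>s\<in>{s \<in> S. block k s = j}. deg G s)"
  proof (rule sum.mono_neutral_left)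
    show "block k -` {j} \<inter> set_mset (\<Sum>\<^sub># G) \<subseteq> {s \<in> S. block k s = j}"
    proof
      fix s assume s: "s \<in> block k -` {j} \<inter> set_mset (\<Sum>\<^sub># G)"
      then have "deg G s \<noteq> 0" by (simp add: deg_def)
      then have "s \<in> S" using assms(2)[of s] by linarith
      with s show "s \<in> {s \<in> S. block k s = j}" by auto
    qed
    show "\<forall>s\<in>{s \<in> S. block k s = j} - block k -` {j} \<inter> set_mset (\<Sum>\<^sub># G). deg G s = 0"
      by (auto simp: deg_def not_in_iff)
  qed (use assms(1) in auto)
  finally show ?thesis .
qed

lemma merge_nodes_add_mset:
  "merge_nodes k (add_mset {#u, v#} G) = add_mset {#block k u, block k v#} (merge_nodes k G)"
  by (simp add: merge_nodes_def)

lemma nodes_of_block: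
  assumes "k \<ge> 1" "j \<ge> 1"
  shows "{s \<in> {1..n}. block k s = j} = {k * (j - 1) + 1..min n (k * j)}"
proof -
  have "block k s = j \<longleftrightarrow> k * (j - 1) + 1 \<le> s \<and> s \<le> k * j" if "s \<ge> 1" for s
  proof -
    have "block k s = j \<longleftrightarrow> (s - 1) div k = j - 1"
      using assms(2) by (auto simp: block_def)
    also have "\<dots> \<longleftrightarrow> k * (j - 1) \<le> s - 1 \<and> s - 1 < k * j"
      using less_eq_div_iff_mult_less_eq[of k "j - 1" "s - 1"]
        div_less_iff_less_mult[of k "s - 1" j] assms
      by (auto simp: mult.commute)
    also have "\<dots> \<longleftrightarrow> k * (j - 1) + 1 \<le> s \<and> s \<le> k * j"
      using that by linarith
    finally show ?thesis .
  qed
  then have "s \<in> {s \<in> {1..n}. block k s = j} \<longleftrightarrow> s \<in> {k * (j - 1) + 1..min n (k * j)}" for s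
    by (cases "s \<ge> 1") auto
  then show ?thesis by blast
qed

lemma count_pair_eq: "count {#u, v#} s = (if s = u then 1 else 0) + (if s = v then 1 else (0::nat))"
  by auto

text \<open>A given edge matches \<open>{#s, v#}\<close> for at most one \<open>s\<close>, and then
  \<open>v\<close> is among its endpoints; a loop at \<open>v\<close> even counts twice on the
  right.\<close>

lemma sum_num_edges_le_deg:
  assumes "finite S"
  shows "(\<Sum>s\<in>S. num_edges G s v) \<le> deg G v"
proof (induction G)
  case empty
  then show ?case by (simp add: num_edges_def)
next
  case (add e G)
  have "(\<Sum>s\<in>S. if e = {#s, v#} then 1 else 0) \<le> count e v"
  proof (cases "\<exists>s\<in>S. e = {#s, v#}")
    case True
    then obtain s where s: "s \<in> S" "e = {#s, v#}" by blast
    have "(\<Sum>x\<in>S. if e = {#x, v#} then 1 else 0) = (\<Sum>x\<in>S. if x = s then 1 else (0::nat))"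
      using s by (intro sum.cong) (auto simp: add_eq_conv_ex)
    then show ?thesis using s assms by simp
  qed (auto intro!: sum.neutral simp: sum_nonneg_eq_0_iff)
  moreover have "(\<Sum>s\<in>S. num_edges (add_mset e G) s v)
      = (\<Sum>s\<in>S. if e = {#s, v#} then 1 else 0) + (\<Sum>s\<in>S. num_edges G s v)"
    unfolding sum.distrib [symmetric] by (intro sum.cong) (auto simp: num_edges_def)
  ultimately show ?case using add by simp
qed

lemma num_edges_commute: "num_edges G u v = num_edges G v u"
  by (simp add: num_edges_def add_mset_commute)

lemma num_edges_add_mset:
  "num_edges (add_mset {#u, v#} G) s1 s2 = num_edges G s1 s2 + (if {#u, v#} = {#s1, s2#} then 1 else 0)"
  by (simp add: num_edges_def)

lemma wf_graph_H1': "a > 0 \<Longrightarrow> G \<in> set_pmf (H1 a n) \<Longrightarrow> wf_graph n G"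
  by (cases n) (simp add: wf_graph_def deg_def, blast intro: wf_graph_H1)

lemma set_pmf_attach_pmf:
  assumes "a > 0" "wf_graph (t - 1) G" "t \<ge> 2"
  shows "set_pmf (attach_pmf a t G) \<subseteq> {1..t}"
proof
  fix s assume "s \<in> set_pmf (attach_pmf a t G)"
  then have "attach_prob a t G s \<noteq> 0"
    using pmf_attach_pmf_wf [OF assms] by (auto simp: set_pmf_eq)
  then show "s \<in> {1..t}" using assms(3) by (auto simp: attach_prob_def split: if_splits)
qed

lemma H1_Suc_support:
  assumes "a > 0" "G \<in> set_pmf (H1 a (Suc n))"
  shows "\<exists>G0\<in>set_pmf (H1 a n). \<exists>s\<in>{1..Suc n}. G = add_mset {#Suc n, s#} G0"
proof (cases n)
  case 0
  then show ?thesis using assms(2) by auto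
next
  case (Suc m)
  then obtain G0 s where "G0 \<in> set_pmf (H1 a n)" "s \<in> set_pmf (attach_pmf a (Suc n) G0)"
    "G = add_mset {#Suc n, s#} G0"
    using assms(2) by auto
  then show ?thesis
    using set_pmf_attach_pmf[OF assms(1), of "Suc n" G0] wf_graph_H1'[OF assms(1), of G0 n] Suc
    by (intro bexI[of _ G0] bexI[of _ s]) auto
qed

lemma finite_set_pmf_H1:
  assumes "a > 0"
  shows "finite (set_pmf (H1 a n))"
proof (induction n)
  case (Suc n)
  have "set_pmf (H1 a (Suc n)) \<subseteq> (\<lambda>(G, s). add_mset {#Suc n, s#} G) ` (set_pmf (H1 a n) \<times> {1..Suc n})"
    using H1_Suc_support[OF assms] by fastforce
  then show ?case using Suc by (meson finite_SigmaI finite_atLeastAtMost finite_imageI finite_subset)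
qed simp

lemma expectation_H1_Suc:
  fixes F :: "mgraph \<Rightarrow> real"
  assumes "a > 0"
  shows "measure_pmf.expectation (H1 a (Suc n)) F
    = measure_pmf.expectation (H1 a n)
        (\<lambda>G. \<Sum>s\<in>{1..Suc n}. attach_prob a (Suc n) G s * F (add_mset {#Suc n, s#} G))"
proof (cases n)
  case 0
  \<comment> \<open>The dummy at time 0 obeys the general rule: node 1 can only choose itself, with
    probability \<open>a / ((a + 1) - 1) = 1\<close>.\<close>
  then show ?thesis using assms by (simp add: attach_prob_def)
next
  case (Suc m)
  let ?S = "set_pmf (H1 a n)"
  have fin: "finite ?S" by (rule finite_set_pmf_H1[OF assms])
  have wf: "wf_graph (Suc n - 1) G" if "G \<in> ?S" for G
    using wf_graph_H1'[OF assms that] by simp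
  have *: "finite (set_pmf (map_pmf (\<lambda>s. add_mset {#Suc n, s#} G) (attach_pmf a (Suc n) G)))"
    if "G \<in> ?S" for G
    using set_pmf_attach_pmf[OF assms wf[OF that]] Suc
    by (simp add: finite_subset)
  have "measure_pmf.expectation (H1 a (Suc n)) F
     = (\<Sum>G\<in>?S. pmf (H1 a n) G *\<^sub>R measure_pmf.expectation
          (map_pmf (\<lambda>s. add_mset {#Suc n, s#} G) (attach_pmf a (Suc n) G)) F)"
  proof -
    have "H1 a (Suc n) = H1 a n \<bind> (\<lambda>G. map_pmf (\<lambda>s. add_mset {#Suc n, s#} G) (attach_pmf a (Suc n) G))"
      by (simp add: Suc)
    then show ?thesis
      using pmf_expectation_bind[OF fin *, where p = "H1 a n" and h = F] by simp
  qed
  also have "\<dots> = (\<Sum>G\<in>?S. pmf (H1 a n) G *\<^sub>R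
        (\<Sum>s\<in>{1..Suc n}. attach_prob a (Suc n) G s * F (add_mset {#Suc n, s#} G)))"
  proof (intro sum.cong refl arg_cong2[where f = scaleR])
    fix G assume G: "G \<in> ?S"
    have "measure_pmf.expectation (map_pmf (\<lambda>s. add_mset {#Suc n, s#} G) (attach_pmf a (Suc n) G)) F
      = (\<Sum>s\<in>{1..Suc n}. pmf (attach_pmf a (Suc n) G) s *\<^sub>R F (add_mset {#Suc n, s#} G))"
      using set_pmf_attach_pmf[OF assms wf[OF G]] Suc
      by (subst integral_map_pmf, subst integral_measure_pmf[where A = "{1..Suc n}"]) auto
    then show "measure_pmf.expectation (map_pmf (\<lambda>s. add_mset {#Suc n, s#} G) (attach_pmf a (Suc n) G)) F
      = (\<Sum>s\<in>{1..Suc n}. attach_prob a (Suc n) G s * F (add_mset {#Suc n, s#} G))"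
      using pmf_attach_pmf_wf[OF assms wf[OF G]] Suc by simp
  qed
  also have "\<dots> = measure_pmf.expectation (H1 a n)
        (\<lambda>G. \<Sum>s\<in>{1..Suc n}. attach_prob a (Suc n) G s * F (add_mset {#Suc n, s#} G))"
    using fin by (subst integral_measure_pmf[where A = ?S]) auto
  finally show ?thesis .
qed

text \<open>Nodes beyond \<open>c\<close> have degree 0 until time \<open>c\<close>, and each of the
  \<open>n - c\<close> later steps adds two endpoints. For the nodes of one block this gives a
  degree bound at its completion that does not depend on time.\<close>

lemma sum_deg_late_nodes_le:
  assumes "a > 0" "G \<in> set_pmf (H1 a n)" "c \<le> n"
  shows "(\<Sum>s\<in>{c + 1..n}. deg G s) \<le> 2 * (n - c)"
  using assms(2,3)
proof (induction n arbitrary: G)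
  case (Suc n)
  obtain G0 s where G0: "G0 \<in> set_pmf (H1 a n)" and G: "G = add_mset {#Suc n, s#} G0"
    using H1_Suc_support[OF assms(1) Suc.prems(1)] by blast
  show ?case
  proof (cases "c = Suc n")
    case False
    with Suc.prems have c: "c \<le> n" by simp
    have d0: "deg G0 (Suc n) = 0" using wf_graph_H1'[OF assms(1) G0] by (simp add: wf_graph_def)
    have "(\<Sum>x\<in>{c + 1..Suc n}. deg G x)
        = (\<Sum>x\<in>{c + 1..Suc n}. count {#Suc n, s#} x) + (\<Sum>x\<in>{c + 1..Suc n}. deg G0 x)"
      by (simp only: G deg_add_mset sum.distrib)
    also have "(\<Sum>x\<in>{c + 1..Suc n}. count {#Suc n, s#} x) \<le> 2"
      unfolding count_pair_eq sum.distrib by simp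
    also have "(\<Sum>x\<in>{c + 1..Suc n}. deg G0 x) \<le> 2 * (n - c)"
      using Suc.IH[OF G0 c] c d0 by simp
    finally show ?thesis using c by simp
  qed simp
qed simp

section \<open>Ratios of Gamma values\<close>

lemma Gamma_real_plus1: "x > 0 \<Longrightarrow> Gamma (x + 1 :: real) = x * Gamma x"
  by (rule Gamma_plus1) auto

text \<open>Log-convexity of \<open>Gamma\<close>: \<open>x + 1\<close> lies between
  \<open>x\<close> and \<open>x + 1 + a\<close>, and \<open>x + 1 + a\<close> lies between
  \<open>x + 1\<close> and \<open>x + 2 + a\<close>, at ratios involving only \<open>a\<close>. Two
  points of each triple differ by 1, so the functional equation replaces their difference by
  \<open>ln x\<close> or \<open>ln (x + 1 + a)\<close>.\<close>

lemma Gamma_ratio_bounds: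
  fixes x a :: real
  assumes "x > 0" "a > 0"
  shows "x powr a \<le> Gamma (x + 1 + a) / Gamma (x + 1)"
    and "Gamma (x + 1 + a) / Gamma (x + 1) \<le> (x + 1 + a) powr a"
proof -
  define f where "f y = ln (Gamma y)" for y :: real
  have conv: "f ((1 - u) * y + u * z) \<le> (1 - u) * f y + u * f z"
    if "y > 0" "z > 0" "0 \<le> u" "u \<le> 1" for y z u
    using convex_onD[OF log_convex_Gamma_real, of u y z] that by (simp add: f_def)
  have f_Suc: "f (y + 1) = f y + ln y" if "y > 0" for y
  proof -
    show ?thesis
      unfolding f_def Gamma_real_plus1[OF that]
      using ln_mult_pos[OF that Gamma_real_pos[OF that]] by linarith
  qed
  have ratio: "Gamma (x + 1 + a) / Gamma (x + 1) = exp (f (x + 1 + a) - f (x + 1))"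
    using Gamma_real_pos[of "x + 1 + a"] Gamma_real_pos[of "x + 1"] assms by (simp add: f_def exp_diff)
  have a: "1 + a > 0" using assms by simp
  have "f ((1 - 1 / (1 + a)) * x + 1 / (1 + a) * (x + 1 + a)) \<le> (1 - 1 / (1 + a)) * f x + 1 / (1 + a) * f (x + 1 + a)"
    using assms by (intro conv) auto
  moreover have comb: "(1 - 1 / (1 + a)) * u + 1 / (1 + a) * v = (a * u + v) / (1 + a)" for u v
  proof -
    have "1 - 1 / (1 + a) = a / (1 + a)" using a by (simp add: diff_divide_eq_iff)
    then show ?thesis by (simp add: add_divide_distrib)
  qed
  moreover have "(1 - 1 / (1 + a)) * x + 1 / (1 + a) * (x + 1 + a) = x + 1"
  proof -
    have "a * x + (x + 1 + a) = (1 + a) * (x + 1)" by (simp add: algebra_simps)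
    then show ?thesis unfolding comb using a by simp
  qed
  ultimately have "(1 + a) * f (x + 1) \<le> a * f x + f (x + 1 + a)"
    using a by (simp add: pos_le_divide_eq mult.commute)
  then have lower: "a * ln x \<le> f (x + 1 + a) - f (x + 1)"
    using f_Suc[OF assms(1)] by (simp add: algebra_simps)
  have comb': "(1 - a / (1 + a)) * u + a / (1 + a) * v = (u + a * v) / (1 + a)" for u v
  proof -
    have "1 - a / (1 + a) = 1 / (1 + a)" using a by (simp add: diff_divide_eq_iff)
    then show ?thesis by (simp add: add_divide_distrib)
  qed
  have point: "(1 - a / (1 + a)) * (x + 1) + a / (1 + a) * (x + 1 + a + 1) = x + 1 + a"
  proof -
    have "x + 1 + a * (x + 1 + a + 1) = (1 + a) * (x + 1 + a)" by (simp add: algebra_simps)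
    then show ?thesis unfolding comb' using a by simp
  qed
  have "f ((1 - a / (1 + a)) * (x + 1) + a / (1 + a) * (x + 1 + a + 1))
      \<le> (1 - a / (1 + a)) * f (x + 1) + a / (1 + a) * f (x + 1 + a + 1)"
    using assms by (intro conv) auto
  then have "f (x + 1 + a) \<le> (f (x + 1) + a * f (x + 1 + a + 1)) / (1 + a)"
    unfolding point unfolding comb' .
  then have "(1 + a) * f (x + 1 + a) \<le> f (x + 1) + a * f (x + 1 + a + 1)"
    using a by (subst (asm) pos_le_divide_eq) (simp_all add: mult.commute)
  then have upper: "f (x + 1 + a) - f (x + 1) \<le> a * ln (x + 1 + a)"
    using f_Suc[of "x + 1 + a"] assms by (simp add: algebra_simps)
  show "x powr a \<le> Gamma (x + 1 + a) / Gamma (x + 1)"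
    unfolding ratio using lower assms by (simp add: powr_def)
  show "Gamma (x + 1 + a) / Gamma (x + 1) \<le> (x + 1 + a) powr a"
    unfolding ratio using upper assms by (simp add: powr_def)
qed

text \<open>Both bounds on \<open>\<rho>\<close> follow by telescoping from \<open>x\<close> to infinity, where the ratio tends to 1.\<close>

lemma Gamma_cross_ratio_bounds:
  fixes x a b :: real
  assumes "x > 0" "a > 0" "b > 0"
  defines "\<rho> \<equiv> \<lambda>x. Gamma (x + 1) * Gamma (x + b + a + 1) / (Gamma (x + a + 1) * Gamma (x + b + 1))"
  shows "1 \<le> \<rho> x" and "\<rho> x - 1 \<le> \<rho> x * (a * b / x)"
proof -
  have pos: "\<rho> y > 0" if "y > 0" for y
    unfolding \<rho>_def using that assms by (intro divide_pos_pos mult_pos_pos Gamma_real_pos) auto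
  have rec: "\<rho> y = \<rho> (y + 1) * (1 + a * b / ((y + 1) * (y + b + a + 1)))" if "y > 0" for y
  proof -
    have G: "Gamma (y + 1 + 1) = (y + 1) * Gamma (y + 1)"
      "Gamma (y + 1 + b + a + 1) = (y + b + a + 1) * Gamma (y + b + a + 1)"
      "Gamma (y + 1 + a + 1) = (y + a + 1) * Gamma (y + a + 1)"
      "Gamma (y + 1 + b + 1) = (y + b + 1) * Gamma (y + b + 1)"
    proof -
      have e: "y + 1 + b + a + 1 = (y + b + a + 1) + 1" "y + 1 + a + 1 = (y + a + 1) + 1"
        "y + 1 + b + 1 = (y + b + 1) + 1" by simp_all
      show "Gamma (y + 1 + 1) = (y + 1) * Gamma (y + 1)"
        "Gamma (y + 1 + b + a + 1) = (y + b + a + 1) * Gamma (y + b + a + 1)"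
        "Gamma (y + 1 + a + 1) = (y + a + 1) * Gamma (y + a + 1)"
        "Gamma (y + 1 + b + 1) = (y + b + 1) * Gamma (y + b + 1)"
        unfolding e using that assms(2,3) by (intro Gamma_real_plus1; simp)+
    qed
    have "1 + a * b / ((y + 1) * (y + b + a + 1)) = (y + a + 1) * (y + b + 1) / ((y + 1) * (y + b + a + 1))"
      using that assms(2,3) by (simp add: divide_simps) (simp add: algebra_simps)
    moreover have "g1 * g2 / (g3 * g4) = (y + 1) * g1 * ((y + b + a + 1) * g2) / ((y + a + 1) * g3 * ((y + b + 1) * g4))
        * ((y + a + 1) * (y + b + 1) / ((y + 1) * (y + b + a + 1)))" if "g3 > 0" "g4 > 0" for g1 g2 g3 g4 :: real
      using that \<open>y > 0\<close> assms(2,3) by simp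
    ultimately show ?thesis
      unfolding \<rho>_def G using that assms(2,3) by (metis Gamma_real_pos add_pos_pos zero_less_one)
  qed
  \<comment> \<open>As a quotient of two Gamma ratios, \<open>\<rho>\<close> is squeezed between
    quotients of powers with the same exponent.\<close>
  have lim: "(\<lambda>n. ln (\<rho> (x + real n))) \<longlonglongrightarrow> 0"
  proof -
    have eq: "\<rho> y = (Gamma (y + b + 1 + a) / Gamma (y + b + 1)) / (Gamma (y + 1 + a) / Gamma (y + 1))" if "y > 0" for y
      unfolding \<rho>_def by (simp add: add_ac mult_ac)
    have lb: "(y + b) powr a / (y + 1 + a) powr a \<le> \<rho> y" if "y > 0" for y
      unfolding eq[OF that] using that assms Gamma_ratio_bounds[of "y + b" a] Gamma_ratio_bounds[of y a]
      by (intro frac_le) (auto intro!: divide_pos_pos Gamma_real_pos)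
    have ub: "\<rho> y \<le> (y + b + 1 + a) powr a / y powr a" if "y > 0" for y
      unfolding eq[OF that] using that assms Gamma_ratio_bounds[of "y + b" a] Gamma_ratio_bounds[of y a]
      by (intro frac_le) auto
    have "(\<lambda>n. \<rho> (x + real n)) \<longlonglongrightarrow> 1"
    proof (rule tendsto_sandwich)
      show "\<forall>\<^sub>F n in sequentially. (x + real n + b) powr a / (x + real n + 1 + a) powr a \<le> \<rho> (x + real n)"
        "\<forall>\<^sub>F n in sequentially. \<rho> (x + real n) \<le> (x + real n + b + 1 + a) powr a / (x + real n) powr a"
        using lb ub assms(1) by (auto intro!: always_eventually)
      show "(\<lambda>n. (x + real n + b) powr a / (x + real n + 1 + a) powr a) \<longlonglongrightarrow> 1" by real_asymp
      show "(\<lambda>n. (x + real n + b + 1 + a) powr a / (x + real n) powr a) \<longlonglongrightarrow> 1" by real_asymp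
    qed
    then have "(\<lambda>n. ln (\<rho> (x + real n))) \<longlonglongrightarrow> ln 1" by (intro tendsto_ln) auto
    then show ?thesis by simp
  qed
  have ln_rec: "ln (\<rho> y) = ln (\<rho> (y + 1)) + ln (1 + a * b / ((y + 1) * (y + b + a + 1)))" if "y > 0" for y
  proof -
    have "0 < 1 + a * b / ((y + 1) * (y + b + a + 1))"
      using that assms(2,3) by (intro add_pos_nonneg) auto
    then show ?thesis using rec[OF that] pos[of "y + 1"] that by (metis add_pos_pos ln_mult_pos zero_less_one)
  qed
  have "0 \<le> ln (\<rho> x)"
  proof -
    have "decseq (\<lambda>n. ln (\<rho> (x + real n)))"
    proof (rule decseq_SucI)
      fix n
      have "x + real n > 0" using assms(1) by simp
      moreover from this have "0 \<le> ln (1 + a * b / ((x + real n + 1) * (x + real n + b + a + 1)))"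
        using assms(2,3) by (intro ln_ge_zero) auto
      ultimately show "ln (\<rho> (x + real (Suc n))) \<le> ln (\<rho> (x + real n))"
        using ln_rec[of "x + real n"] by (simp add: add_ac)
    qed
    from decseq_ge[OF this lim, of 0] show ?thesis by simp
  qed
  then show "1 \<le> \<rho> x" using pos[OF assms(1)] by (simp add: ln_ge_zero_iff)
  have "ln (\<rho> x) \<le> a * b / x"
  proof -
    have "incseq (\<lambda>n. ln (\<rho> (x + real n)) - a * b / (x + real n))"
    proof (rule incseq_SucI)
      fix n
      define y where "y = x + real n"
      have y: "y > 0" using assms(1) by (simp add: y_def)
      have "ln (1 + a * b / ((y + 1) * (y + b + a + 1))) \<le> a * b / ((y + 1) * (y + b + a + 1))"
        using y assms(2,3) by (intro ln_add_one_self_le_self) auto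
      \<comment> \<open>Dropping \<open>b + a\<close> from the last factor makes the increments
        telescope.\<close>
      also have "\<dots> \<le> a * b / ((y + 1) * y)"
        using y assms(2,3) by (intro divide_left_mono mult_left_mono mult_pos_pos) auto
      also have "\<dots> = a * b / y - a * b / (y + 1)"
        using y by (simp add: field_simps)
      finally have "ln (\<rho> y) - a * b / y \<le> ln (\<rho> (y + 1)) - a * b / (y + 1)"
        using ln_rec[OF y] by linarith
      then show "ln (\<rho> (x + real n)) - a * b / (x + real n) \<le> ln (\<rho> (x + real (Suc n))) - a * b / (x + real (Suc n))"
        by (simp add: y_def add_ac)
    qed
    moreover have "(\<lambda>n. ln (\<rho> (x + real n)) - a * b / (x + real n)) \<longlonglongrightarrow> 0 - 0"
      by (intro tendsto_diff lim) real_asymp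
    ultimately show ?thesis using incseq_le[of _ "0 - 0" 0] by fastforce
  qed
  \<comment> \<open>Using this inequality instead of exponentiating keeps a factor
    \<open>\<rho> x\<close> on the right, which later combines into \<open>upper_at\<close>.\<close>
  moreover have "1 - 1 / \<rho> x \<le> ln (\<rho> x)"
    using ln_le_minus_one[of "1 / \<rho> x"] pos[OF assms(1)] by (simp add: ln_div)
  ultimately have "\<rho> x * (1 - 1 / \<rho> x) \<le> \<rho> x * (a * b / x)"
    using pos[OF assms(1)] by (intro mult_left_mono) auto
  then show "\<rho> x - 1 \<le> \<rho> x * (a * b / x)"
    using pos[OF assms(1)] by (simp add: right_diff_distrib)
qed

text \<open>A convergent sequence is bounded, so first-order expansions of both envelopes give a
  bound \<open>C / n\<close> for everything in between. The two limits need not agree.\<close>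

lemma deviation_bound_from_limits:
  fixes l u :: "nat \<Rightarrow> real"
  assumes "(\<lambda>n. real n * (l n - 1)) \<longlonglongrightarrow> A" "(\<lambda>n. real n * (u n - 1)) \<longlonglongrightarrow> B"
  shows "\<exists>C\<ge>0. \<forall>n\<ge>1. \<forall>x. l n \<le> x \<longrightarrow> x \<le> u n \<longrightarrow> \<bar>x - 1\<bar> \<le> C / real n"
proof -
  obtain C1 where C1: "C1 > 0" "\<And>n. norm (real n * (l n - 1)) \<le> C1"
    using convergent_imp_Bseq[OF convergentI[OF assms(1)]] by (auto elim: BseqE)
  obtain C2 where C2: "C2 > 0" "\<And>n. norm (real n * (u n - 1)) \<le> C2"
    using convergent_imp_Bseq[OF convergentI[OF assms(2)]] by (auto elim: BseqE)
  have "\<bar>x - 1\<bar> \<le> (C1 + C2) / real n" if "n \<ge> 1" "l n \<le> x" "x \<le> u n" for n x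
  proof -
    have "real n * (l n - 1) \<le> real n * (x - 1)" "real n * (x - 1) \<le> real n * (u n - 1)"
      using that by (intro mult_left_mono; simp)+
    then have "\<bar>real n * (x - 1)\<bar> \<le> C1 + C2"
      using C1(1) C1(2)[of n] C2(1) C2(2)[of n] unfolding real_norm_def by linarith
    then show ?thesis using that(1) by (simp add: abs_mult pos_le_divide_eq mult.commute)
  qed
  then show ?thesis using C1(1) C2(1) by (intro exI[of _ "C1 + C2"]) auto
qed

text \<open>The quadratic cross term is made linear in \<open>E\<close> by the a priori bound
  \<open>M\<close>; this lets relative errors be multiplied one factor at a time.\<close>

lemma abs_mult_minus_one_le:
  fixes u v A B E :: real
  assumes "\<bar>u - 1\<bar> \<le> A * E" "\<bar>v - 1\<bar> \<le> B * E" "0 \<le> E" "E \<le> M" "0 \<le> A" "0 \<le> B"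
  shows "\<bar>u * v - 1\<bar> \<le> (A + B + M * A * B) * E"
proof -
  have "\<bar>(u - 1) * (v - 1)\<bar> \<le> (A * E) * (B * E)"
    unfolding abs_mult using assms by (intro mult_mono) auto
  also have "\<dots> = (A * B * E) * E" by simp
  also have "\<dots> \<le> (A * B * E) * M" using assms by (intro mult_left_mono) auto
  finally have "\<bar>(u - 1) * (v - 1)\<bar> \<le> M * A * B * E" by (simp add: mult_ac)
  moreover have "u * v - 1 = (u - 1) * (v - 1) + (u - 1) + (v - 1)" by (simp add: algebra_simps)
  moreover have "(A + B + M * A * B) * E = M * A * B * E + A * E + B * E" by (simp add: distrib_right)
  ultimately show ?thesis using assms(1,2) by linarith
qed

section \<open>The merged Markov chain\<close>

locale buckley_osthus =
  fixes a :: real and k :: nat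
  assumes a_pos: "a > 0" and k_pos: "k \<ge> 1"
begin

definition supp :: "nat \<Rightarrow> mgraph set" where
  "supp n = merge_nodes k ` set_pmf (H1 a n)"

text \<open>\<open>H a k t\<close> only sees the times \<open>k * t\<close>, while the recurrences
  pass through every time \<open>n\<close>; hence the expectation is over \<open>H1 a n\<close> and
  merging is applied inside.\<close>

definition Ex :: "nat \<Rightarrow> (mgraph \<Rightarrow> real) \<Rightarrow> real" where
  "Ex n F = measure_pmf.expectation (H1 a n) (\<lambda>G. F (merge_nodes k G))"

text \<open>
  \<open>D n\<close> is the denominator of the attachment probabilities in the step from time \<open>n\<close> to time \<open>n + 1\<close>.
  At time \<open>n\<close> the blocks \<open>1, \<dots>, n div k\<close> are complete and block \<open>n div k + 1\<close> has \<open>n mod k\<close> nodes, to which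
  the new node is added.
\<close>

definition D :: "nat \<Rightarrow> real" where
  "D n = (a + 1) * real (Suc n) - 1"

definition w :: "nat \<Rightarrow> real" where
  "w d = real d - real k + real k * a"

text \<open>In the second case the \<open>n mod k\<close> nodes already in the block contribute
  their degree plus \<open>a - 1\<close> each, and the new node contributes
  \<open>a\<close>.\<close>

definition p :: "nat \<Rightarrow> mgraph \<Rightarrow> nat \<Rightarrow> real" where
  "p n M j = (if j \<le> n div k then w (deg M j)
     else real (deg M j) - real (n mod k) + (real (n mod k) + 1) * a) / D n"

lemma D_ge: "D n \<ge> a * real (Suc n)"
  by (simp add: D_def algebra_simps)

lemma D_pos: "D n > 0"
  using D_ge[of n] a_pos by (smt (verit) mult_pos_pos of_nat_0_less_iff zero_less_Suc)

lemma integrable_H1: "integrable (measure_pmf (H1 a n)) (F :: mgraph \<Rightarrow> real)"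
  by (intro integrable_measure_pmf_finite finite_set_pmf_H1 a_pos)

lemma Ex_add: "Ex n (\<lambda>M. F M + G M) = Ex n F + Ex n G"
  unfolding Ex_def by (intro Bochner_Integration.integral_add integrable_H1)

lemma Ex_diff: "Ex n (\<lambda>M. F M - G M) = Ex n F - Ex n G"
  unfolding Ex_def by (intro Bochner_Integration.integral_diff integrable_H1)

lemma Ex_cmult: "Ex n (\<lambda>M. c * F M) = c * Ex n F"
  unfolding Ex_def by simp

lemma Ex_divide: "Ex n (\<lambda>M. F M / c) = Ex n F / c"
  unfolding Ex_def by simp

lemma Ex_const: "Ex n (\<lambda>M. c) = c"
  unfolding Ex_def by simp

lemma Ex_mono: "(\<And>M. M \<in> supp n \<Longrightarrow> F M \<le> G M) \<Longrightarrow> Ex n F \<le> Ex n G"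
  unfolding Ex_def supp_def by (intro integral_mono_AE integrable_H1) (auto simp: AE_measure_pmf_iff)

lemma Ex_cong: "(\<And>M. M \<in> supp n \<Longrightarrow> F M = G M) \<Longrightarrow> Ex n F = Ex n G"
  by (intro antisym Ex_mono) auto

lemma Ex_nonneg: "(\<And>M. M \<in> supp n \<Longrightarrow> 0 \<le> F M) \<Longrightarrow> 0 \<le> Ex n F"
  using Ex_mono[of n "\<lambda>_. 0" F] by (simp add: Ex_const)

lemma Ex_le_const: "(\<And>M. M \<in> supp n \<Longrightarrow> F M \<le> c) \<Longrightarrow> Ex n F \<le> c"
  using Ex_mono[of n F "\<lambda>_. c"] by (simp add: Ex_const)

section \<open>Attachment probabilities of blocks\<close>

lemma block_Suc: "block k (Suc n) = Suc (n div k)"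
  by (simp add: block_def)

lemma deg_merged:
  assumes "G \<in> set_pmf (H1 a n)"
  shows "deg (merge_nodes k G) j = (\<Sum>s\<in>{s \<in> {1..n}. block k s = j}. deg G s)"
  using wf_graph_H1'[OF a_pos assms] by (intro deg_merge_nodes) (auto simp: wf_graph_def)

lemma complete_block_nodes:
  assumes "1 \<le> j" "j \<le> n div k"
  shows "{s \<in> {1..n}. block k s = j} = {k * (j - 1) + 1..k * j}"
    and "k * j \<le> n" and "card {k * (j - 1) + 1..k * j} = k"
proof -
  show le: "k * j \<le> n"
    using assms(2) k_pos less_eq_div_iff_mult_less_eq[of k j n] by (simp add: mult.commute)
  then show "{s \<in> {1..n}. block k s = j} = {k * (j - 1) + 1..k * j}"
    using nodes_of_block[OF k_pos assms(1), of n] by (simp add: min_def)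
  show "card {k * (j - 1) + 1..k * j} = k"
    using assms(1) by (cases j) auto
qed

lemma partial_block_nodes:
  shows "{s \<in> {1..n}. block k s = Suc (n div k)} = {k * (n div k) + 1..n}"
    and "card {k * (n div k) + 1..n} = n mod k"
proof -
  have "n < k * Suc (n div k)"
    using k_pos by (simp add: dividend_less_times_div)
  then show "{s \<in> {1..n}. block k s = Suc (n div k)} = {k * (n div k) + 1..n}"
    using nodes_of_block[OF k_pos, of "Suc (n div k)" n] by (simp add: min_def)
  show "card {k * (n div k) + 1..n} = n mod k"
    by (simp add: minus_mult_div_eq_mod)
qed

text \<open>This makes the merged graph a Markov chain: node weights are affine in the degree, so
  their sum over a block depends only on the degree and the number of nodes of the block.\<close>

lemma sum_attach_prob_block:
  assumes G: "G \<in> set_pmf (H1 a n)" and j: "j \<in> {1..Suc (n div k)}"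
  shows "(\<Sum>s\<in>{s \<in> {1..Suc n}. block k s = j}. attach_prob a (Suc n) G s) = p n (merge_nodes k G) j"
proof (cases "j \<le> n div k")
  case True
  with j have j': "1 \<le> j" "j \<le> n div k" "j \<noteq> Suc (n div k)" by auto
  let ?B = "{k * (j - 1) + 1..k * j}"
  have "{s \<in> {1..Suc n}. block k s = j} = {s \<in> {1..n}. block k s = j}"
    using block_Suc[of n] j'(3) by (auto simp: le_Suc_eq)
  also have "\<dots> = ?B" by (rule complete_block_nodes[OF j'(1,2)])
  finally have "(\<Sum>s\<in>{s \<in> {1..Suc n}. block k s = j}. attach_prob a (Suc n) G s)
     = (\<Sum>s\<in>?B. attach_prob a (Suc n) G s)" by simp
  also have "\<dots> = (\<Sum>s\<in>?B. (real (deg G s) + (a - 1)) / D n)"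
    using complete_block_nodes(2)[OF j'(1,2)]
    by (intro sum.cong) (auto simp: attach_prob_def D_def)
  also have "\<dots> = ((\<Sum>s\<in>?B. real (deg G s)) + real k * (a - 1)) / D n"
    using complete_block_nodes(3)[OF j'(1,2)]
    by (simp add: sum_divide_distrib [symmetric] sum.distrib)
  also have "(\<Sum>s\<in>?B. real (deg G s)) = real (deg (merge_nodes k G) j)"
    unfolding deg_merged[OF G] complete_block_nodes(1)[OF j'(1,2)] by simp
  finally show ?thesis using True by (simp add: p_def w_def algebra_simps)
next
  case False
  with j have j': "j = Suc (n div k)" by auto
  let ?B = "{k * (n div k) + 1..n}"
  have "{s \<in> {1..Suc n}. block k s = j} = insert (Suc n) {s \<in> {1..n}. block k s = j}"
    using block_Suc[of n] j' by (auto simp: le_Suc_eq)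
  also have "\<dots> = insert (Suc n) ?B" using partial_block_nodes(1) j' by simp
  finally have "(\<Sum>s\<in>{s \<in> {1..Suc n}. block k s = j}. attach_prob a (Suc n) G s)
     = attach_prob a (Suc n) G (Suc n) + (\<Sum>s\<in>?B. attach_prob a (Suc n) G s)" by simp
  also have "(\<Sum>s\<in>?B. attach_prob a (Suc n) G s) = (\<Sum>s\<in>?B. (real (deg G s) + (a - 1)) / D n)"
    by (intro sum.cong) (auto simp: attach_prob_def D_def)
  also have "\<dots> = ((\<Sum>s\<in>?B. real (deg G s)) + real (n mod k) * (a - 1)) / D n"
    using partial_block_nodes(2)[of n]
    by (simp add: sum_divide_distrib [symmetric] sum.distrib)
  also have "attach_prob a (Suc n) G (Suc n) = a / D n"
    by (simp add: attach_prob_def D_def)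
  also have "(\<Sum>s\<in>?B. real (deg G s)) = real (deg (merge_nodes k G) j)"
    unfolding deg_merged[OF G] j' partial_block_nodes(1) by simp
  finally show ?thesis using False
    by (simp add: p_def add_divide_distrib [symmetric] algebra_simps)
qed

lemma sum_attach_prob_block_image:
  assumes G: "G \<in> set_pmf (H1 a n)"
  shows "(\<Sum>s\<in>{1..Suc n}. attach_prob a (Suc n) G s * \<Phi> (block k s))
    = (\<Sum>j\<in>{1..Suc (n div k)}. p n (merge_nodes k G) j * \<Phi> j)"
proof -
  have "block k ` {1..Suc n} \<subseteq> {1..Suc (n div k)}"
    by (auto simp: block_def intro!: div_le_mono)
  then have "(\<Sum>s\<in>{1..Suc n}. attach_prob a (Suc n) G s * \<Phi> (block k s))
    = (\<Sum>j\<in>{1..Suc (n div k)}. \<Sum>s\<in>{s \<in> {1..Suc n}. block k s = j}. attach_prob a (Suc n) G s * \<Phi> (block k s))"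
    by (subst sum.group) auto
  also have "\<dots> = (\<Sum>j\<in>{1..Suc (n div k)}. (\<Sum>s\<in>{s \<in> {1..Suc n}. block k s = j}. attach_prob a (Suc n) G s) * \<Phi> j)"
    by (intro sum.cong refl) (simp add: sum_distrib_right)
  also have "\<dots> = (\<Sum>j\<in>{1..Suc (n div k)}. p n (merge_nodes k G) j * \<Phi> j)"
    using sum_attach_prob_block[OF G] by (intro sum.cong refl) simp
  finally show ?thesis .
qed

lemma Ex_Suc:
  "Ex (Suc n) F = Ex n (\<lambda>M. \<Sum>j\<in>{1..Suc (n div k)}. p n M j * F (add_mset {#Suc (n div k), j#} M))"
  unfolding Ex_def expectation_H1_Suc[OF a_pos] merge_nodes_add_mset block_Suc
proof (intro integral_cong_AE)
  show "AE G in measure_pmf (H1 a n).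
      (\<Sum>s\<in>{1..Suc n}. attach_prob a (Suc n) G s
        * F (add_mset {#Suc (n div k), block k s#} (merge_nodes k G)))
    = (\<Sum>j\<in>{1..Suc (n div k)}. p n (merge_nodes k G) j
        * F (add_mset {#Suc (n div k), j#} (merge_nodes k G)))"
    unfolding AE_measure_pmf_iff by (intro ballI sum_attach_prob_block_image)
qed auto

lemma sum_p:
  assumes "M \<in> supp n"
  shows "(\<Sum>j\<in>{1..Suc (n div k)}. p n M j) = 1"
proof -
  from assms obtain G where G: "G \<in> set_pmf (H1 a n)" and M: "M = merge_nodes k G"
    by (auto simp: supp_def)
  have "(\<Sum>j\<in>{1..Suc (n div k)}. p n M j) = (\<Sum>s\<in>{1..Suc n}. attach_prob a (Suc n) G s)"
    using sum_attach_prob_block_image[OF G, of "\<lambda>_. 1"] M by simp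
  also have "\<dots> = 1"
  proof (cases "n = 0")
    case True
    then show ?thesis using a_pos by (simp add: attach_prob_def)
  next
    case False
    then show ?thesis using attach_prob_sum[OF a_pos, of "Suc n" G] wf_graph_H1'[OF a_pos G] by simp
  qed
  finally show ?thesis .
qed

section \<open>Degrees of blocks on the support\<close>

lemma sum_pred_deg:
  assumes "G \<in> set_pmf (H1 a n)"
  shows "(\<Sum>s\<in>{1..n}. deg G s - 1) = n"
proof -
  have wf: "wf_graph n G" by (rule wf_graph_H1'[OF a_pos assms])
  have "(\<Sum>s\<in>{1..n}. deg G s - 1) = (\<Sum>s\<in>{1..n}. deg G s) - (\<Sum>s\<in>{1..n}. 1)"
    using wf by (intro sum_subtractf_nat) (auto simp: wf_graph_def)
  also have "\<dots> = n" using wf by (simp add: wf_graph_def)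
  finally show ?thesis .
qed

text \<open>Apart from the one degree that each node brings, the excesses \<open>deg G s - 1\<close>
  of all nodes share the total \<open>n\<close> (\<open>sum_pred_deg\<close>). Block degrees written
  as excess plus \<open>k\<close> thus draw on a common budget.\<close>

lemma deg_complete_block:
  assumes G: "G \<in> set_pmf (H1 a n)" and j: "1 \<le> j" "j \<le> n div k"
  shows "deg (merge_nodes k G) j = (\<Sum>s\<in>{s \<in> {1..n}. block k s = j}. deg G s - 1) + k"
proof -
  have wf: "wf_graph n G" by (rule wf_graph_H1'[OF a_pos G])
  have "deg (merge_nodes k G) j = (\<Sum>s\<in>{s \<in> {1..n}. block k s = j}. (deg G s - 1) + 1)"
    using wf unfolding deg_merged[OF G]
    by (intro sum.cong refl le_add_diff_inverse2 [symmetric]) (auto simp: wf_graph_def)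
  then show ?thesis
    unfolding sum.distrib using complete_block_nodes[OF j] by simp
qed

lemma deg_ge:
  assumes "M \<in> supp n" "1 \<le> j" "j \<le> n div k"
  shows "k \<le> deg M j"
  using assms by (auto simp: supp_def deg_complete_block)

lemma deg_le:
  assumes "M \<in> supp n" "1 \<le> j" "j \<le> n div k"
  shows "deg M j \<le> n + k"
proof -
  from assms obtain G where G: "G \<in> set_pmf (H1 a n)" and M: "M = merge_nodes k G"
    by (auto simp: supp_def)
  have "(\<Sum>s\<in>{s \<in> {1..n}. block k s = j}. deg G s - 1) \<le> (\<Sum>s\<in>{1..n}. deg G s - 1)"
    by (intro sum_mono2) auto
  then show ?thesis
    unfolding M deg_complete_block[OF G assms(2,3)] sum_pred_deg[OF G] by simp
qed

text \<open>Disjoint blocks draw on the same budget \<open>n\<close>. Adding two single bounds would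
  give about \<open>2 * n\<close>, too much for \<open>late_weight_pair\<close> when
  \<open>a\<close> is small.\<close>

lemma deg_pair_le:
  assumes "M \<in> supp n" "1 \<le> i" "i \<le> n div k" "1 \<le> j" "j \<le> n div k" "i \<noteq> j"
  shows "deg M i + deg M j \<le> n + 2 * k"
proof -
  from assms obtain G where G: "G \<in> set_pmf (H1 a n)" and M: "M = merge_nodes k G"
    by (auto simp: supp_def)
  let ?f = "\<lambda>s. deg G s - 1" and ?B = "\<lambda>j. {s \<in> {1..n}. block k s = j}"
  have "sum ?f (?B i) + sum ?f (?B j) = sum ?f (?B i \<union> ?B j)"
    using assms(6) by (intro sum.union_disjoint [symmetric]) auto
  also have "\<dots> \<le> sum ?f {1..n}"
    by (intro sum_mono2) auto
  finally show ?thesis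
    unfolding M deg_complete_block[OF G assms(2,3)] deg_complete_block[OF G assms(4,5)] sum_pred_deg[OF G]
    by simp
qed

lemma deg_late_block_le:
  assumes "M \<in> supp n" "k * c \<le> n"
  shows "deg M (Suc c) \<le> 2 * (n - k * c)"
proof -
  from assms obtain G where G: "G \<in> set_pmf (H1 a n)" and M: "M = merge_nodes k G"
    by (auto simp: supp_def)
  have "{s \<in> {1..n}. block k s = Suc c} = {k * c + 1..min n (k * Suc c)}"
    using nodes_of_block[OF k_pos, of "Suc c" n] by simp
  then have "deg M (Suc c) \<le> (\<Sum>s\<in>{k * c + 1..n}. deg G s)"
    unfolding M deg_merged[OF G] by (intro sum_mono2) auto
  also have "\<dots> \<le> 2 * (n - k * c)"
    by (rule sum_deg_late_nodes_le[OF a_pos G assms(2)])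
  finally show ?thesis .
qed

lemma deg_partial_ge:
  assumes "M \<in> supp n"
  shows "n mod k \<le> deg M (Suc (n div k))"
proof -
  from assms obtain G where G: "G \<in> set_pmf (H1 a n)" and M: "M = merge_nodes k G"
    by (auto simp: supp_def)
  have "n mod k = (\<Sum>s\<in>{k * (n div k) + 1..n}. 1)"
    using partial_block_nodes(2)[of n] by simp
  also have "\<dots> \<le> (\<Sum>s\<in>{k * (n div k) + 1..n}. deg G s)"
    using wf_graph_H1'[OF a_pos G] by (intro sum_mono) (auto simp: wf_graph_def)
  finally show ?thesis
    unfolding M deg_merged[OF G] using partial_block_nodes(1)[of n] by simp
qed

text \<open>The unfinished block has bounded degree, so an edge stays inside it only with
  probability of order \<open>1 / D n\<close>. Nonnegativity uses that each of its nodes has degree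
  at least 1.\<close>

lemma p_partial:
  assumes "M \<in> supp n"
  shows "0 \<le> p n M (Suc (n div k))" and "p n M (Suc (n div k)) \<le> real k * (a + 1) / D n"
proof -
  let ?i = "n mod k"
  have i: "?i < k" using k_pos by simp
  have "n - k * (n div k) = ?i" by (simp add: minus_mult_div_eq_mod)
  then have le: "deg M (Suc (n div k)) \<le> 2 * ?i"
    using deg_late_block_le[OF assms, of "n div k"] by simp
  have eq: "p n M (Suc (n div k)) = (real (deg M (Suc (n div k))) - real ?i + (real ?i + 1) * a) / D n"
    by (simp add: p_def)
  show "0 \<le> p n M (Suc (n div k))"
    unfolding eq using deg_partial_ge[OF assms] a_pos D_pos[of n] by simp
  have "(real ?i + 1) * a \<le> real k * a"
    using i a_pos by (intro mult_right_mono) auto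
  then have "real (deg M (Suc (n div k))) - real ?i + (real ?i + 1) * a \<le> real k * (a + 1)"
    using le i by (simp add: distrib_left)
  then show "p n M (Suc (n div k)) \<le> real k * (a + 1) / D n"
    unfolding eq using D_pos[of n] by (simp add: divide_right_mono)
qed

text \<open>
  Here \<open>t\<close> is the number of complete blocks: \<open>N\<close> counts those of degree \<open>d\<close>, \<open>Y\<close> the edges between them and
  the block under construction, and \<open>Z\<close> is the paper's \<open>X\<close>.
\<close>

definition N :: "nat \<Rightarrow> nat \<Rightarrow> mgraph \<Rightarrow> real" where
  "N t d M = (\<Sum>j\<in>{1..t}. of_bool (deg M j = d))"

definition Y :: "nat \<Rightarrow> nat \<Rightarrow> mgraph \<Rightarrow> real" where
  "Y t d M = (\<Sum>j\<in>{1..t}. of_bool (deg M j = d) * real (num_edges M j (Suc t)))"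

definition Z :: "nat \<Rightarrow> nat \<Rightarrow> nat \<Rightarrow> mgraph \<Rightarrow> real" where
  "Z t d1 d2 M = (\<Sum>i\<in>{1..t}. \<Sum>j\<in>{1..t}.
     of_bool (deg M i = d1) * of_bool (deg M j = d2) * (of_bool (i \<noteq> j) * real (num_edges M i j)))"

text \<open>Since the probabilities sum to 1, a statistic that ignores loops at the unfinished block
  changes only through the chosen complete block; the irregular probability of the unfinished block
  drops out.\<close>

lemma Ex_Suc_increment:
  assumes "\<And>M. M \<in> supp n \<Longrightarrow> F (add_mset {#Suc (n div k), Suc (n div k)#} M) = F M"
    and "\<And>M j. M \<in> supp n \<Longrightarrow> j \<in> {1..n div k} \<Longrightarrow>
      F (add_mset {#Suc (n div k), j#} M) = F M + \<Delta> M j"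
  shows "Ex (Suc n) F = Ex n F + Ex n (\<lambda>M. \<Sum>j\<in>{1..n div k}. w (deg M j) * \<Delta> M j) / D n"
proof -
  let ?t = "n div k"
  have split: "{1..Suc ?t} = insert (Suc ?t) {1..?t}" by auto
  have "(\<Sum>j\<in>{1..Suc ?t}. p n M j * F (add_mset {#Suc ?t, j#} M))
    = F M + (\<Sum>j\<in>{1..?t}. w (deg M j) * \<Delta> M j) / D n" if M: "M \<in> supp n" for M
  proof -
    have p: "p n M j = w (deg M j) / D n" if "j \<in> {1..?t}" for j
      using that by (simp add: p_def)
    have "(\<Sum>j\<in>{1..Suc ?t}. p n M j * F (add_mset {#Suc ?t, j#} M))
      = p n M (Suc ?t) * F M + (\<Sum>j\<in>{1..?t}. p n M j * F M + w (deg M j) * \<Delta> M j / D n)"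
      unfolding split using assms M by (simp add: p distrib_left)
    also have "\<dots> = (\<Sum>j\<in>{1..Suc ?t}. p n M j) * F M + (\<Sum>j\<in>{1..?t}. w (deg M j) * \<Delta> M j) / D n"
      unfolding split by (simp add: sum.distrib sum_distrib_right sum_divide_distrib distrib_right)
    finally show ?thesis using sum_p[OF M] by simp
  qed
  then have "Ex (Suc n) F = Ex n (\<lambda>M. F M + (\<Sum>j\<in>{1..?t}. w (deg M j) * \<Delta> M j) / D n)"
    unfolding Ex_Suc by (intro Ex_cong)
  then show ?thesis by (simp add: Ex_add Ex_divide)
qed

lemma w_pred: "d \<ge> 1 \<Longrightarrow> w (d - Suc 0) = w d - 1"
  by (simp add: w_def of_nat_diff)

lemma of_bool_deg_add_mset:
  assumes "d \<ge> 1" "i \<noteq> u"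
  shows "of_bool (deg (add_mset {#u, j#} M) i = d)
    = (of_bool (deg M i = d) + of_bool (i = j) * (of_bool (deg M i = d - 1) - of_bool (deg M i = d)) :: real)"
  using assms by auto

text \<open>The index \<open>n div k\<close> is frozen on both sides; a block completed at this step
  is added separately in \<open>W_Suc\<close>. The gain factor is
  \<open>w (d - 1) = w d - 1\<close>.\<close>

lemma Ex_N_Suc:
  assumes "d \<ge> 1"
  shows "Ex (Suc n) (N (n div k) d) = Ex n (N (n div k) d)
    + ((w d - 1) * Ex n (N (n div k) (d - 1)) - w d * Ex n (N (n div k) d)) / D n"
proof -
  let ?t = "n div k"
  define \<Delta> where "\<Delta> M j = (of_bool (deg M j = d - 1) - of_bool (deg M j = d) :: real)" for M :: mgraph and j
  have "Ex (Suc n) (N ?t d) = Ex n (N ?t d) + Ex n (\<lambda>M. \<Sum>j\<in>{1..?t}. w (deg M j) * \<Delta> M j) / D n"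
  proof (rule Ex_Suc_increment)
    fix M
    show "N ?t d (add_mset {#Suc ?t, Suc ?t#} M) = N ?t d M"
      unfolding N_def by (intro sum.cong) auto
    fix j assume j: "j \<in> {1..?t}"
    have "N ?t d (add_mset {#Suc ?t, j#} M)
      = (\<Sum>i\<in>{1..?t}. of_bool (deg M i = d) + of_bool (i = j) * \<Delta> M i)"
      unfolding N_def \<Delta>_def by (intro sum.cong refl of_bool_deg_add_mset[OF assms]) auto
    then show "N ?t d (add_mset {#Suc ?t, j#} M) = N ?t d M + \<Delta> M j"
      using j by (simp add: sum.distrib N_def of_bool_def if_distrib[of "\<lambda>x. x * _"] sum.delta cong: if_cong)
  qed
  also have "(\<lambda>M. \<Sum>j\<in>{1..?t}. w (deg M j) * \<Delta> M j) = (\<lambda>M. w (d - 1) * N ?t (d - 1) M - w d * N ?t d M)"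
    unfolding N_def \<Delta>_def sum_distrib_left sum_subtractf [symmetric]
    by (intro ext sum.cong) auto
  finally show ?thesis by (simp add: Ex_diff Ex_cmult w_pred[OF assms])
qed

text \<open>A block of degree \<open>d - 1\<close> that is hit gains one degree and, at once, one
  more edge to the unfinished block; this extra edge puts the degree count next to \<open>Y\<close>
  in the gain.\<close>

lemma Ex_Y_Suc:
  assumes "d \<ge> 1"
  shows "Ex (Suc n) (Y (n div k) d) = Ex n (Y (n div k) d)
    + ((w d - 1) * (Ex n (Y (n div k) (d - 1)) + Ex n (N (n div k) (d - 1)))
        - w d * Ex n (Y (n div k) d)) / D n"
proof -
  let ?t = "n div k"
  define e where "e M j = real (num_edges M j (Suc ?t))" for M j
  define \<Delta> where "\<Delta> M j = of_bool (deg M j = d - 1) * (e M j + 1) - of_bool (deg M j = d) * e M j"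
    for M j
  have "Ex (Suc n) (Y ?t d) = Ex n (Y ?t d) + Ex n (\<lambda>M. \<Sum>j\<in>{1..?t}. w (deg M j) * \<Delta> M j) / D n"
  proof (rule Ex_Suc_increment)
    fix M
    show "Y ?t d (add_mset {#Suc ?t, Suc ?t#} M) = Y ?t d M"
      unfolding Y_def by (intro sum.cong) (auto simp: num_edges_add_mset add_eq_conv_ex)
    fix j assume j: "j \<in> {1..?t}"
    have "Y ?t d (add_mset {#Suc ?t, j#} M)
      = (\<Sum>i\<in>{1..?t}. of_bool (deg M i = d) * e M i + of_bool (i = j) * \<Delta> M i)"
      unfolding Y_def
    proof (intro sum.cong refl)
      fix i assume i: "i \<in> {1..?t}"
      have "real (num_edges (add_mset {#Suc ?t, j#} M) i (Suc ?t)) = e M i + of_bool (i = j)"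
        using i j by (auto simp: num_edges_add_mset e_def add_eq_conv_ex)
      moreover have "i \<noteq> Suc ?t" using i by auto
      ultimately show "of_bool (deg (add_mset {#Suc ?t, j#} M) i = d)
          * real (num_edges (add_mset {#Suc ?t, j#} M) i (Suc ?t))
        = of_bool (deg M i = d) * e M i + of_bool (i = j) * \<Delta> M i"
        unfolding of_bool_deg_add_mset[OF assms \<open>i \<noteq> Suc ?t\<close>] by (simp add: \<Delta>_def)
    qed
    then show "Y ?t d (add_mset {#Suc ?t, j#} M) = Y ?t d M + \<Delta> M j"
      using j by (simp add: sum.distrib Y_def e_def of_bool_def if_distrib[of "\<lambda>x. x * _"] sum.delta cong: if_cong)
  qed
  also have "(\<lambda>M. \<Sum>j\<in>{1..?t}. w (deg M j) * \<Delta> M j)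
      = (\<lambda>M. w (d - 1) * (Y ?t (d - 1) M + N ?t (d - 1) M) - w d * Y ?t d M)"
    unfolding N_def Y_def \<Delta>_def e_def sum_distrib_left sum_subtractf [symmetric] sum.distrib [symmetric]
    by (intro ext sum.cong) (auto simp: distrib_left)
  finally show ?thesis by (simp add: Ex_diff Ex_cmult Ex_add w_pred[OF assms])
qed

text \<open>The new edge ends in the unfinished block, so \<open>Z\<close> changes only because one
  endpoint block moves to the next degree.\<close>

lemma Ex_Z_Suc:
  assumes "d1 \<ge> 1" "d2 \<ge> 1"
  shows "Ex (Suc n) (Z (n div k) d1 d2) = Ex n (Z (n div k) d1 d2)
    + ((w d1 - 1) * Ex n (Z (n div k) (d1 - 1) d2) + (w d2 - 1) * Ex n (Z (n div k) d1 (d2 - 1))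
        - (w d1 + w d2) * Ex n (Z (n div k) d1 d2)) / D n"
proof -
  let ?t = "n div k"
  define I where "I d M i = (of_bool (deg M i = d) :: real)" for d M i
  define J where "J d M i = I (d - 1) M i - I d M i" for d M i
  define e where "e M i j = of_bool (i \<noteq> j) * real (num_edges M i j)" for M and i j :: nat
  define \<Delta> where "\<Delta> M j = (\<Sum>i\<in>{1..?t}. J d1 M j * I d2 M i * e M j i) +
    (\<Sum>i\<in>{1..?t}. I d1 M i * J d2 M j * e M i j)" for M j
  have Z_I: "Z ?t d1 d2 M = (\<Sum>i\<in>{1..?t}. \<Sum>j\<in>{1..?t}. I d1 M i * I d2 M j * e M i j)" for d1 d2 M
    by (simp add: Z_def I_def e_def)
  have e_eq: "e (add_mset {#Suc ?t, j#} M) i i' = e M i i'" if "i \<in> {1..?t}" "i' \<in> {1..?t}" for M i i' j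
    using that by (auto simp: num_edges_add_mset e_def add_eq_conv_ex)
  have I_eq: "I d (add_mset {#Suc ?t, j#} M) i = I d M i + of_bool (i = j) * J d M i"
    if "i \<in> {1..?t}" "d \<ge> 1" for d M i j
    unfolding I_def J_def by (rule of_bool_deg_add_mset) (use that in auto)
  have "Ex (Suc n) (Z ?t d1 d2) = Ex n (Z ?t d1 d2) + Ex n (\<lambda>M. \<Sum>j\<in>{1..?t}. w (deg M j) * \<Delta> M j) / D n"
  proof (rule Ex_Suc_increment)
    fix M
    show "Z ?t d1 d2 (add_mset {#Suc ?t, Suc ?t#} M) = Z ?t d1 d2 M"
      unfolding Z_I using assms by (intro sum.cong refl) (simp add: I_eq e_eq)
    fix j assume j: "j \<in> {1..?t}"
    \<comment> \<open>The term in which both indicators change would need \<open>i = i' = j\<close>,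
      where \<open>e\<close> is 0.\<close>
    have prod: "I d1 (add_mset {#Suc ?t, j#} M) i * I d2 (add_mset {#Suc ?t, j#} M) i' * e (add_mset {#Suc ?t, j#} M) i i'
      = I d1 M i * I d2 M i' * e M i i' + of_bool (i = j) * (J d1 M i * I d2 M i' * e M i i')
        + of_bool (i' = j) * (I d1 M i * J d2 M i' * e M i i')"
      if "i \<in> {1..?t}" "i' \<in> {1..?t}" for i i'
      using that assms by (auto simp: I_eq e_eq algebra_simps) (auto simp: e_def)
    have "Z ?t d1 d2 (add_mset {#Suc ?t, j#} M) = Z ?t d1 d2 M
      + (\<Sum>i\<in>{1..?t}. of_bool (i = j) * (\<Sum>i'\<in>{1..?t}. J d1 M i * I d2 M i' * e M i i'))
      + (\<Sum>i\<in>{1..?t}. \<Sum>i'\<in>{1..?t}. of_bool (i' = j) * (I d1 M i * J d2 M i' * e M i i'))"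
      unfolding Z_I using prod by (simp add: sum.distrib sum_distrib_left)
    then show "Z ?t d1 d2 (add_mset {#Suc ?t, j#} M) = Z ?t d1 d2 M + \<Delta> M j"
      using j by (simp add: \<Delta>_def of_bool_def if_distrib[of "\<lambda>x. x * _"] sum.delta cong: if_cong)
  qed
  also have "(\<lambda>M. \<Sum>j\<in>{1..?t}. w (deg M j) * \<Delta> M j)
      = (\<lambda>M. w (d1 - 1) * Z ?t (d1 - 1) d2 M - w d1 * Z ?t d1 d2 M
          + (w (d2 - 1) * Z ?t d1 (d2 - 1) M - w d2 * Z ?t d1 d2 M))"
  proof
    fix M
    have wJ: "w (deg M j) * (J d M j * x) = w (d - 1) * (I (d - 1) M j * x) - w d * (I d M j * x)" for d j x
      by (auto simp: J_def I_def left_diff_distrib)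
    have "(\<Sum>j\<in>{1..?t}. w (deg M j) * \<Delta> M j)
      = (\<Sum>j\<in>{1..?t}. \<Sum>i\<in>{1..?t}. w (deg M j) * (J d1 M j * (I d2 M i * e M j i)))
      + (\<Sum>j\<in>{1..?t}. \<Sum>i\<in>{1..?t}. w (deg M j) * (J d2 M j * (I d1 M i * e M i j)))"
      by (simp add: \<Delta>_def distrib_left sum.distrib sum_distrib_left mult_ac)
    also have "(\<Sum>j\<in>{1..?t}. \<Sum>i\<in>{1..?t}. w (deg M j) * (J d1 M j * (I d2 M i * e M j i)))
      = w (d1 - 1) * Z ?t (d1 - 1) d2 M - w d1 * Z ?t d1 d2 M"
      unfolding wJ Z_I by (simp add: sum_subtractf sum_distrib_left mult_ac)
    also have "(\<Sum>j\<in>{1..?t}. \<Sum>i\<in>{1..?t}. w (deg M j) * (J d2 M j * (I d1 M i * e M i j)))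
      = (\<Sum>i\<in>{1..?t}. \<Sum>j\<in>{1..?t}. w (deg M j) * (J d2 M j * (I d1 M i * e M i j)))"
      by (rule sum.swap)
    also have "\<dots> = w (d2 - 1) * Z ?t d1 (d2 - 1) M - w d2 * Z ?t d1 d2 M"
      unfolding wJ Z_I by (simp add: sum_subtractf sum_distrib_left mult_ac)
    finally show "(\<Sum>j\<in>{1..?t}. w (deg M j) * \<Delta> M j)
      = w (d1 - 1) * Z ?t (d1 - 1) d2 M - w d1 * Z ?t d1 d2 M
          + (w (d2 - 1) * Z ?t d1 (d2 - 1) M - w d2 * Z ?t d1 d2 M)" .
  qed
  finally show ?thesis
    by (simp add: Ex_diff Ex_cmult Ex_add w_pred[OF assms(1)] w_pred[OF assms(2)] algebra_simps)
qed

text \<open>After \<open>i\<close> nodes the degree is \<open>i\<close> unless some edge stayed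
  inside the block; this is a union bound over the \<open>i\<close> steps with
  \<open>p_partial\<close> at each.\<close>

lemma Ex_deg_partial:
  assumes "i \<le> k"
  shows "Ex (k * t + i) (\<lambda>M. of_bool (deg M (Suc t) \<noteq> i)) \<le> real i * (real k * (a + 1)) / (a * real (Suc t))"
  using assms
proof (induction i)
  case 0
  have "Ex (k * t) (\<lambda>M. of_bool (deg M (Suc t) \<noteq> 0)) \<le> 0"
    using deg_late_block_le[of _ "k * t" t] by (intro Ex_le_const) auto
  then show ?case by simp
next
  case (Suc i)
  define n where "n = k * t + i"
  have t: "n div k = t" and i: "n mod k = i" using Suc.prems by (auto simp: n_def)
  have split: "{1..Suc t} = insert (Suc t) {1..t}" by auto
  have "(\<Sum>j\<in>{1..Suc t}. p n M j * of_bool (deg (add_mset {#Suc t, j#} M) (Suc t) \<noteq> Suc i))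
    \<le> of_bool (deg M (Suc t) \<noteq> i) + real k * (a + 1) / D n" if M: "M \<in> supp n" for M
  proof -
    have "(\<Sum>j\<in>{1..t}. p n M j) \<le> 1"
      using sum_p[OF M] p_partial(1)[OF M] unfolding t split by simp
    moreover have "(\<Sum>j\<in>{1..t}. p n M j * of_bool (deg (add_mset {#Suc t, j#} M) (Suc t) \<noteq> Suc i))
      = (\<Sum>j\<in>{1..t}. p n M j) * of_bool (deg M (Suc t) \<noteq> i)"
      unfolding sum_distrib_right by (intro sum.cong) auto
    ultimately have "(\<Sum>j\<in>{1..t}. p n M j * of_bool (deg (add_mset {#Suc t, j#} M) (Suc t) \<noteq> Suc i))
      \<le> of_bool (deg M (Suc t) \<noteq> i)" by auto
    moreover have "p n M (Suc t) * of_bool (deg (add_mset {#Suc t, Suc t#} M) (Suc t) \<noteq> Suc i) \<le> p n M (Suc t)"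
      using p_partial(1)[OF M] t by auto
    moreover have "(\<Sum>j\<in>{1..Suc t}. f j) = f (Suc t) + (\<Sum>j\<in>{1..t}. f j)" for f :: "nat \<Rightarrow> real"
      unfolding split by (rule sum.insert) auto
    moreover have "p n M (Suc t) \<le> real k * (a + 1) / D n"
      using p_partial(2)[OF M] t by simp
    ultimately show ?thesis by (smt (verit))
  qed
  then have "Ex (Suc n) (\<lambda>M. of_bool (deg M (Suc t) \<noteq> Suc i))
    \<le> Ex n (\<lambda>M. of_bool (deg M (Suc t) \<noteq> i) + real k * (a + 1) / D n)"
    unfolding Ex_Suc t by (intro Ex_mono)
  also have "\<dots> = Ex n (\<lambda>M. of_bool (deg M (Suc t) \<noteq> i)) + real k * (a + 1) / D n"
    by (simp add: Ex_add Ex_const)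
  also have "\<dots> \<le> real i * (real k * (a + 1)) / (a * real (Suc t)) + real k * (a + 1) / (a * real (Suc t))"
  proof (intro add_mono)
    show "Ex n (\<lambda>M. of_bool (deg M (Suc t) \<noteq> i)) \<le> real i * (real k * (a + 1)) / (a * real (Suc t))"
      using Suc unfolding n_def by simp
    have "Suc t \<le> Suc n" using k_pos by (simp add: n_def trans_le_add1)
    then have "a * real (Suc t) \<le> D n"
      using D_ge[of n] a_pos by (smt (verit) mult_left_mono of_nat_mono)
    then show "real k * (a + 1) / D n \<le> real k * (a + 1) / (a * real (Suc t))"
      using a_pos D_pos[of n] by (intro divide_left_mono mult_pos_pos) auto
  qed
  finally show ?case by (simp add: n_def add_divide_distrib distrib_right)
qed

lemma expected_X_eq_Ex:
  "expected_X a k d1 d2 t = Ex (k * t) (Z t d1 d2)"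
proof -
  have "real (X d1 d2 t M) = Z t d1 d2 M" for M
  proof -
    have "Z t d1 d2 M = (\<Sum>(s1, s2)\<in>{1..t} \<times> {1..t}. if s1 \<noteq> s2 \<and> deg M s1 = d1 \<and> deg M s2 = d2
        then real (num_edges M s1 s2) else 0)"
      unfolding Z_def by (subst sum.cartesian_product) (intro sum.cong, auto)
    also have "\<dots> = (\<Sum>(s1, s2)\<in>{x \<in> {1..t} \<times> {1..t}. fst x \<noteq> snd x \<and> deg M (fst x) = d1 \<and> deg M (snd x) = d2}.
       real (num_edges M s1 s2))"
      by (subst sum.inter_filter) (auto intro!: sum.cong)
    also have "\<dots> = real (X d1 d2 t M)"
      unfolding X_def of_nat_sum by (intro sum.cong) auto
    finally show ?thesis by simp
  qed
  then show ?thesis by (simp add: expected_X_def H_def Ex_def)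
qed

section \<open>Limiting coefficients\<close>

lemma N_Suc: "N (Suc t) d M = N t d M + of_bool (deg M (Suc t) = d)"
  by (simp add: N_def)

text \<open>The edges held in \<open>Y\<close> are released in both orders. The corner term vanishes
  because \<open>Z\<close> ignores loops.\<close>

lemma Z_Suc:
  "Z (Suc t) d1 d2 M = Z t d1 d2 M + of_bool (deg M (Suc t) = d2) * Y t d1 M + of_bool (deg M (Suc t) = d1) * Y t d2 M"
proof -
  define f where "f i j = of_bool (deg M i = d1) * of_bool (deg M j = d2) * (of_bool (i \<noteq> j) * real (num_edges M i j))" for i j
  have row: "(\<Sum>j\<in>{1..t}. f (Suc t) j) = of_bool (deg M (Suc t) = d1) * Y t d2 M"
    unfolding f_def Y_def sum_distrib_left
    by (intro sum.cong refl) (auto simp: num_edges_commute[of M "Suc t"])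
  have col: "(\<Sum>i\<in>{1..t}. f i (Suc t)) = of_bool (deg M (Suc t) = d2) * Y t d1 M"
    unfolding f_def Y_def sum_distrib_left by (intro sum.cong refl) auto
  have "Z (Suc t) d1 d2 M = (\<Sum>i\<in>{1..Suc t}. \<Sum>j\<in>{1..Suc t}. f i j)"
    by (simp only: Z_def f_def)
  also have "\<dots> = (\<Sum>i\<in>{1..t}. \<Sum>j\<in>{1..t}. f i j) + (\<Sum>i\<in>{1..t}. f i (Suc t))
      + (\<Sum>j\<in>{1..t}. f (Suc t) j) + f (Suc t) (Suc t)"
    by (simp add: sum.distrib)
  also have "f (Suc t) (Suc t) = 0" by (simp add: f_def)
  finally show ?thesis unfolding row col by (simp add: Z_def f_def)
qed

lemma N_nonneg: "0 \<le> N t d M" and Y_nonneg: "0 \<le> Y t d M" and Z_nonneg: "0 \<le> Z t d1 d2 M"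
  by (auto simp: N_def Y_def Z_def intro!: sum_nonneg)

lemma N_le: "N t d M \<le> real t"
  using sum_mono[of "{1..t}" "\<lambda>j. of_bool (deg M j = d)" "\<lambda>_. 1 :: real"] by (simp add: N_def)

lemma Y_le: "Y t d M \<le> real (deg M (Suc t))"
proof -
  have "Y t d M \<le> (\<Sum>j\<in>{1..t}. real (num_edges M j (Suc t)))"
    unfolding Y_def by (intro sum_mono) auto
  also have "\<dots> \<le> real (deg M (Suc t))"
    unfolding of_nat_sum [symmetric] of_nat_le_iff by (intro sum_num_edges_le_deg) auto
  finally show ?thesis .
qed

lemma Y_le_supp:
  assumes "M \<in> supp n" "k * t \<le> n" "n \<le> k * Suc t"
  shows "Y t d M \<le> 2 * real k"
proof -
  have "deg M (Suc t) \<le> 2 * k"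
    using deg_late_block_le[OF assms(1,2)] assms(3) by simp
  then show ?thesis using Y_le[of t d M] by linarith
qed

lemma Z_le:
  assumes "M \<in> supp n" "t \<le> n div k"
  shows "Z t d1 d2 M \<le> real t * real (n + k)"
proof -
  have "Z t d1 d2 M \<le> (\<Sum>i\<in>{1..t}. \<Sum>j\<in>{1..t}. real (num_edges M i j))"
    unfolding Z_def by (intro sum_mono) auto
  also have "\<dots> = (\<Sum>j\<in>{1..t}. real (\<Sum>i\<in>{1..t}. num_edges M i j))"
    by (subst sum.swap) simp
  also have "\<dots> \<le> (\<Sum>j\<in>{1..t}. real (n + k))"
  proof (intro sum_mono)
    fix j assume "j \<in> {1..t}"
    then have "deg M j \<le> n + k" using deg_le[OF assms(1), of j] assms(2) by auto
    then show "real (\<Sum>i\<in>{1..t}. num_edges M i j) \<le> real (n + k)"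
      unfolding of_nat_le_iff by (intro order_trans[OF sum_num_edges_le_deg]) auto
  qed
  finally show ?thesis by simp
qed

lemma N_eq_0:
  assumes "M \<in> supp n" "t \<le> n div k" "d < k \<or> d > n + k"
  shows "N t d M = 0"
  unfolding N_def
proof (intro sum.neutral ballI)
  fix j assume "j \<in> {1..t}"
  then show "of_bool (deg M j = d) = (0 :: real)"
    using deg_le[OF assms(1), of j] deg_ge[OF assms(1), of j] assms(2,3) by auto
qed

lemma Y_eq_0:
  assumes "M \<in> supp n" "t \<le> n div k" "d < k \<or> d > n + k"
  shows "Y t d M = 0"
  unfolding Y_def
proof (intro sum.neutral ballI)
  fix j assume "j \<in> {1..t}"
  then show "of_bool (deg M j = d) * real (num_edges M j (Suc t)) = 0"
    using deg_le[OF assms(1), of j] deg_ge[OF assms(1), of j] assms(2,3) by auto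
qed

lemma Z_eq_0:
  assumes "M \<in> supp n" "t \<le> n div k" "d1 < k \<or> d2 < k \<or> d1 + d2 > n + 2 * k"
  shows "Z t d1 d2 M = 0"
  unfolding Z_def
proof (intro sum.neutral ballI)
  fix i j assume ij: "i \<in> {1..t}" "j \<in> {1..t}"
  have "i \<noteq> j \<Longrightarrow> deg M i + deg M j \<le> n + 2 * k"
    using deg_pair_le[OF assms(1), of i j] ij assms(2) by auto
  then show "of_bool (deg M i = d1) * of_bool (deg M j = d2) * (of_bool (i \<noteq> j) * real (num_edges M i j)) = 0"
    using deg_ge[OF assms(1), of i] deg_ge[OF assms(1), of j] assms(2,3) ij
    by (cases "i = j") auto
qed

section \<open>Solutions of the limiting recurrences\<close>

abbreviation \<kappa> :: real where "\<kappa> \<equiv> real k * a"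

lemma kappa_pos: "\<kappa> > 0"
  using a_pos k_pos by simp

lemma w_k: "w k = \<kappa>"
  by (simp add: w_def)

lemma w_ge: "d \<ge> k \<Longrightarrow> w d \<ge> \<kappa>"
  by (simp add: w_def)

lemma w_pos: "d \<ge> k \<Longrightarrow> w d > 0"
  using w_ge[of d] kappa_pos by linarith

text \<open>
  The limit of \<open>w d * N d / t\<close> is \<open>g d\<close>, the limit of \<open>X(d1, d2, t) / t\<close> is \<open>c d1 d2\<close>, and \<open>src d1 d2\<close> is the limiting
  number of ordered edges that each completed block contributes.
\<close>

definition K :: real where
  "K = (a + 1) * (Gamma (\<kappa> + a + 1) / Gamma \<kappa>)"

definition g :: "nat \<Rightarrow> real" where
  "g d = (if d < k then 0 else K * (Gamma (w d + 1) / Gamma (w d + a + 2)))"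

lemma K_pos: "K > 0"
  using kappa_pos a_pos by (auto simp: K_def intro!: mult_pos_pos divide_pos_pos Gamma_real_pos)

lemma g_nonneg: "g d \<ge> 0"
proof (cases "d < k")
  case False
  then have "w d > 0" using w_pos by simp
  then show ?thesis using K_pos a_pos
    by (auto simp: g_def intro!: mult_nonneg_nonneg divide_nonneg_nonneg less_imp_le[OF Gamma_real_pos])
qed (simp add: g_def)

text \<open>The summand \<open>a + 1\<close> on the left is the increment of \<open>D n\<close>:
  this is the condition for \<open>g d * D n / ((a + 1) * real k)\<close> to solve the recurrence of
  \<open>W\<close>, with completions averaged over \<open>k\<close> steps.\<close>

lemma g_rec:
  assumes "d \<ge> k"
  shows "(w d + a + 1) * g d = w d * g (d - 1) + (a + 1) * w d * of_bool (d = k)"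
proof (cases "d = k")
  case True
  \<comment> \<open>This case determines the constant \<open>K\<close>; all others are
    homogeneous.\<close>
  have "Gamma (\<kappa> + a + 2) = (\<kappa> + a + 1) * Gamma (\<kappa> + a + 1)"
    using Gamma_real_plus1[of "\<kappa> + a + 1"] kappa_pos a_pos by (simp add: add.assoc)
  moreover have "Gamma (\<kappa> + 1) = \<kappa> * Gamma \<kappa>"
    using Gamma_real_plus1 kappa_pos by blast
  ultimately have "(\<kappa> + a + 1) * g k = (\<kappa> + a + 1) * ((a + 1) * (Gamma (\<kappa> + a + 1) / Gamma \<kappa>)
      * (\<kappa> * Gamma \<kappa> / ((\<kappa> + a + 1) * Gamma (\<kappa> + a + 1))))"
    by (simp add: g_def w_k K_def)
  also have "\<dots> = (a + 1) * \<kappa>"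
  proof -
    have *: "q * (r * (B / A) * (\<kappa> * A / (q * B))) = r * \<kappa>" if "q > 0" "A > 0" "B > 0" for q r A B :: real
      using that by (simp add: field_simps)
    show ?thesis
      by (rule *) (use kappa_pos a_pos in \<open>auto intro!: Gamma_real_pos add_pos_pos\<close>)
  qed
  moreover have "g (k - 1) = 0" using k_pos by (simp add: g_def)
  ultimately show ?thesis using True by (simp add: w_k)
next
  case False
  with assms have d: "d > k" by simp
  have w1: "w (d - 1) = w d - 1" using d k_pos w_pred[of d] by simp
  have w2: "w d > 1" using d kappa_pos by (simp add: w_def)
  have "Gamma (w d + a + 2) = (w d + a + 1) * Gamma (w d + a + 1)"
    using Gamma_real_plus1[of "w d + a + 1"] w2 a_pos by (simp add: add.assoc)
  moreover have "Gamma (w d + 1) = w d * Gamma (w d)"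
    using Gamma_real_plus1[of "w d"] w2 by simp
  ultimately have gd: "g d = K * (w d * Gamma (w d) / ((w d + a + 1) * Gamma (w d + a + 1)))"
    using d by (simp add: g_def)
  have "w d - 1 + a + 2 = w d + a + 1" "w d - 1 + 1 = w d" "\<not> d - 1 < k" using d by auto
  then have gp: "g (d - 1) = K * (Gamma (w d) / Gamma (w d + a + 1))"
    unfolding g_def w1 by metis
  have "w d + a + 1 > 0" using w2 a_pos by simp
  then show ?thesis unfolding gd gp using False by simp
qed

text \<open>By the recurrence this product can only decrease beyond its value at \<open>k\<close>,
  as \<open>w (Suc d) = w d + 1\<close>. It bounds the comparison solution at degrees whose weight
  exceeds the time.\<close>

lemma g_bound: "d \<ge> k \<Longrightarrow> (w d + a + 1) * g d \<le> (a + 1) * \<kappa>"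
proof (induction d rule: dec_induct)
  case base
  then show ?case using g_rec[of k] k_pos by (simp add: w_k g_def)
next
  case (step d)
  have "(w (Suc d) + a + 1) * g (Suc d) = w (Suc d) * g d"
    using g_rec[of "Suc d"] step by simp
  also have "\<dots> \<le> (w d + a + 1) * g d"
    using a_pos by (intro mult_right_mono g_nonneg) (simp add: w_def)
  finally show ?case using step by linarith
qed

lemma w_mult_g_pred_bound:
  assumes "d \<ge> k"
  shows "w d * g (d - 1) \<le> (a + 1) * \<kappa>"
proof -
  have "0 \<le> (a + 1) * w d * of_bool (d = k)"
    using w_pos[OF assms] a_pos by simp
  then show ?thesis using g_bound[OF assms] g_rec[OF assms] by linarith
qed

function c :: "nat \<Rightarrow> nat \<Rightarrow> real" where
  "c d1 d2 = (if d1 < k \<or> d2 < k then 0 else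
     ((w d1 - 1) * c (d1 - 1) d2 + (w d2 - 1) * c d1 (d2 - 1)
       + of_bool (d2 = k) * g (d1 - 1) + of_bool (d1 = k) * g (d2 - 1)) / (w d1 + w d2 + a + 1))"
  by pat_completeness auto
termination
  using k_pos by (relation "Wellfounded.measure (\<lambda>(d1, d2). d1 + d2)") auto

declare c.simps [simp del]

definition src :: "nat \<Rightarrow> nat \<Rightarrow> real" where
  "src d1 d2 = (of_bool (d2 = k) * g (d1 - 1) + of_bool (d1 = k) * g (d2 - 1)) / (a + 1)"

lemma c_eq_0: "d1 < k \<or> d2 < k \<Longrightarrow> c d1 d2 = 0"
  by (simp add: c.simps[of d1 d2])

lemma src_eq_0: "d1 < k \<or> d2 < k \<Longrightarrow> src d1 d2 = 0"
  by (auto simp: src_def g_def)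

lemma src_nonneg: "src d1 d2 \<ge> 0"
  using a_pos by (simp add: src_def g_nonneg)

text \<open>As for \<open>g\<close>, the summand \<open>a + 1\<close> is the increment of
  \<open>D n\<close>, so that \<open>c d1 d2 * D n / ((a + 1) * real k)\<close> solves the edge
  recurrence with averaged source. The value 0 below \<open>k\<close> removes the missing
  predecessors.\<close>

lemma c_rec:
  assumes "d1 \<ge> k" "d2 \<ge> k"
  shows "(w d1 + w d2 + a + 1) * c d1 d2
    = (w d1 - 1) * c (d1 - 1) d2 + (w d2 - 1) * c d1 (d2 - 1) + (a + 1) * src d1 d2"
  using assms w_pos[of d1] w_pos[of d2] a_pos by (subst c.simps) (simp add: src_def)

lemma c_commute: "c d1 d2 = c d2 d1"
proof (induction d1 d2 rule: c.induct)
  case (1 d1 d2)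
  then show ?case
    by (cases "d1 < k \<or> d2 < k") (auto simp: c_eq_0 c.simps[of d1 d2] c.simps[of d2 d1] add_ac)
qed

text \<open>The periodic correction of the edge count is proportional to \<open>src\<close> and gets
  multiplied by the weights, so \<open>src\<close> must decay like the reciprocal of their
  sum.\<close>

lemma src_bound:
  assumes "d1 \<ge> k" "d2 \<ge> k"
  shows "(w d1 + w d2 + a) * src d1 d2 \<le> 2 * (\<kappa> + 1) * (\<kappa> + a + 1)"
proof -
  have *: "(w d + \<kappa> + a) * g (d - 1) \<le> (a + 1) * (\<kappa> + 1) * (\<kappa> + a + 1)" if d: "d \<ge> k" for d
  proof (cases "d = k")
    case True
    then show ?thesis using kappa_pos a_pos k_pos by (simp add: g_def)
  next
    case False
    then have "w d \<ge> 1" using d kappa_pos by (simp add: w_def)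
    then have "(\<kappa> + a) * 1 \<le> (\<kappa> + a) * w d"
      using kappa_pos a_pos by (intro mult_left_mono) auto
    then have "w d + \<kappa> + a \<le> (\<kappa> + a + 1) * w d" by (simp add: algebra_simps)
    then have "(w d + \<kappa> + a) * g (d - 1) \<le> (\<kappa> + a + 1) * (w d * g (d - 1))"
      unfolding mult.assoc [symmetric] by (intro mult_right_mono g_nonneg)
    also have "\<dots> \<le> (\<kappa> + a + 1) * ((a + 1) * \<kappa>)"
      using w_mult_g_pred_bound[OF d] kappa_pos a_pos by (intro mult_left_mono) auto
    also have "\<dots> \<le> (a + 1) * (\<kappa> + 1) * (\<kappa> + a + 1)"
      using kappa_pos a_pos by (simp add: algebra_simps)
    finally show ?thesis .
  qed
  have "(w d1 + w d2 + a) * (of_bool (d2 = k) * g (d1 - 1)) \<le> (a + 1) * (\<kappa> + 1) * (\<kappa> + a + 1)"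
    using *[OF assms(1)] kappa_pos a_pos by (auto simp: w_k)
  moreover have "(w d1 + w d2 + a) * (of_bool (d1 = k) * g (d2 - 1)) \<le> (a + 1) * (\<kappa> + 1) * (\<kappa> + a + 1)"
    using *[OF assms(2)] kappa_pos a_pos by (auto simp: w_k add_ac)
  moreover have "(a + 1) * src d1 d2 = of_bool (d2 = k) * g (d1 - 1) + of_bool (d1 = k) * g (d2 - 1)"
    using a_pos by (simp add: src_def)
  then have "(a + 1) * ((w d1 + w d2 + a) * src d1 d2)
    = (w d1 + w d2 + a) * (of_bool (d2 = k) * g (d1 - 1)) + (w d1 + w d2 + a) * (of_bool (d1 = k) * g (d2 - 1))"
    by (metis distrib_left mult.left_commute)
  ultimately have "(a + 1) * ((w d1 + w d2 + a) * src d1 d2) \<le> (a + 1) * (2 * (\<kappa> + 1) * (\<kappa> + a + 1))"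
    by linarith
  then show ?thesis using a_pos by (simp add: mult_le_cancel_left)
qed

definition \<mu> :: real where "\<mu> = min 1 \<kappa>"

lemma mu_pos: "\<mu> > 0" and mu_le: "\<mu> \<le> 1" "\<mu> \<le> \<kappa>"
  using kappa_pos by (auto simp: \<mu>_def)

text \<open>For \<open>d > k\<close> any \<open>\<mu> \<le> 1\<close> will do. At
  \<open>d = k\<close> the left side is 0, and \<open>\<kappa> - \<mu> \<ge> 0\<close> is needed
  although \<open>\<kappa>\<close> may be below 1; hence the minimum in
  \<open>\<mu>\<close>.\<close>

lemma pred_weight_le:
  assumes "d \<ge> k" "B \<ge> 0" "\<bar>x\<bar> \<le> B" "d = k \<Longrightarrow> x = 0"
  shows "\<bar>(w d - 1) * x\<bar> \<le> (w d - \<mu>) * B"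
proof (cases "d = k")
  case True
  then show ?thesis using assms mu_le by (simp add: w_k)
next
  case False
  then have "w d \<ge> 1" using assms(1) kappa_pos by (simp add: w_def)
  then have "\<bar>(w d - 1) * x\<bar> \<le> (w d - 1) * B"
    using assms by (simp add: abs_mult mult_left_mono)
  also have "\<dots> \<le> (w d - \<mu>) * B" using assms mu_le by (intro mult_right_mono) auto
  finally show ?thesis .
qed

lemma c_nonneg: "c d1 d2 \<ge> 0"
proof (induction d1 d2 rule: c.induct)
  case (1 d1 d2)
  show ?case
  proof (cases "d1 < k \<or> d2 < k")
    case True
    then show ?thesis by (simp add: c_eq_0)
  next
    case False
    have "(w d - 1) * x \<ge> 0" if "d \<ge> k" "x \<ge> 0" "d = k \<Longrightarrow> x = 0" for d x
      using that kappa_pos by (cases "d = k") (auto simp: w_def intro!: mult_nonneg_nonneg)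
    from this[of d1 "c (d1 - 1) d2"] this[of d2 "c d1 (d2 - 1)"]
    have "(w d1 - 1) * c (d1 - 1) d2 \<ge> 0" "(w d2 - 1) * c d1 (d2 - 1) \<ge> 0"
      using False 1 k_pos by (auto simp: c_eq_0)
    then have "(w d1 + w d2 + a + 1) * c d1 d2 \<ge> 0"
      using c_rec[of d1 d2] False a_pos src_nonneg[of d1 d2] by simp
    moreover have "w d1 + w d2 + a + 1 > 0"
      using False w_pos[of d1] w_pos[of d2] a_pos by simp
    ultimately show ?thesis by (simp add: zero_le_mult_iff)
  qed
qed

lemma c_bound:
  "\<exists>S\<ge>0. \<forall>d1\<ge>k. \<forall>d2\<ge>k. (w d1 + w d2 + a + 1) * c d1 d2 \<le> S"
proof -
  define Q where "Q = 2 * (\<kappa> + 1) * (\<kappa> + a + 1)"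
  \<comment> \<open>With both predecessors at most \<open>S / (s + a)\<close>, where
    \<open>s = w d1 + w d2\<close>, they contribute at most \<open>S - a * S / (s + a)\<close>. The
    choice \<open>a * S = (a + 1) * Q\<close> leaves exactly the room that the source needs.\<close>
  define S where "S = (a + 1) * Q / a"
  have Q: "Q \<ge> 0" using kappa_pos a_pos by (simp add: Q_def)
  have S: "S \<ge> 0" using Q a_pos by (simp add: S_def)
  have "d1 \<ge> k \<longrightarrow> d2 \<ge> k \<longrightarrow> (w d1 + w d2 + a + 1) * c d1 d2 \<le> S" for d1 d2
  proof (induction d1 d2 rule: c.induct)
    case (1 d1 d2)
    show ?case
    proof (intro impI)
      assume d: "d1 \<ge> k" "d2 \<ge> k"
      let ?s = "w d1 + w d2"
      have s: "?s + a > 0" using w_pos d a_pos by (simp add: add_pos_pos)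
      have A1: "\<bar>c (d1 - 1) d2\<bar> \<le> S / (?s + a)"
      proof (cases "d1 = k")
        case False
        then have "(w (d1 - 1) + w d2 + a + 1) * c (d1 - 1) d2 \<le> S"
          using 1(1) d by simp
        then have "(?s + a) * c (d1 - 1) d2 \<le> S"
          using w_pred[of d1] d k_pos by (simp add: add_ac)
        then show ?thesis using s c_nonneg[of "d1 - 1" d2] by (simp add: field_simps)
      qed (use s S k_pos in \<open>simp add: c_eq_0\<close>)
      have A2: "\<bar>c d1 (d2 - 1)\<bar> \<le> S / (?s + a)"
      proof (cases "d2 = k")
        case False
        then have "(w d1 + w (d2 - 1) + a + 1) * c d1 (d2 - 1) \<le> S"
          using 1(2) d by simp
        then have "(?s + a) * c d1 (d2 - 1) \<le> S"
          using w_pred[of d2] d k_pos by (simp add: add_ac)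
        then show ?thesis using s c_nonneg[of d1 "d2 - 1"] by (simp add: field_simps)
      qed (use s S k_pos in \<open>simp add: c_eq_0\<close>)
      have B1: "\<bar>(w d1 - 1) * c (d1 - 1) d2\<bar> \<le> (w d1 - \<mu>) * (S / (?s + a))"
        by (rule pred_weight_le) (use d A1 s S k_pos in \<open>auto simp: c_eq_0\<close>)
      have B2: "\<bar>(w d2 - 1) * c d1 (d2 - 1)\<bar> \<le> (w d2 - \<mu>) * (S / (?s + a))"
        by (rule pred_weight_le) (use d A2 s S k_pos in \<open>auto simp: c_eq_0\<close>)
      have "(w d1 - \<mu>) * R + (w d2 - \<mu>) * R = (?s - 2 * \<mu>) * R" for R
        by (simp add: algebra_simps)
      then have "(w d1 - \<mu>) * (S / (?s + a)) + (w d2 - \<mu>) * (S / (?s + a)) = (?s - 2 * \<mu>) * (S / (?s + a))" .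
      also have "\<dots> \<le> ?s * (S / (?s + a))"
        using mu_pos S s by (intro mult_right_mono) auto
      also have "\<dots> = S - a * S / (?s + a)"
        using s by (simp add: field_simps)
      also have "a * S / (?s + a) = (a + 1) * Q / (?s + a)"
        using a_pos by (simp add: S_def)
      finally have "(w d1 - 1) * c (d1 - 1) d2 + (w d2 - 1) * c d1 (d2 - 1) \<le> S - (a + 1) * Q / (?s + a)"
        using B1 B2 by linarith
      moreover have "src d1 d2 \<le> Q / (?s + a)"
        using src_bound[OF d] s by (simp add: Q_def field_simps)
      then have "(a + 1) * src d1 d2 \<le> (a + 1) * Q / (?s + a)"
        using a_pos mult_left_mono[of "src d1 d2" "Q / (?s + a)" "a + 1"] by simp
      ultimately show "(w d1 + w d2 + a + 1) * c d1 d2 \<le> S"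
        unfolding c_rec[OF d] by linarith
    qed
  qed
  then show ?thesis using S by blast
qed

section \<open>Blocks of given degree\<close>

lemma D_Suc: "D (Suc n) = D n + (a + 1)"
  by (simp add: D_def algebra_simps)

lemma D_le: "D n \<le> (a + 1) * real (Suc n)"
  by (simp add: D_def)

lemma time_cases:
  obtains (inner) "Suc (n mod k) < k" "Suc n div k = n div k" "Suc n mod k = Suc (n mod k)"
  | (last) "Suc (n mod k) = k" "Suc n div k = Suc (n div k)" "Suc n mod k = 0" "Suc n = k * Suc (n div k)"
proof (cases "Suc (n mod k) = k")
  case True
  moreover from this have "Suc n div k = Suc (n div k)" "Suc n mod k = 0"
    by (simp_all add: div_Suc mod_Suc)
  moreover have "Suc n = k * (Suc n div k) + Suc n mod k" by simp
  ultimately show ?thesis using last by simp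
next
  case False
  moreover have "n mod k < k" using k_pos by simp
  ultimately show ?thesis using inner by (simp add: div_Suc mod_Suc)
qed

lemma Ex_deg_last:
  assumes "Suc n = k * Suc t"
  shows "\<bar>Ex (Suc n) (\<lambda>M. of_bool (deg M (Suc t) = d)) - of_bool (d = k)\<bar>
    \<le> Ex (Suc n) (\<lambda>M. of_bool (deg M (Suc t) \<noteq> k))"
proof (cases "d = k")
  case True
  have "Ex (Suc n) (\<lambda>M. of_bool (deg M (Suc t) \<noteq> k)) = Ex (Suc n) (\<lambda>M. 1 - of_bool (deg M (Suc t) = k))"
    by (intro Ex_cong) auto
  then show ?thesis using True Ex_nonneg[of "Suc n" "\<lambda>M. of_bool (deg M (Suc t) \<noteq> k)"]
    by (simp add: Ex_diff Ex_const)
next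
  case False
  then show ?thesis
    using Ex_mono[of "Suc n" "\<lambda>M. of_bool (deg M (Suc t) = d)" "\<lambda>M. of_bool (deg M (Suc t) \<noteq> k)"]
      Ex_nonneg[of "Suc n" "\<lambda>M. of_bool (deg M (Suc t) = d)"] by auto
qed

text \<open>The constant of \<open>Ex_deg_partial\<close> at \<open>i = k\<close>, multiplied by the
  factor that converts \<open>1 / Suc t\<close> into \<open>1 / D n\<close>.\<close>

definition P :: real where "P = real k * (real k * (a + 1)) / a * ((a + 1) * real k)"

lemma P_nonneg: "P \<ge> 0"
  using a_pos by (simp add: P_def)

lemma inverse_time_le:
  assumes "Suc n = k * Suc t"
  shows "1 / real (Suc t) \<le> (a + 1) * real k / D n"
proof -
  have "D n \<le> (a + 1) * real k * real (Suc t)"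
    using D_le[of n] unfolding assms of_nat_mult by (simp add: mult.assoc)
  then show ?thesis using D_pos[of n] by (simp add: divide_simps)
qed

lemma Ex_deg_last_le:
  assumes "Suc n = k * Suc t"
  shows "Ex (Suc n) (\<lambda>M. of_bool (deg M (Suc t) \<noteq> k)) \<le> P / D n"
proof -
  have "Ex (Suc n) (\<lambda>M. of_bool (deg M (Suc t) \<noteq> k)) \<le> real k * (real k * (a + 1)) / (a * real (Suc t))"
    using Ex_deg_partial[of k t] assms by (simp add: add.commute)
  also have "\<dots> = real k * (real k * (a + 1)) / a * (1 / real (Suc t))"
    by simp
  also have "\<dots> \<le> real k * (real k * (a + 1)) / a * ((a + 1) * real k / D n)"
    using a_pos by (intro mult_left_mono inverse_time_le assms) auto
  also have "\<dots> = P / D n" by (simp add: P_def)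
  finally show ?thesis .
qed

text \<open>
  Multiplied by \<open>w d\<close> the recurrence for the degree counts has the nonnegative coefficients \<open>1 - w d / D n\<close> and
  \<open>w d / D n\<close>; the source terms of \<open>Y\<close> need the counts with exactly this precision.
\<close>

definition W :: "nat \<Rightarrow> nat \<Rightarrow> real" where
  "W n d = w d * Ex n (N (n div k) d)"

definition jump :: "nat \<Rightarrow> nat \<Rightarrow> real" where
  "jump n d = (if Suc (n mod k) = k
     then Ex (Suc n) (\<lambda>M. of_bool (deg M (Suc (n div k)) = d)) - of_bool (d = k) else 0)"

lemma jump_le: "\<bar>jump n d\<bar> \<le> P / D n"
proof (cases n rule: time_cases)
  case last
  then show ?thesis using Ex_deg_last[of n "n div k" d] Ex_deg_last_le[of n "n div k"]
    by (simp add: jump_def)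
qed (use P_nonneg D_pos[of n] in \<open>simp add: jump_def\<close>)

text \<open>On completion a block has at most \<open>2 * k\<close> endpoints, so completions disturb
  only boundedly many degrees.\<close>

lemma jump_eq_0:
  assumes "d > 2 * k"
  shows "jump n d = 0"
proof (cases n rule: time_cases)
  case last
  have "of_bool (deg M (Suc (n div k)) = d) = (0 :: real)" if "M \<in> supp (Suc n)" for M
    using deg_late_block_le[OF that, of "n div k"] last(4) assms by auto
  then have "Ex (Suc n) (\<lambda>M. of_bool (deg M (Suc (n div k)) = d)) = 0"
    using Ex_cong[of "Suc n" _ "\<lambda>_. 0"] by (simp add: Ex_const)
  then show ?thesis using assms k_pos by (simp add: jump_def)
qed (simp add: jump_def)

lemma W_Suc:
  assumes "d \<ge> k"
  shows "W (Suc n) d = W n d + w d / D n * (W n (d - 1) - W n d)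
    + (if Suc (n mod k) = k then w d * (jump n d + of_bool (d = k)) else 0)"
proof -
  have d: "d \<ge> 1" using assms k_pos by simp
  have "w d * Ex (Suc n) (N (n div k) d) = W n d + w d / D n * (W n (d - 1) - W n d)"
  proof -
    have 1: "(w d - 1) * Ex n (N (n div k) (d - 1)) = W n (d - 1)" by (simp add: W_def w_pred[OF d])
    have 2: "w d * Ex n (N (n div k) d) = W n d" by (simp add: W_def)
    show ?thesis unfolding Ex_N_Suc[OF d] 1 2 by (simp add: distrib_left 2)
  qed
  moreover have "W (Suc n) d = w d * Ex (Suc n) (N (n div k) d)
    + (if Suc (n mod k) = k then w d * (jump n d + of_bool (d = k)) else 0)"
  proof (cases n rule: time_cases)
    case last
    have "Ex (Suc n) (N (Suc (n div k)) d)
      = Ex (Suc n) (\<lambda>M. N (n div k) d M + of_bool (deg M (Suc (n div k)) = d))"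
      by (intro Ex_cong) (simp add: N_Suc)
    also have "\<dots> = Ex (Suc n) (N (n div k) d) + (jump n d + of_bool (d = k))"
      using last by (simp add: Ex_add jump_def)
    finally show ?thesis unfolding W_def last(2) using last(1) by (simp add: distrib_left)
  qed (simp add: W_def)
  ultimately show ?thesis by simp
qed

lemma W_eq_0: "d < k \<or> d > n + k \<Longrightarrow> W n d = 0"
  using Ex_cong[of n "N (n div k) d" "\<lambda>_. 0"] N_eq_0[of _ n "n div k" d]
  by (auto simp: W_def Ex_const)

lemma g_le: "g d \<le> \<kappa>"
proof (cases "d < k")
  case False
  then have "(w d + a + 1) * g d \<le> (a + 1) * \<kappa>" using g_bound by simp
  moreover have "(a + 1) * g d \<le> (w d + a + 1) * g d"
    using False w_pos[of d] by (intro mult_right_mono g_nonneg) auto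
  ultimately have "(a + 1) * g d \<le> (a + 1) * \<kappa>" by linarith
  then show ?thesis using a_pos by (simp add: mult_le_cancel_left)
qed (use kappa_pos in \<open>simp add: g_def\<close>)

lemma W_bounds:
  shows "0 \<le> W n d" and "W n d \<le> (real n + \<kappa>) * real n"
proof -
  have E: "0 \<le> Ex n (N (n div k) d)" "Ex n (N (n div k) d) \<le> real n"
    using Ex_nonneg[of n "N (n div k) d"] Ex_le_const[of n "N (n div k) d" "real (n div k)"]
      N_nonneg N_le div_le_dividend[of n k] by (auto intro: order_trans)
  show "0 \<le> W n d"
    using E(1) w_pos[of d] W_eq_0[of d n] by (cases "d < k") (auto simp: W_def)
  show "W n d \<le> (real n + \<kappa>) * real n"
  proof (cases "d < k \<or> d > n + k")
    case False
    then show ?thesis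
      unfolding W_def using E w_pos[of d] by (intro mult_mono) (auto simp: w_def)
  qed (use W_eq_0 kappa_pos in simp)
qed

text \<open>
  Blocks are completed only every \<open>k\<close> steps, whereas the comparison solution grows at every step; \<open>drift\<close>
  is the periodic correction that makes up for this.
\<close>

definition drift :: "nat \<Rightarrow> nat \<Rightarrow> real" where
  "drift n d = of_bool (d = k) * \<kappa> * real (n mod k) / real k"

lemma drift_bounds: "0 \<le> drift n d" "drift n d \<le> \<kappa>"
proof -
  show "0 \<le> drift n d" using a_pos by (simp add: drift_def)
  have "real (n mod k) / real k \<le> 1" using k_pos by (simp add: less_imp_le)
  then have "\<kappa> * (real (n mod k) / real k) \<le> \<kappa>" using kappa_pos by (intro mult_left_le) auto
  then show "drift n d \<le> \<kappa>" using kappa_pos by (auto simp: drift_def)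
qed

text \<open>\<open>D n / ((a + 1) * real k)\<close> replaces the number of blocks, from which it
  differs by a bounded amount: a multiple of \<open>D n\<close> is what fits a recurrence with
  denominators \<open>D n\<close> exactly.\<close>

definition err :: "nat \<Rightarrow> nat \<Rightarrow> real" where
  "err n d = W n d - g d * D n / ((a + 1) * real k) + drift n d"

lemma err_eq_0: "d < k \<Longrightarrow> err n d = 0"
  by (simp add: err_def W_eq_0 g_def drift_def)

lemma err_Suc:
  assumes d: "d \<ge> k"
  shows "err (Suc n) d = err n d + w d / D n * (err n (d - 1) - err n d)
    + (w d * jump n d - w d / D n * (drift n (d - 1) - drift n d))"
proof -
  define V where "V n d = g d * D n / ((a + 1) * real k)" for n d
  have V1: "V (Suc n) d = V n d + g d / real k"
  proof -
    have "x * (z + q) / (q * real k) = x * z / (q * real k) + x / real k" if "q > 0" for x z q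
      using that k_pos by (simp add: field_simps)
    then show ?thesis unfolding V_def D_Suc using a_pos by simp
  qed
  have "w d / D n * (V n (d - 1) - V n d) = (w d * g (d - 1) - w d * g d) / ((a + 1) * real k)"
  proof -
    have "u / z * (x1 * z / q - x2 * z / q) = (u * x1 - u * x2) / q" if "z > 0" for u x1 x2 z q :: real
      using that by (simp add: right_diff_distrib diff_divide_distrib)
    then show ?thesis unfolding V_def using D_pos[of n] by simp
  qed
  also have "w d * g (d - 1) - w d * g d = (a + 1) * (g d - w d * of_bool (d = k))"
    using g_rec[OF d] by (simp add: algebra_simps)
  also have "(a + 1) * (g d - w d * of_bool (d = k)) / ((a + 1) * real k) = (g d - w d * of_bool (d = k)) / real k"
    using a_pos by simp
  finally have V2: "w d / D n * (V n (d - 1) - V n d) = g d / real k - of_bool (d = k) * \<kappa> / real k"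
    by (auto simp: diff_divide_distrib w_k)
  have b: "drift (Suc n) d = drift n d + of_bool (d = k) * \<kappa> / real k
     - (if Suc (n mod k) = k then w d * of_bool (d = k) else 0)"
  proof (cases n rule: time_cases)
    case last
    then have r: "real (n mod k) = real k - 1" by linarith
    have "\<kappa> / real k * (real k - 1) = \<kappa> - \<kappa> / real k" using k_pos by (simp add: field_simps)
    then show ?thesis unfolding drift_def last(3) r using last(1) by (auto simp: w_k)
  qed (use k_pos in \<open>auto simp: drift_def field_simps\<close>)
  have j: "(if Suc (n mod k) = k then w d * (jump n d + of_bool (d = k)) else 0)
      - (if Suc (n mod k) = k then w d * of_bool (d = k) else 0) = w d * jump n d"
    by (simp add: jump_def distrib_left right_diff_distrib)
  have main: "Wn + q * (Wp - Wn) - (Vn + G) + (bn + B)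
      = Wn - Vn + bn + q * (Wp - Vp + bp - (Wn - Vn + bn)) - q * (bp - bn)"
    if "q * (Vp - Vn) = G - B" for Wn Wp Vn Vp bn bp q G B :: real
    using that by (simp add: algebra_simps)
  have e: "err n d = W n d - V n d + drift n d" for n d by (simp add: err_def V_def)
  show ?thesis
    unfolding e W_Suc[OF d] V1 b
    using main[OF V2, of "W n d" "W n (d - 1)" "drift n d" "drift n (d - 1)"] j by linarith
qed

text \<open>While \<open>w d \<le> D n\<close>, a step forms a convex combination of
  \<open>err n d\<close> and \<open>err n (d - 1)\<close> plus a residual of order
  \<open>1 / D n\<close>. Nothing contracts, and the residuals alone would add up to a logarithm of
  time; a bound that depends on \<open>d\<close> prevents this.\<close>

lemma W_asymptotics:
  "\<exists>U\<ge>0. \<forall>n d. \<bar>W n d - g d * D n / ((a + 1) * real k)\<bar> \<le> U"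
proof -
  define r where "r = (\<kappa> + real k) * P + (\<kappa> + real k) * \<kappa>"
  have r: "r \<ge> 0" using kappa_pos P_nonneg by (simp add: r_def)
  have res: "\<bar>w d * jump n d - w d / D n * (drift n (d - 1) - drift n d)\<bar> \<le> r / D n * of_bool (d \<le> 2 * k)"
    if d: "d \<ge> k" for n d
  proof (cases "d \<le> 2 * k")
    case True
    then have wd: "0 \<le> w d" "w d \<le> \<kappa> + real k" using w_pos[OF d] by (auto simp: w_def)
    have 1: "\<bar>w d * jump n d\<bar> \<le> (\<kappa> + real k) * (P / D n)"
      unfolding abs_mult using wd jump_le[of n d] by (intro mult_mono) auto
    have "\<bar>drift n (d - 1) - drift n d\<bar> \<le> \<kappa>"
      using drift_bounds[of n d] drift_bounds[of n "d - 1"] by linarith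
    moreover have "w d / D n \<le> (\<kappa> + real k) / D n"
      using D_pos[of n] by (intro divide_right_mono wd(2)) simp
    ultimately have 2: "\<bar>w d / D n * (drift n (d - 1) - drift n d)\<bar> \<le> (\<kappa> + real k) / D n * \<kappa>"
      unfolding abs_mult using wd D_pos[of n] by (intro mult_mono) auto
    have "r / D n = (\<kappa> + real k) * (P / D n) + (\<kappa> + real k) / D n * \<kappa>"
      unfolding r_def by (subst add_divide_distrib) simp
    then have "\<bar>w d * jump n d - w d / D n * (drift n (d - 1) - drift n d)\<bar> \<le> r / D n"
      using 1 2 by linarith
    then show ?thesis using True by simp
  next
    case False
    then have "jump n d = 0" "drift n d = 0" "drift n (d - 1) = 0"
      using k_pos by (auto simp: jump_eq_0 drift_def)
    then show ?thesis using False by simp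
  qed
  \<comment> \<open>From \<open>n0\<close> on, \<open>w d > D n\<close> forces
    \<open>d > Suc n + k\<close>, a degree that no complete block has at time
    \<open>Suc n\<close>.\<close>
  obtain n0 :: nat where n0: "real n0 * a \<ge> \<kappa> + 1"
    using reals_Archimedean3[OF a_pos] by (meson less_imp_le)
  \<comment> \<open>The first two summands cover times up to \<open>n0\<close>, the third the
    comparison term at impossible degrees (\<open>g_bound\<close>), the last the drift.\<close>
  define C0 where "C0 = (real n0 + \<kappa>) * real n0 + \<kappa> * D n0 / ((a + 1) * real k) + (a + 1) * \<kappa> / ((a + 1) * real k) + \<kappa>"
  \<comment> \<open>The residual lives on degrees up to \<open>2 * k\<close> only, so an increase of the bound there absorbs it.\<close>
  define U where "U d = C0 + r / \<kappa> * real (min d (2 * k) + 1 - k)" for d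
  have DK: "(a + 1) * real k > 0" using a_pos k_pos by simp
  have C0: "C0 \<ge> 0" using kappa_pos a_pos k_pos D_pos[of n0] DK
    unfolding C0_def by (intro add_nonneg_nonneg mult_nonneg_nonneg divide_nonneg_nonneg) auto
  have U_ge: "C0 \<le> U d" for d using r kappa_pos by (simp add: U_def)
  have early: "\<bar>err n d\<bar> \<le> U d" if "n \<le> n0" for n d
  proof -
    have "D n \<le> D n0" using that a_pos by (simp add: D_def mult_left_mono)
    then have "g d * D n / ((a + 1) * real k) \<le> \<kappa> * D n0 / ((a + 1) * real k)"
      using g_le[of d] g_nonneg[of d] D_pos[of n] DK kappa_pos by (intro divide_right_mono mult_mono) auto
    moreover have "0 \<le> g d * D n / ((a + 1) * real k)"
      using g_nonneg[of d] D_pos[of n] DK by simp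
    moreover have "W n d \<le> (real n0 + \<kappa>) * real n0"
      using that kappa_pos by (intro order_trans[OF W_bounds(2)] mult_mono) auto
    moreover have "0 \<le> (a + 1) * \<kappa> / ((a + 1) * real k)" "0 \<le> (real n0 + \<kappa>) * real n0"
      "0 \<le> \<kappa> * D n0 / ((a + 1) * real k)"
      using kappa_pos a_pos D_pos[of n0] by auto
    ultimately have "\<bar>err n d\<bar> \<le> C0"
      using drift_bounds[of n d] W_bounds(1)[of n d] unfolding err_def C0_def by linarith
    then show ?thesis using U_ge[of d] by linarith
  qed
  have bound: "\<bar>err n d\<bar> \<le> U d" for n d
  proof (cases "n \<le> n0")
    case False
    then have "n0 \<le> n" by simp
    then show ?thesis
    proof (induction n arbitrary: d rule: dec_induct)
      case base
      show ?case by (rule early) simp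
    next
      case (step n)
      consider "d < k" | "d \<ge> k" "w d \<le> D n" | "d \<ge> k" "w d > D n" by linarith
      then show ?case
      proof cases
        case 1
        then show ?thesis using U_ge[of d] C0 by (simp add: err_eq_0)
      next
        case 2
        let ?q = "w d / D n"
        have q: "0 \<le> ?q" "?q \<le> 1" using 2 D_pos[of n] w_pos[of d] by auto
        have "err n d + ?q * (err n (d - 1) - err n d) = (1 - ?q) * err n d + ?q * err n (d - 1)"
          by (simp add: algebra_simps)
        also have "\<bar>\<dots>\<bar> \<le> (1 - ?q) * U d + ?q * U (d - 1)"
        proof -
          have "\<bar>(1 - q) * x + q * z\<bar> \<le> (1 - q) * X + q * Z"
            if "0 \<le> q" "q \<le> 1" "\<bar>x\<bar> \<le> X" "\<bar>z\<bar> \<le> Z" for q x z X Z :: real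
          proof -
            have "\<bar>(1 - q) * x\<bar> \<le> (1 - q) * X" "\<bar>q * z\<bar> \<le> q * Z"
              using that by (auto simp: abs_mult intro!: mult_mono)
            then show ?thesis by linarith
          qed
          from this[OF q step.IH step.IH] show ?thesis .
        qed
        also have "\<dots> = U d - ?q * (U d - U (d - 1))"
        proof -
          have "(1 - q) * u + q * v = u - q * (u - v)" for q u v :: real by (simp add: algebra_simps)
          then show ?thesis .
        qed
        finally have *: "\<bar>err n d + ?q * (err n (d - 1) - err n d)\<bar> \<le> U d - ?q * (U d - U (d - 1))" .
        have "U d - U (d - 1) = r / \<kappa> * of_bool (d \<le> 2 * k)"
        proof (cases "d \<le> 2 * k")
          case True
          then have "min d (2 * k) + 1 - k = Suc (min (d - 1) (2 * k) + 1 - k)"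
            using 2(1) k_pos by auto
          then have "real (min d (2 * k) + 1 - k) = real (min (d - 1) (2 * k) + 1 - k) + 1" by simp
          then show ?thesis using True unfolding U_def by (simp add: distrib_left)
        next
          case False
          then have "min d (2 * k) = min (d - 1) (2 * k)" by auto
          then show ?thesis using False by (simp add: U_def)
        qed
        \<comment> \<open>An increment \<open>r / \<kappa>\<close> of \<open>U\<close> is felt with
          the factor \<open>w d / D n\<close>, which is at least
          \<open>\<kappa> / D n\<close>.\<close>
        moreover have "r / D n \<le> ?q * (r / \<kappa>)"
        proof -
          have "r * \<kappa> \<le> r * w d" using r w_ge[OF 2(1)] by (intro mult_left_mono)
          then show ?thesis using D_pos[of n] kappa_pos by (simp add: field_simps)
        qed
        ultimately have "r / D n * of_bool (d \<le> 2 * k) \<le> ?q * (U d - U (d - 1))"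
          by auto
        then show ?thesis using * res[OF 2(1), of n] unfolding err_Suc[OF 2(1)] by linarith
      next
        case 3
        \<comment> \<open>The combination is no longer convex here, but \<open>W\<close> vanishes at
          the next time and only bounded comparison terms remain.\<close>
        have "real n0 * a \<le> real (Suc n) * a"
          using step.hyps a_pos by (intro mult_right_mono) auto
        then have "real d > real (Suc n + k)"
          using 3(2) n0 by (simp add: w_def D_def algebra_simps)
        then have W0: "W (Suc n) d = 0"
          by (intro W_eq_0) linarith
        have "g d * D (Suc n) \<le> g d * (w d + a + 1)"
          using 3(2) by (intro mult_left_mono g_nonneg) (simp add: D_Suc)
        also have "\<dots> \<le> (a + 1) * \<kappa>" using g_bound[OF 3(1)] by (simp add: mult.commute)
        finally have "g d * D (Suc n) / ((a + 1) * real k) \<le> (a + 1) * \<kappa> / ((a + 1) * real k)"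
          using DK by (intro divide_right_mono) auto
        moreover have "0 \<le> g d * D (Suc n) / ((a + 1) * real k)"
          using g_nonneg[of d] D_pos[of "Suc n"] DK by simp
        moreover have "0 \<le> (real n0 + \<kappa>) * real n0" "0 \<le> \<kappa> * D n0 / ((a + 1) * real k)"
          using kappa_pos a_pos D_pos[of n0] DK by auto
        ultimately have "\<bar>err (Suc n) d\<bar> \<le> C0"
          using drift_bounds[of "Suc n" d] W0 unfolding err_def C0_def by linarith
        then show ?thesis using U_ge[of d] by linarith
      qed
    qed
  qed (rule early)
  define U' where "U' = C0 + r / \<kappa> * real (2 * k + 1) + \<kappa>"
  have "\<bar>W n d - g d * D n / ((a + 1) * real k)\<bar> \<le> U'" for n d
  proof -
    have "r / \<kappa> * real (min d (2 * k) + 1 - k) \<le> r / \<kappa> * real (2 * k + 1)"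
      using r kappa_pos by (intro mult_left_mono) auto
    then show ?thesis
      using bound[of n d] drift_bounds[of n d] unfolding U_def U'_def err_def by linarith
  qed
  moreover have "U' \<ge> 0" unfolding U'_def using C0 r kappa_pos a_pos by (intro add_nonneg_nonneg mult_nonneg_nonneg) auto
  ultimately show ?thesis by blast
qed

section \<open>Edges between blocks of given degrees\<close>

text \<open>
  The recurrences have a negative coefficient when the weight exceeds \<open>D n\<close>, but from some time on
  no block (pair of blocks) has such a weight.
\<close>

lemma late_weight:
  assumes "\<kappa> + 1 \<le> real n0 * a" "n0 \<le> n" "D n < w d"
  shows "Suc n + k < d"
proof -
  have "real n0 * a \<le> real (Suc n) * a" using assms(2) a_pos by (intro mult_right_mono) auto
  then have "real (Suc n + k) < real d" using assms(1,3) by (simp add: w_def D_def algebra_simps)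
  then show ?thesis by linarith
qed

lemma late_weight_pair:
  assumes "2 * \<kappa> + 1 \<le> real n0 * a" "n0 \<le> n" "D n < w d1 + w d2"
  shows "Suc n + 2 * k < d1 + d2"
proof -
  have "real n0 * a \<le> real (Suc n) * a" using assms(2) a_pos by (intro mult_right_mono) auto
  then have "real (Suc n + 2 * k) < real (d1 + d2)" using assms(1,3) by (simp add: w_def D_def algebra_simps)
  then show ?thesis by linarith
qed

text \<open>An unfinished block lives for only \<open>k\<close> steps, so errors of order
  \<open>1 / D n\<close> per step stay of that order. Each step adds \<open>W (d - 1) / D n\<close>,
  which is close to \<open>g (d - 1) / ((a + 1) * real k)\<close>; the rest is feedback from the
  edges already present.\<close>

lemma Y_asymptotics:
  "\<exists>C\<ge>0. \<forall>t d. k \<le> d \<longrightarrow> \<bar>Ex (k * Suc t) (Y t d) - g (d - 1) / (a + 1)\<bar> \<le> C / real (Suc t)"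
proof -
  obtain U where U: "U \<ge> 0" "\<And>n d. \<bar>W n d - g d * D n / ((a + 1) * real k)\<bar> \<le> U"
    using W_asymptotics by blast
  obtain n0 :: nat where n0: "real n0 * a \<ge> \<kappa> + 1"
    using reals_Archimedean3[OF a_pos] by (meson less_imp_le)
  \<comment> \<open>A bound for the growth per step of the weighted count \<open>u\<close>: the
    first two summands come from \<open>q * W\<close>, the last is the crude bound for large weights
    before time \<open>n0\<close>.\<close>
  define C1 where "C1 = (a + 1) * \<kappa> / ((a + 1) * real k) + U + (real n0 + \<kappa>) * (2 * real k)"
  have DK: "(a + 1) * real k > 0" using a_pos k_pos by simp
  have C1: "0 \<le> (a + 1) * \<kappa> / ((a + 1) * real k)" "0 \<le> (real n0 + \<kappa>) * (2 * real k)" "C1 \<ge> 0"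
    using U(1) kappa_pos a_pos unfolding C1_def by (auto intro!: add_nonneg_nonneg)
  \<comment> \<open>The scaled count is bounded uniformly in \<open>d\<close>, so its feedback is of
    order \<open>1 / D n\<close> although the factor \<open>w d / D n\<close> is not.\<close>
  define u where "u t i d = w d * Ex (k * t + i) (Y t d)" for t i d
  have step: "Ex (k * t + Suc i) (Y t d) = Ex (k * t + i) (Y t d)
      + (u t i (d - 1) + W (k * t + i) (d - 1) - u t i d) / D (k * t + i)"
    if i: "i < k" and d: "k \<le> d" for t i d
  proof -
    have t: "(k * t + i) div k = t" using i by simp
    have d1: "1 \<le> d" using d k_pos by simp
    have "Ex (Suc (k * t + i)) (Y t d) = Ex (k * t + i) (Y t d)
      + ((w d - 1) * (Ex (k * t + i) (Y t (d - 1)) + Ex (k * t + i) (N t (d - 1)))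
        - w d * Ex (k * t + i) (Y t d)) / D (k * t + i)"
      using Ex_Y_Suc[OF d1, of "k * t + i"] unfolding t .
    moreover have "(w d - 1) * (Ex (k * t + i) (Y t (d - 1)) + Ex (k * t + i) (N t (d - 1)))
        - w d * Ex (k * t + i) (Y t d) = u t i (d - 1) + W (k * t + i) (d - 1) - u t i d"
      using w_pred[OF d1] unfolding u_def W_def t by (simp add: distrib_left)
    ultimately show ?thesis by simp
  qed
  have u0: "u t i d = 0" if "i < k" "d < k" for t i d
    using Ex_cong[of "k * t + i" "Y t d" "\<lambda>_. 0"] Y_eq_0[of _ "k * t + i" t d] that
    by (simp add: u_def Ex_const)
  have u_ge: "0 \<le> u t i d" if "i < k" for t i d
    using u0[OF that, of d t] w_pos[of d] Ex_nonneg[of "k * t + i" "Y t d"] Y_nonneg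
    by (cases "d < k") (auto simp: u_def)
  \<comment> \<open>At time \<open>k * t\<close> the block \<open>Suc t\<close> has no node
    yet.\<close>
  have base: "Ex (k * t) (Y t d) = 0" for t d
  proof -
    have "Y t d M = 0" if "M \<in> supp (k * t)" for M
      using deg_late_block_le[OF that, of t] Y_le[of t d M] Y_nonneg[of t d M] by simp
    then show ?thesis using Ex_cong[of "k * t" "Y t d" "\<lambda>_. 0"] by (simp add: Ex_const)
  qed
  have u_le: "i \<le> k \<Longrightarrow> k \<le> d \<Longrightarrow> u t i d \<le> real i * C1" for t i d
  proof (induction i arbitrary: d)
    case 0
    then show ?case by (simp add: u_def base)
  next
    case (Suc i)
    let ?n = "k * t + i"
    have i: "i < k" and d: "k \<le> d" using Suc.prems by auto
    have iC: "0 \<le> real i * C1" using C1 by simp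
    have iC': "real (Suc i) * C1 = real i * C1 + C1" by (simp add: distrib_right)
    show ?case
    proof (cases "w d \<le> D ?n")
      case True
      define q where "q = w d / D ?n"
      have q: "0 \<le> q" "q \<le> 1" using True D_pos[of ?n] w_pos[OF d] by (auto simp: q_def)
      have IH: "u t i (d - 1) \<le> real i * C1" "u t i d \<le> real i * C1"
        using Suc.IH[of "d - 1"] Suc.IH[of d] i d u0[OF i, of "d - 1" t] iC
        by (cases "d - 1 < k"; simp)+
      have "u t (Suc i) d = u t i d + q * (u t i (d - 1) + W ?n (d - 1) - u t i d)"
        using step[OF i d, of t] by (simp add: u_def q_def distrib_left)
      also have "\<dots> = (1 - q) * u t i d + q * u t i (d - 1) + q * W ?n (d - 1)"
        by (simp add: algebra_simps)
      also have "(1 - q) * u t i d \<le> (1 - q) * (real i * C1)"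
        using q IH by (intro mult_left_mono) auto
      also have "q * u t i (d - 1) \<le> q * (real i * C1)"
        using q IH by (intro mult_left_mono) auto
      also have "q * W ?n (d - 1) \<le> q * (g (d - 1) * D ?n / ((a + 1) * real k) + U)"
        using q U(2)[of ?n "d - 1"] by (intro mult_left_mono) auto
      also have "\<dots> = w d * g (d - 1) / ((a + 1) * real k) + q * U"
        using D_pos[of ?n] by (simp add: q_def distrib_left)
      also have "\<dots> \<le> (a + 1) * \<kappa> / ((a + 1) * real k) + U"
        using w_mult_g_pred_bound[OF d] DK q U(1)
        by (intro add_mono divide_right_mono mult_left_le_one_le) auto
      finally have "u t (Suc i) d \<le> (1 - q) * (real i * C1) + q * (real i * C1)
        + ((a + 1) * \<kappa> / ((a + 1) * real k) + U)" by simp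
      moreover have "(1 - q) * (real i * C1) + q * (real i * C1) = real i * C1" by (simp add: algebra_simps)
      moreover have "(a + 1) * \<kappa> / ((a + 1) * real k) + U \<le> C1"
        using C1(2) unfolding C1_def by linarith
      ultimately show ?thesis unfolding iC' by linarith
    next
      case False
      \<comment> \<open>Here \<open>1 - q\<close> would be negative. Either no block of degree
        \<open>d\<close> exists at the next time, or the time is below \<open>n0\<close> and crude
        bounds suffice.\<close>
      have t: "t \<le> Suc ?n div k" using k_pos by (simp add: div_le_mono le_trans less_eq_div_iff_mult_less_eq mult.commute)
      show ?thesis
      proof (cases "Suc ?n + k < d")
        case True
        then have "Ex (Suc ?n) (Y t d) = 0"
          using Ex_cong[of "Suc ?n" "Y t d" "\<lambda>_. 0"] Y_eq_0[of _ "Suc ?n" t d] t by (simp add: Ex_const)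
        then show ?thesis using iC C1 by (simp add: u_def distrib_right)
      next
        case small: False
        then have "?n < n0" using late_weight[OF n0, of ?n d] False by linarith
        then have "w d \<le> real n0 + \<kappa>" using small by (simp add: w_def)
        moreover have "Ex (Suc ?n) (Y t d) \<le> 2 * real k"
          using i by (intro Ex_le_const Y_le_supp) auto
        moreover have "0 \<le> Ex (Suc ?n) (Y t d)" by (intro Ex_nonneg Y_nonneg)
        ultimately have "u t (Suc i) d \<le> (real n0 + \<kappa>) * (2 * real k)"
          using kappa_pos unfolding u_def by (intro mult_mono) auto
        moreover have "(real n0 + \<kappa>) * (2 * real k) \<le> C1"
          using C1(1) U(1) unfolding C1_def by linarith
        ultimately show ?thesis unfolding iC' using iC by linarith
      qed
    qed
  qed
  \<comment> \<open>Feedback at most \<open>real k * C1\<close>, error of \<open>W\<close> at most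
    \<open>U\<close>, and \<open>D n \<ge> a * Suc t\<close>.\<close>
  define C2 where "C2 = (real k * C1 + U) / a"
  have C2: "C2 \<ge> 0" using C1 U(1) a_pos by (simp add: C2_def)
  have Y_i: "i \<le> k \<Longrightarrow> \<bar>Ex (k * t + i) (Y t d) - real i * (g (d - 1) / ((a + 1) * real k))\<bar>
      \<le> real i * (C2 / real (Suc t))" if d: "k \<le> d" for t i d
  proof (induction i)
    case 0
    then show ?case by (simp add: base)
  next
    case (Suc i)
    let ?n = "k * t + i"
    have i: "i < k" using Suc.prems by simp
    let ?g = "g (d - 1) / ((a + 1) * real k)"
    have "\<bar>u t i (d - 1) - u t i d\<bar> \<le> real i * C1"
    proof -
      have "u t i (d - 1) \<le> real i * C1"
        using u_le[of i "d - 1" t] i u0[OF i, of "d - 1" t] C1 by (cases "d - 1 < k") auto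
      moreover have "u t i d \<le> real i * C1" using u_le[of i d t] i d by simp
      ultimately show ?thesis using u_ge[OF i, of t d] u_ge[OF i, of t "d - 1"] by linarith
    qed
    also have "\<dots> \<le> real k * C1" using i C1 by (intro mult_right_mono) auto
    finally have "\<bar>u t i (d - 1) + W ?n (d - 1) - u t i d - g (d - 1) * D ?n / ((a + 1) * real k)\<bar> \<le> real k * C1 + U"
      using U(2)[of ?n "d - 1"] by linarith
    then have "\<bar>(u t i (d - 1) + W ?n (d - 1) - u t i d - g (d - 1) * D ?n / ((a + 1) * real k)) / D ?n\<bar>
        \<le> (real k * C1 + U) / D ?n"
      unfolding abs_divide using D_pos[of ?n] by (simp add: divide_right_mono)
    also have "(u t i (d - 1) + W ?n (d - 1) - u t i d - g (d - 1) * D ?n / ((a + 1) * real k)) / D ?n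
      = (u t i (d - 1) + W ?n (d - 1) - u t i d) / D ?n - ?g"
      using D_pos[of ?n] by (simp add: diff_divide_distrib)
    also have "(real k * C1 + U) / D ?n \<le> (real k * C1 + U) / (a * real (Suc t))"
    proof (intro divide_left_mono mult_pos_pos)
      have "Suc t \<le> Suc ?n" using k_pos by (simp add: trans_le_add1)
      then have "a * real (Suc t) \<le> a * real (Suc ?n)"
        using a_pos by (intro mult_left_mono of_nat_mono) auto
      then show "a * real (Suc t) \<le> D ?n" using D_ge[of ?n] by linarith
    qed (use C1 U(1) a_pos D_pos in auto)
    also have "\<dots> = C2 / real (Suc t)" by (simp add: C2_def)
    finally have increment: "\<bar>(u t i (d - 1) + W ?n (d - 1) - u t i d) / D ?n - ?g\<bar> \<le> C2 / real (Suc t)" .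
    have "\<bar>E + x - real (Suc i) * G\<bar> \<le> real (Suc i) * B"
      if "\<bar>x - G\<bar> \<le> B" "\<bar>E - real i * G\<bar> \<le> real i * B" for E x G B :: real
    proof -
      have "real (Suc i) * v = real i * v + v" for v by (simp add: distrib_right)
      then show ?thesis using that by (simp add: abs_le_iff)
    qed
    from this[OF increment Suc.IH[OF less_imp_le[OF i]]] show ?case
      unfolding step[OF i d] .
  qed
  have "\<bar>Ex (k * Suc t) (Y t d) - g (d - 1) / (a + 1)\<bar> \<le> real k * C2 / real (Suc t)" if "k \<le> d" for t d
    using Y_i[OF that, of k t] k_pos by (simp add: add.commute)
  moreover have "real k * C2 \<ge> 0" using C2 by simp
  ultimately show ?thesis by blast
qed

lemma Ex_abs_diff_le:
  assumes "\<And>M. M \<in> supp n \<Longrightarrow> \<bar>F M - G M\<bar> \<le> B M"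
  shows "\<bar>Ex n F - Ex n G\<bar> \<le> Ex n B"
proof -
  have "Ex n F \<le> Ex n (\<lambda>M. G M + B M)" "Ex n G \<le> Ex n (\<lambda>M. F M + B M)"
    using assms by (intro Ex_mono; force simp: abs_le_iff)+
  then show ?thesis by (simp add: Ex_add abs_le_iff)
qed

section \<open>Edges released at a completion\<close>

definition J :: "nat \<Rightarrow> nat \<Rightarrow> nat \<Rightarrow> real" where
  "J n d1 d2 = Ex (Suc n) (\<lambda>M. of_bool (deg M (Suc (n div k)) = d2) * Y (n div k) d1 M)
     + Ex (Suc n) (\<lambda>M. of_bool (deg M (Suc (n div k)) = d1) * Y (n div k) d2 M)"

text \<open>A block closes with degree \<open>k\<close> up to probability \<open>P / D n\<close>,
  and \<open>Y\<close> is then at most \<open>2 * real k\<close>; so the dependence between its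
  degree and \<open>Y\<close> is negligible and only the expectation of \<open>Y\<close>
  matters.\<close>

lemma J_asymptotics:
  "\<exists>C\<ge>0. \<forall>n d1 d2. Suc (n mod k) = k \<longrightarrow> k \<le> d1 \<longrightarrow> k \<le> d2 \<longrightarrow> \<bar>J n d1 d2 - src d1 d2\<bar> \<le> C / D n"
proof -
  obtain C where C: "C \<ge> 0" "\<And>t d. k \<le> d \<Longrightarrow> \<bar>Ex (k * Suc t) (Y t d) - g (d - 1) / (a + 1)\<bar> \<le> C / real (Suc t)"
    using Y_asymptotics by blast
  define C' where "C' = 2 * real k * P + C * ((a + 1) * real k)"
  have C': "C' \<ge> 0" using C(1) P_nonneg a_pos by (simp add: C'_def)
  have half: "\<bar>Ex (Suc n) (\<lambda>M. of_bool (deg M (Suc (n div k)) = d2) * Y (n div k) d1 M)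
      - of_bool (d2 = k) * (g (d1 - 1) / (a + 1))\<bar> \<le> C' / D n"
    if n: "Suc (n mod k) = k" and d: "k \<le> d1" for n d1 d2
  proof -
    let ?t = "n div k"
    have kt: "Suc n = k * Suc ?t" using n by (cases n rule: time_cases) auto
    have "\<bar>Ex (Suc n) (\<lambda>M. of_bool (deg M (Suc ?t) = d2) * Y ?t d1 M) - Ex (Suc n) (\<lambda>M. of_bool (d2 = k) * Y ?t d1 M)\<bar>
      \<le> Ex (Suc n) (\<lambda>M. 2 * real k * of_bool (deg M (Suc ?t) \<noteq> k))"
    proof (rule Ex_abs_diff_le)
      fix M assume M: "M \<in> supp (Suc n)"
      have "Y ?t d1 M \<le> 2 * real k" by (rule Y_le_supp[OF M]) (simp_all add: kt)
      then show "\<bar>of_bool (deg M (Suc ?t) = d2) * Y ?t d1 M - of_bool (d2 = k) * Y ?t d1 M\<bar>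
          \<le> 2 * real k * of_bool (deg M (Suc ?t) \<noteq> k)"
        using Y_nonneg[of ?t d1 M] by auto
    qed
    also have "\<dots> \<le> 2 * real k * (P / D n)"
      unfolding Ex_cmult using Ex_deg_last_le[OF kt] by (intro mult_left_mono) auto
    finally have 1: "\<bar>Ex (Suc n) (\<lambda>M. of_bool (deg M (Suc ?t) = d2) * Y ?t d1 M) - of_bool (d2 = k) * Ex (Suc n) (Y ?t d1)\<bar>
      \<le> 2 * real k * (P / D n)" by (simp only: Ex_cmult)
    have "\<bar>of_bool (d2 = k) * Ex (Suc n) (Y ?t d1) - of_bool (d2 = k) * (g (d1 - 1) / (a + 1))\<bar>
      \<le> \<bar>Ex (Suc n) (Y ?t d1) - g (d1 - 1) / (a + 1)\<bar>" by auto
    also have "\<dots> \<le> C * (1 / real (Suc ?t))" using C(2)[OF d, of ?t] unfolding kt by simp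
    also have "\<dots> \<le> C * ((a + 1) * real k / D n)"
      using C(1) by (intro mult_left_mono inverse_time_le kt)
    finally have 2: "\<bar>of_bool (d2 = k) * Ex (Suc n) (Y ?t d1) - of_bool (d2 = k) * (g (d1 - 1) / (a + 1))\<bar>
      \<le> C * ((a + 1) * real k / D n)" .
    have "C' / D n = 2 * real k * (P / D n) + C * ((a + 1) * real k / D n)"
      unfolding C'_def by (subst add_divide_distrib) simp
    then show ?thesis using 1 2 by linarith
  qed
  have "\<bar>J n d1 d2 - src d1 d2\<bar> \<le> 2 * C' / D n" if "Suc (n mod k) = k" "k \<le> d1" "k \<le> d2" for n d1 d2
  proof -
    have src: "src d1 d2 = of_bool (d2 = k) * (g (d1 - 1) / (a + 1)) + of_bool (d1 = k) * (g (d2 - 1) / (a + 1))"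
      by (simp add: src_def add_divide_distrib)
    have "\<bar>x + x' - (q + q')\<bar> \<le> 2 * C' / D n" if "\<bar>x - q\<bar> \<le> C' / D n" "\<bar>x' - q'\<bar> \<le> C' / D n" for x x' q q'
      using that by linarith
    from this[OF half[OF that(1,2), of d2] half[OF that(1,3), of d1]]
    show ?thesis unfolding J_def src .
  qed
  then show ?thesis using C' by (intro exI[of _ "2 * C'"]) auto
qed

section \<open>Comparison of the edge counts\<close>

definition eZ :: "nat \<Rightarrow> nat \<Rightarrow> nat \<Rightarrow> real" where
  "eZ n d1 d2 = Ex n (Z (n div k) d1 d2)"

lemma eZ_Suc:
  assumes "d1 \<ge> k" "d2 \<ge> k"
  shows "eZ (Suc n) d1 d2 = eZ n d1 d2 + ((w d1 - 1) * eZ n (d1 - 1) d2 + (w d2 - 1) * eZ n d1 (d2 - 1)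
      - (w d1 + w d2) * eZ n d1 d2) / D n + (if Suc (n mod k) = k then J n d1 d2 else 0)"
proof -
  have d: "d1 \<ge> 1" "d2 \<ge> 1" using assms k_pos by auto
  have "eZ (Suc n) d1 d2 = Ex (Suc n) (Z (n div k) d1 d2) + (if Suc (n mod k) = k then J n d1 d2 else 0)"
  proof (cases n rule: time_cases)
    case last
    have "Ex (Suc n) (Z (Suc (n div k)) d1 d2) = Ex (Suc n) (\<lambda>M. Z (n div k) d1 d2 M
      + of_bool (deg M (Suc (n div k)) = d2) * Y (n div k) d1 M + of_bool (deg M (Suc (n div k)) = d1) * Y (n div k) d2 M)"
      by (intro Ex_cong) (simp add: Z_Suc)
    also have "\<dots> = Ex (Suc n) (Z (n div k) d1 d2) + J n d1 d2"
      unfolding Ex_add J_def by simp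
    finally show ?thesis unfolding eZ_def last(2) using last(1) by simp
  qed (simp add: eZ_def)
  then show ?thesis unfolding Ex_Z_Suc[OF d] eZ_def by simp
qed

lemma eZ_eq_0: "d1 < k \<or> d2 < k \<or> d1 + d2 > n + 2 * k \<Longrightarrow> eZ n d1 d2 = 0"
  using Ex_cong[of n "Z (n div k) d1 d2" "\<lambda>_. 0"] Z_eq_0[of _ n "n div k" d1 d2]
  by (auto simp: eZ_def Ex_const)

lemma eZ_bounds: "0 \<le> eZ n d1 d2" "eZ n d1 d2 \<le> real n * real (n + k)"
proof -
  show "0 \<le> eZ n d1 d2" unfolding eZ_def by (intro Ex_nonneg Z_nonneg)
  have "eZ n d1 d2 \<le> real (n div k) * real (n + k)"
    unfolding eZ_def by (intro Ex_le_const Z_le) auto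
  also have "\<dots> \<le> real n * real (n + k)" by (intro mult_right_mono) auto
  finally show "eZ n d1 d2 \<le> real n * real (n + k)" .
qed

text \<open>The analogue of \<open>drift\<close> for edges. Its support is unbounded, since only one
  of the two degrees has to be \<open>k\<close>; its decay in the other degree, inherited from
  \<open>src\<close>, keeps the residual of order \<open>1 / D n\<close>.\<close>

definition pair_drift :: "nat \<Rightarrow> nat \<Rightarrow> nat \<Rightarrow> real" where
  "pair_drift n d1 d2 = src d1 d2 * (real (n mod k) / real k)"

definition pair_err :: "nat \<Rightarrow> nat \<Rightarrow> nat \<Rightarrow> real" where
  "pair_err n d1 d2 = eZ n d1 d2 - c d1 d2 * D n / ((a + 1) * real k) + pair_drift n d1 d2"

lemma pair_err_eq_0: "d1 < k \<or> d2 < k \<Longrightarrow> pair_err n d1 d2 = 0"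
  using eZ_eq_0[of d1 d2 n] by (auto simp: pair_err_def pair_drift_def c_eq_0 src_eq_0)

lemma pair_err_Suc:
  assumes d: "d1 \<ge> k" "d2 \<ge> k"
  shows "pair_err (Suc n) d1 d2 = pair_err n d1 d2 + ((w d1 - 1) * pair_err n (d1 - 1) d2 + (w d2 - 1) * pair_err n d1 (d2 - 1)
      - (w d1 + w d2) * pair_err n d1 d2) / D n
    + ((if Suc (n mod k) = k then J n d1 d2 - src d1 d2 else 0)
       - ((w d1 - 1) * pair_drift n (d1 - 1) d2 + (w d2 - 1) * pair_drift n d1 (d2 - 1) - (w d1 + w d2) * pair_drift n d1 d2) / D n)"
proof -
  define V where "V n d1 d2 = c d1 d2 * D n / ((a + 1) * real k)" for n d1 d2
  define L where "L f = ((w d1 - 1) * f (d1 - 1) d2 + (w d2 - 1) * f d1 (d2 - 1) - (w d1 + w d2) * f d1 d2) / D n"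
    for f :: "nat \<Rightarrow> nat \<Rightarrow> real"
  have V1: "V (Suc n) d1 d2 = V n d1 d2 + c d1 d2 / real k"
  proof -
    have "x * (z + q) / (q * real k) = x * z / (q * real k) + x / real k" if "q > 0" for x z q
      using that k_pos by (simp add: field_simps)
    then show ?thesis unfolding V_def D_Suc using a_pos by simp
  qed
  have "L (V n) = ((w d1 - 1) * c (d1 - 1) d2 + (w d2 - 1) * c d1 (d2 - 1) - (w d1 + w d2) * c d1 d2) / ((a + 1) * real k)"
  proof -
    have "(u1 * (x1 * z / q) + u2 * (x2 * z / q) - u3 * (x3 * z / q)) / z = (u1 * x1 + u2 * x2 - u3 * x3) / q"
      if "z > 0" for u1 u2 u3 x1 x2 x3 z q :: real
      using that by (simp add: add_divide_distrib diff_divide_distrib)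
    then show ?thesis unfolding V_def L_def using D_pos[of n] by simp
  qed
  also have "(w d1 - 1) * c (d1 - 1) d2 + (w d2 - 1) * c d1 (d2 - 1) - (w d1 + w d2) * c d1 d2
    = (a + 1) * (c d1 d2 - src d1 d2)"
    using c_rec[OF d] by (simp add: algebra_simps)
  also have "(a + 1) * (c d1 d2 - src d1 d2) / ((a + 1) * real k) = c d1 d2 / real k - src d1 d2 / real k"
    using a_pos by (simp add: diff_divide_distrib)
  finally have V2: "L (V n) = c d1 d2 / real k - src d1 d2 / real k" .
  have b: "pair_drift (Suc n) d1 d2 = pair_drift n d1 d2 + src d1 d2 / real k - (if Suc (n mod k) = k then src d1 d2 else 0)"
  proof (cases n rule: time_cases)
    case inner
    then show ?thesis unfolding pair_drift_def inner(3) by (simp add: add_divide_distrib distrib_left)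
  next
    case last
    then have r: "real (n mod k) = real k - 1" by linarith
    have "src d1 d2 * ((real k - 1) / real k) = src d1 d2 - src d1 d2 / real k"
      using k_pos by (simp add: diff_divide_distrib right_diff_distrib)
    then show ?thesis unfolding pair_drift_def last(3) r using last(1) by simp
  qed
  have Z: "pair_err n = (\<lambda>d1 d2. eZ n d1 d2 - V n d1 d2 + pair_drift n d1 d2)" for n by (simp add: fun_eq_iff pair_err_def V_def)
  have L: "L (\<lambda>d1 d2. f d1 d2 - v d1 d2 + b d1 d2) = L f - L v + L b" for f v b
    unfolding L_def by (simp add: add_divide_distrib [symmetric] diff_divide_distrib [symmetric] algebra_simps)
  have Lz: "L (pair_err n) = L (eZ n) - L (V n) + L (pair_drift n)"
    unfolding Z by (rule L)
  have "eZ (Suc n) d1 d2 = eZ n d1 d2 + L (eZ n) + (if Suc (n mod k) = k then J n d1 d2 else 0)"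
    unfolding L_def by (rule eZ_Suc[OF d])
  then have "pair_err (Suc n) d1 d2 = pair_err n d1 d2 + L (pair_err n)
    + ((if Suc (n mod k) = k then J n d1 d2 - src d1 d2 else 0) - L (pair_drift n))"
    using V1 V2 b Lz unfolding Z by (simp split: if_splits)
  then show ?thesis by (simp only: L_def)
qed

lemma eZ_asymptotics:
  "\<exists>C\<ge>0. \<forall>n d1 d2. k \<le> d1 \<longrightarrow> k \<le> d2 \<longrightarrow> \<bar>pair_err n d1 d2\<bar> \<le> C"
proof -
  obtain CJ where CJ: "CJ \<ge> 0" "\<And>n d1 d2. Suc (n mod k) = k \<Longrightarrow> k \<le> d1 \<Longrightarrow> k \<le> d2 \<Longrightarrow> \<bar>J n d1 d2 - src d1 d2\<bar> \<le> CJ / D n"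
    using J_asymptotics by blast
  obtain S where S: "S \<ge> 0" "\<And>d1 d2. k \<le> d1 \<Longrightarrow> k \<le> d2 \<Longrightarrow> (w d1 + w d2 + a + 1) * c d1 d2 \<le> S"
    using c_bound by blast
  obtain n0 :: nat where n0: "real n0 * a \<ge> 2 * \<kappa> + 1"
    using reals_Archimedean3[OF a_pos] by (meson less_imp_le)
  define Q where "Q = 2 * (\<kappa> + 1) * (\<kappa> + a + 1)"
  have Q: "Q \<ge> 0" using kappa_pos a_pos by (simp add: Q_def)
  have pair_drift_nonneg: "0 \<le> pair_drift n d1 d2" for n d1 d2 using src_nonneg by (simp add: pair_drift_def)
  have pair_drift_le_src: "pair_drift n d1 d2 \<le> src d1 d2" for n d1 d2
    using src_nonneg[of d1 d2] k_pos unfolding pair_drift_def by (intro mult_left_le) (auto simp: less_imp_le)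
  have pair_drift_bound: "(w d1 + w d2 + a) * pair_drift n d1 d2 \<le> Q" if "k \<le> d1" "k \<le> d2" for n d1 d2
  proof -
    have "(w d1 + w d2 + a) * pair_drift n d1 d2 \<le> (w d1 + w d2 + a) * src d1 d2"
      using w_pos[of d1] w_pos[of d2] a_pos that by (intro mult_left_mono pair_drift_le_src) auto
    also have "\<dots> \<le> Q" using src_bound[OF that] by (simp add: Q_def)
    finally show ?thesis .
  qed
  define R where "R = CJ + 3 * Q"
  have res: "\<bar>(if Suc (n mod k) = k then J n d1 d2 - src d1 d2 else 0)
       - ((w d1 - 1) * pair_drift n (d1 - 1) d2 + (w d2 - 1) * pair_drift n d1 (d2 - 1) - (w d1 + w d2) * pair_drift n d1 d2) / D n\<bar> \<le> R / D n"
    if d: "k \<le> d1" "k \<le> d2" for n d1 d2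
  proof -
    have 1: "\<bar>(if Suc (n mod k) = k then J n d1 d2 - src d1 d2 else 0)\<bar> \<le> CJ / D n"
      using CJ(1) CJ(2)[OF _ d, of n] D_pos[of n] by simp
    have 2: "\<bar>(w d1 + w d2) * pair_drift n d1 d2\<bar> \<le> Q"
    proof -
      have "(w d1 + w d2) * pair_drift n d1 d2 \<le> (w d1 + w d2 + a) * pair_drift n d1 d2"
        using a_pos by (intro mult_right_mono pair_drift_nonneg) simp
      then show ?thesis using pair_drift_bound[OF d, of n] pair_drift_nonneg[of n d1 d2] w_pos d by (simp add: add_nonneg_nonneg less_imp_le)
    qed
    have 3: "\<bar>(w d1 - 1) * pair_drift n (d1 - 1) d2\<bar> \<le> Q"
    proof (cases "d1 = k")
      case False
      then have d': "k \<le> d1 - 1" "1 \<le> d1" using d by auto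
      have "(w d1 - 1) * pair_drift n (d1 - 1) d2 \<le> (w (d1 - 1) + w d2 + a) * pair_drift n (d1 - 1) d2"
        using a_pos w_pos[OF d(2)] w_pred[OF d'(2)] by (intro mult_right_mono pair_drift_nonneg) simp
      moreover have "0 \<le> w d1 - 1" using w_pos[OF d'(1)] w_pred[OF d'(2)] by simp
      ultimately show ?thesis using pair_drift_bound[OF d'(1) d(2), of n] pair_drift_nonneg[of n "d1 - 1" d2] by (simp add: abs_mult)
    qed (use Q k_pos in \<open>simp add: pair_drift_def src_eq_0\<close>)
    have 4: "\<bar>(w d2 - 1) * pair_drift n d1 (d2 - 1)\<bar> \<le> Q"
    proof (cases "d2 = k")
      case False
      then have d': "k \<le> d2 - 1" "1 \<le> d2" using d by auto
      have "(w d2 - 1) * pair_drift n d1 (d2 - 1) \<le> (w d1 + w (d2 - 1) + a) * pair_drift n d1 (d2 - 1)"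
        using a_pos w_pos[OF d(1)] w_pred[OF d'(2)] by (intro mult_right_mono pair_drift_nonneg) simp
      moreover have "0 \<le> w d2 - 1" using w_pos[OF d'(1)] w_pred[OF d'(2)] by simp
      ultimately show ?thesis using pair_drift_bound[OF d(1) d'(1), of n] pair_drift_nonneg[of n d1 "d2 - 1"] by (simp add: abs_mult)
    qed (use Q k_pos in \<open>simp add: pair_drift_def src_eq_0\<close>)
    have "\<bar>((w d1 - 1) * pair_drift n (d1 - 1) d2 + (w d2 - 1) * pair_drift n d1 (d2 - 1) - (w d1 + w d2) * pair_drift n d1 d2) / D n\<bar> \<le> 3 * Q / D n"
      unfolding abs_divide abs_of_pos[OF D_pos] using 2 3 4 by (intro divide_right_mono less_imp_le[OF D_pos]) linarith
    moreover have "R / D n = CJ / D n + 3 * Q / D n" by (simp add: R_def add_divide_distrib)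
    ultimately show ?thesis using 1 by linarith
  qed
  have DK: "(a + 1) * real k > 0" using a_pos k_pos by simp
  \<comment> \<open>Early times need the first two summands, impossible degrees the third, the drift
    the fourth. The last makes \<open>2 * \<mu> * C0 \<ge> R\<close>, so that the gap between loss
    and gain pays for the residual.\<close>
  define C0 where "C0 = real n0 * real (n0 + k) + S * D n0 / ((a + 1) * real k) + S / ((a + 1) * real k) + Q / a + R / (2 * \<mu>)"
  have parts: "0 \<le> real n0 * real (n0 + k)" "0 \<le> S * D n0 / ((a + 1) * real k)" "0 \<le> S / ((a + 1) * real k)" "0 \<le> Q / a" "0 \<le> R / (2 * \<mu>)"
    using S(1) D_pos[of n0] a_pos Q CJ(1) mu_pos by (auto simp: R_def)
  have C0: "0 \<le> C0" and muC0: "R \<le> 2 * \<mu> * C0"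
  proof -
    show "0 \<le> C0" using parts unfolding C0_def by linarith
    have "R / (2 * \<mu>) \<le> C0" using parts unfolding C0_def by linarith
    then show "R \<le> 2 * \<mu> * C0" using mu_pos by (simp add: field_simps)
  qed
  have pair_drift_le: "pair_drift n d1 d2 \<le> Q / a" if "k \<le> d1" "k \<le> d2" for n d1 d2
  proof -
    have "a * pair_drift n d1 d2 \<le> (w d1 + w d2 + a) * pair_drift n d1 d2"
      using w_pos[of d1] w_pos[of d2] that by (intro mult_right_mono pair_drift_nonneg) auto
    then have "a * pair_drift n d1 d2 \<le> Q" using pair_drift_bound[OF that, of n] by linarith
    then show ?thesis using a_pos by (simp add: field_simps)
  qed
  have early: "\<bar>pair_err n d1 d2\<bar> \<le> C0" if n: "n \<le> n0" and d: "k \<le> d1" "k \<le> d2" for n d1 d2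
  proof -
    have "1 * c d1 d2 \<le> (w d1 + w d2 + a + 1) * c d1 d2"
      using w_pos[of d1] w_pos[of d2] a_pos d by (intro mult_right_mono c_nonneg) auto
    then have "c d1 d2 \<le> S" using S(2)[OF d] by linarith
    moreover have "D n \<le> D n0" using n a_pos by (simp add: D_def mult_left_mono)
    ultimately have "c d1 d2 * D n / ((a + 1) * real k) \<le> S * D n0 / ((a + 1) * real k)"
      using D_pos[of n] DK S(1) by (intro divide_right_mono mult_mono) auto
    moreover have "0 \<le> c d1 d2 * D n / ((a + 1) * real k)"
      using c_nonneg[of d1 d2] D_pos[of n] DK by simp
    moreover have "eZ n d1 d2 \<le> real n0 * real (n0 + k)"
      using n by (intro order_trans[OF eZ_bounds(2)] mult_mono) auto
    ultimately show ?thesis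
      using pair_drift_le[OF d, of n] pair_drift_nonneg[of n d1 d2] eZ_bounds(1)[of n d1 d2] parts unfolding pair_err_def C0_def by linarith
  qed
  have bound: "\<bar>pair_err n d1 d2\<bar> \<le> C0" if "k \<le> d1" "k \<le> d2" for n d1 d2
  proof (cases "n \<le> n0")
    case False
    then have "n0 \<le> n" by simp
    then show ?thesis using that
    proof (induction n arbitrary: d1 d2 rule: dec_induct)
      case base
      then show ?case by (intro early) auto
    next
      case (step n)
      note d = step.prems
      let ?s = "w d1 + w d2"
      show ?case
      proof (cases "?s \<le> D n")
        case True
        have IH: "\<bar>pair_err n d1 d2\<bar> \<le> C0" by (rule step.IH[OF d])
        have IH1: "\<bar>(w d1 - 1) * pair_err n (d1 - 1) d2\<bar> \<le> (w d1 - \<mu>) * C0"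
          using step.IH[of "d1 - 1" d2] d C0 k_pos
          by (intro pred_weight_le) (cases "d1 = k"; auto simp: pair_err_eq_0)+
        have IH2: "\<bar>(w d2 - 1) * pair_err n d1 (d2 - 1)\<bar> \<le> (w d2 - \<mu>) * C0"
          using step.IH[of d1 "d2 - 1"] d C0 k_pos
          by (intro pred_weight_le) (cases "d2 = k"; auto simp: pair_err_eq_0)+
        have "\<bar>(D n - ?s) * pair_err n d1 d2\<bar> \<le> (D n - ?s) * C0"
          unfolding abs_mult using True IH by (intro mult_mono) auto
        then have "\<bar>(D n - ?s) * pair_err n d1 d2 + (w d1 - 1) * pair_err n (d1 - 1) d2 + (w d2 - 1) * pair_err n d1 (d2 - 1)\<bar>
          \<le> (D n - ?s) * C0 + (w d1 - \<mu>) * C0 + (w d2 - \<mu>) * C0"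
          using IH1 IH2 by linarith
        \<comment> \<open>The coefficients add up to \<open>D n - 2 * \<mu>\<close>, not
          \<open>D n\<close>: this is the contraction that the degree counts lack.\<close>
        also have "\<dots> = D n * C0 - 2 * \<mu> * C0" by (simp add: algebra_simps)
        also have "\<dots> \<le> D n * C0 - R" using muC0 by simp
        finally have "\<bar>((D n - ?s) * pair_err n d1 d2 + (w d1 - 1) * pair_err n (d1 - 1) d2 + (w d2 - 1) * pair_err n d1 (d2 - 1)) / D n\<bar>
          \<le> (D n * C0 - R) / D n"
          unfolding abs_divide abs_of_pos[OF D_pos] by (intro divide_right_mono less_imp_le[OF D_pos])
        also have "\<dots> = C0 - R / D n" using D_pos[of n] by (simp add: diff_divide_distrib)
        also have "((D n - ?s) * pair_err n d1 d2 + (w d1 - 1) * pair_err n (d1 - 1) d2 + (w d2 - 1) * pair_err n d1 (d2 - 1)) / D n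
          = pair_err n d1 d2 + ((w d1 - 1) * pair_err n (d1 - 1) d2 + (w d2 - 1) * pair_err n d1 (d2 - 1) - ?s * pair_err n d1 d2) / D n"
        proof -
          have "((D n - s) * x + p + q) / D n = x + (p + q - s * x) / D n" for s x p q
            using D_pos[of n] by (simp add: field_simps)
          then show ?thesis .
        qed
        finally show ?thesis unfolding pair_err_Suc[OF d] using res[OF d, of n] by linarith
      next
        case False
        then have "Suc n + 2 * k < d1 + d2"
          using late_weight_pair[OF n0 step.hyps(1), of d1 d2] by simp
        then have e0: "eZ (Suc n) d1 d2 = 0" by (simp add: eZ_eq_0)
        have "c d1 d2 * D (Suc n) \<le> c d1 d2 * (?s + a + 1)"
          using False by (intro mult_left_mono c_nonneg) (simp add: D_Suc)
        also have "\<dots> \<le> S" using S(2)[OF d] by (simp add: mult.commute)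
        finally have "c d1 d2 * D (Suc n) / ((a + 1) * real k) \<le> S / ((a + 1) * real k)"
          using DK by (intro divide_right_mono) auto
        moreover have "0 \<le> c d1 d2 * D (Suc n) / ((a + 1) * real k)"
          using c_nonneg[of d1 d2] D_pos[of "Suc n"] DK by simp
        ultimately show ?thesis
          using pair_drift_le[OF d, of "Suc n"] pair_drift_nonneg[of "Suc n" d1 d2] parts e0 unfolding pair_err_def C0_def by linarith
      qed
    qed
  qed (use early that in auto)
  then show ?thesis using C0 by blast
qed

text \<open>At \<open>n = k * t\<close> the drift is 0, and
  \<open>D (k * t) / ((a + 1) * real k)\<close> equals \<open>t\<close> plus the constant
  \<open>a / ((a + 1) * real k)\<close>.\<close>

theorem expected_X_asymptotics:
  "\<exists>C. \<forall>d1\<ge>k. \<forall>d2\<ge>k. \<forall>t. \<bar>expected_X a k d1 d2 t - c d1 d2 * real t\<bar> \<le> C"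
proof -
  obtain C where C: "\<And>n d1 d2. k \<le> d1 \<Longrightarrow> k \<le> d2 \<Longrightarrow> \<bar>pair_err n d1 d2\<bar> \<le> C"
    using eZ_asymptotics by blast
  obtain S where S: "S \<ge> 0" "\<And>d1 d2. k \<le> d1 \<Longrightarrow> k \<le> d2 \<Longrightarrow> (w d1 + w d2 + a + 1) * c d1 d2 \<le> S"
    using c_bound by blast
  have "\<bar>expected_X a k d1 d2 t - c d1 d2 * real t\<bar> \<le> C + S / real k" if d: "k \<le> d1" "k \<le> d2" for d1 d2 t
  proof -
    have "a * c d1 d2 \<le> (w d1 + w d2 + a + 1) * c d1 d2"
      using w_pos[of d1] w_pos[of d2] d by (intro mult_right_mono c_nonneg) auto
    then have 1: "a * c d1 d2 \<le> S" using S(2)[OF d] by linarith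
    have "a * c d1 d2 / ((a + 1) * real k) \<le> S / (1 * real k)"
      using 1 S(1) a_pos k_pos by (intro frac_le mult_right_mono) auto
    then have "a * c d1 d2 / ((a + 1) * real k) \<le> S / real k" by simp
    moreover have "0 \<le> a * c d1 d2 / ((a + 1) * real k)" using a_pos c_nonneg by simp
    moreover have "c d1 d2 * D (k * t) / ((a + 1) * real k) = c d1 d2 * real t + a * c d1 d2 / ((a + 1) * real k)"
    proof -
      have "D (k * t) = (a + 1) * real k * real t + a" by (simp add: D_def algebra_simps)
      moreover have "x * (q * u + v) / q = x * u + v * x / q" if "q > 0" for x q u v :: real
        using that by (simp add: field_simps)
      ultimately show ?thesis using a_pos k_pos by simp
    qed
    moreover have "pair_err (k * t) d1 d2 = expected_X a k d1 d2 t - c d1 d2 * D (k * t) / ((a + 1) * real k)"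
      using k_pos by (simp add: pair_err_def pair_drift_def eZ_def expected_X_eq_Ex)
    ultimately show ?thesis using C[OF d, of "k * t"] by linarith
  qed
  then show ?thesis by blast
qed

section \<open>The mean value property and bounds for \<open>\<theta>\<close>\<close>

text \<open>\<open>B\<close> is \<open>c\<close> normalised so that its recurrence becomes a weighted mean; \<open>h\<close> is an exact solution.\<close>

definition R :: "real \<Rightarrow> real" where "R s = Gamma (s + 1) / Gamma (s + a + 2)"

definition B :: "nat \<Rightarrow> nat \<Rightarrow> real" where
  "B d1 d2 = c d1 d2 * (w d1 * w d2) / (K * \<kappa> * R (w d1 + w d2))"

definition h :: "real \<Rightarrow> real \<Rightarrow> real" where
  "h x y = (x + y + 1) * (x + y + 2) / ((x + 1) * (y + 1))"

definition \<theta> :: "nat \<Rightarrow> nat \<Rightarrow> real" where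
  "\<theta> d1 d2 = B d1 d2 - h (w d1) (w d2)"

lemma R_pos: "s > 0 \<Longrightarrow> R s > 0"
  using a_pos by (auto simp: R_def intro!: divide_pos_pos Gamma_real_pos)

lemma R_pred:
  assumes "s > 1"
  shows "R (s - 1) = R s * (s + a + 1) / s"
proof -
  have "Gamma (s + 1) = s * Gamma s" "Gamma (s + a + 2) = (s + a + 1) * Gamma (s + a + 1)"
    using Gamma_real_plus1[of s] Gamma_real_plus1[of "s + a + 1"] assms a_pos by (auto simp: add_ac)
  moreover have "R (s - 1) = Gamma s / Gamma (s + a + 1)"
  proof -
    have "s - 1 + 1 = s" "s - 1 + a + 2 = s + a + 1" by simp_all
    then show ?thesis unfolding R_def by metis
  qed
  moreover have "s + a + 1 > 0" using assms a_pos by simp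
  ultimately show ?thesis using assms by (simp add: R_def)
qed

lemma c_eq_B:
  assumes "d1 \<ge> k" "d2 \<ge> k"
  shows "c d1 d2 = B d1 d2 * (K * \<kappa> * R (w d1 + w d2)) / (w d1 * w d2)"
proof -
  have "R (w d1 + w d2) > 0" using w_pos assms by (intro R_pos) (simp add: add_pos_pos)
  then have "K * \<kappa> * R (w d1 + w d2) > 0" using mult_pos_pos[OF mult_pos_pos[OF K_pos kappa_pos]] by blast
  moreover have "x = x * m / q * q / m" if "q > 0" "m > 0" for x q m :: real using that by simp
  ultimately show ?thesis
    unfolding B_def using w_pos[OF assms(1)] w_pos[OF assms(2)] mult_pos_pos by blast
qed

lemma B_pred:
  assumes "d1 \<ge> k" "d2 \<ge> k"
  shows "(w d1 - 1) * c (d1 - 1) d2 = B (d1 - 1) d2 * (K * \<kappa> * R (w d1 + w d2))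
    * ((w d1 + w d2 + a + 1) / (w d1 + w d2)) / w d2"
proof (cases "d1 = k")
  case True
  \<comment> \<open>The normalising factors of \<open>B (k - 1) d2\<close> need not be positive, but
    \<open>c\<close> is 0 there, hence so is \<open>B\<close>.\<close>
  then show ?thesis using k_pos by (simp add: B_def c_eq_0)
next
  case False
  then have d: "k \<le> d1 - 1" "1 \<le> d1" using assms by auto
  have w: "w (d1 - 1) = w d1 - 1" using w_pred[OF d(2)] by simp
  have "w d1 - 1 > 0" using w_pos[OF d(1)] w by simp
  moreover have "R (w d1 - 1 + w d2) = R (w d1 + w d2) * (w d1 + w d2 + a + 1) / (w d1 + w d2)"
    using R_pred[of "w d1 + w d2"] \<open>w d1 - 1 > 0\<close> w_pos[OF assms(2)] by (simp add: add_diff_eq diff_add_eq)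
  ultimately show ?thesis
    unfolding c_eq_B[OF d(1) assms(2)] w by simp
qed

lemma B_rec:
  assumes d: "d1 \<ge> k" "d2 \<ge> k"
  shows "(w d1 + w d2) * B d1 d2 = w d1 * B (d1 - 1) d2 + w d2 * B d1 (d2 - 1)
    + (w d1 + w d2) * (w d1 * w d2) * ((a + 1) * src d1 d2)
      / ((w d1 + w d2 + a + 1) * (K * \<kappa> * R (w d1 + w d2)))"
proof -
  have B_commute: "B u v = B v u" for u v
    by (simp add: B_def c_commute[of u v] mult.commute[of "w u"] add.commute[of "w u"])
  have w: "w d1 > 0" "w d2 > 0" using w_pos d by auto
  define Q where "Q = K * \<kappa> * R (w d1 + w d2)"
  have Q: "Q > 0" unfolding Q_def using K_pos kappa_pos R_pos[of "w d1 + w d2"] w by simp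
  have "(w d2 - 1) * c d1 (d2 - 1) = B d1 (d2 - 1) * Q * ((w d1 + w d2 + a + 1) / (w d1 + w d2)) / w d1"
    using B_pred[OF d(2,1)] by (simp add: c_commute[of d1] B_commute[of d1] Q_def add.commute[of "w d1"])
  then have c_eq: "(w d1 + w d2 + a + 1) * (B d1 d2 * Q / (w d1 * w d2))
    = B (d1 - 1) d2 * Q * ((w d1 + w d2 + a + 1) / (w d1 + w d2)) / w d2
      + B d1 (d2 - 1) * Q * ((w d1 + w d2 + a + 1) / (w d1 + w d2)) / w d1 + (a + 1) * src d1 d2"
    using c_rec[OF d] B_pred[OF d] c_eq_B[OF d] by (simp add: Q_def)
  have *: "s * b = x * b1 + z * b2 + s * (x * z) * v / (q * r)"
    if "q * (b * r / (x * z)) = b1 * r * (q / s) / z + b2 * r * (q / s) / x + v"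
      "x > 0" "z > 0" "q > 0" "r > 0" "s > 0" for s b x z b1 b2 v q r :: real
  proof -
    have "s * b = q * (b * r / (x * z)) * (s * (x * z) / (q * r))" using that(2-) by simp
    also have "\<dots> = x * b1 + z * b2 + s * (x * z) * v / (q * r)"
      unfolding that(1) using that(2-) by (simp add: field_simps)
    finally show ?thesis .
  qed
  show ?thesis
    unfolding Q_def [symmetric] by (rule *[OF c_eq]) (use w Q a_pos in linarith)+
qed

lemma h_harmonic:
  assumes "x > 0" "y > 0"
  shows "(x + y) * h x y = x * h (x - 1) y + y * h x (y - 1)"
  using assms by (simp add: h_def divide_simps) (simp add: algebra_simps)

lemma theta_harmonic:
  assumes "d1 > k" "d2 > k"
  shows "(w d1 + w d2) * \<theta> d1 d2 = w d1 * \<theta> (d1 - 1) d2 + w d2 * \<theta> d1 (d2 - 1)"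
proof -
  have "1 \<le> d1" "1 \<le> d2" using assms by auto
  then have w: "w (d1 - 1) = w d1 - 1" "w (d2 - 1) = w d2 - 1" using w_pred by simp_all
  have "src d1 d2 = 0" using assms by (simp add: src_def)
  then show ?thesis
    using B_rec[of d1 d2] h_harmonic[of "w d1" "w d2"] w_pos[of d1] w_pos[of d2] assms
    unfolding \<theta>_def w by (simp add: right_diff_distrib)
qed

section \<open>Boundary values of \<open>\<theta>\<close>\<close>

definition \<rho> :: "real \<Rightarrow> real" where
  "\<rho> x = Gamma (x + 1) * Gamma (x + \<kappa> + a + 1) / (Gamma (x + a + 1) * Gamma (x + \<kappa> + 1))"

text \<open>For \<open>d2 = k\<close> one predecessor of \<open>B\<close> is missing and the
  normalised source is \<open>\<rho>\<close>. The function \<open>h\<close> has no such boundary: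
  with \<open>x = w d\<close>, its second term \<open>\<kappa> * h x (\<kappa> - 1)\<close> equals
  \<open>(x + \<kappa>) * (1 + \<kappa> / (x + 1))\<close>.\<close>

lemma theta_boundary:
  assumes "d > k"
  shows "(w d + \<kappa>) * \<theta> d k = w d * \<theta> (d - 1) k + (w d + \<kappa>) * (\<rho> (w d) - 1 - \<kappa> / (w d + 1))"
proof -
  let ?x = "w d" and ?s = "w d + \<kappa>"
  have d1: "1 \<le> d" using assms by auto
  have w: "w (d - 1) = ?x - 1" using w_pred[OF d1] by simp
  have x: "?x > 0" using w_pos[of d] assms by simp
  have "(a + 1) * src d k = g (d - 1)"
    using assms a_pos by (simp add: src_def)
  also have "\<dots> = K * (Gamma ?x / Gamma (?x + a + 1))"
  proof -
    have "\<not> d - 1 < k" "?x - 1 + 1 = ?x" "?x - 1 + a + 2 = ?x + a + 1" using assms by auto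
    then show ?thesis unfolding g_def w by metis
  qed
  finally have y: "(a + 1) * src d k = K * (Gamma ?x / Gamma (?x + a + 1))" .
  have B0: "B d (k - 1) = 0" using k_pos by (simp add: B_def c_eq_0)
  have src_eq: "?s * (?x * \<kappa>) * (K * (Gamma ?x / Gamma (?x + a + 1))) / ((?s + a + 1) * (K * \<kappa> * R ?s)) = ?s * \<rho> ?x"
  proof -
    have G: "Gamma (?x + 1) = ?x * Gamma ?x" "Gamma (?s + a + 2) = (?s + a + 1) * Gamma (?s + a + 1)"
      using Gamma_real_plus1[OF x] Gamma_real_plus1[of "?s + a + 1"] x kappa_pos a_pos by (auto simp: add_ac)
    have *: "s * (x * m) * (kk * (g1 / g2)) / (q * (kk * m * (g3 / (q * g4)))) = s * (x * g1 * g4 / (g2 * g3))"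
      if "m > 0" "kk > 0" "q > 0" for s x m kk g1 g2 g3 g4 q :: real
      using that by simp
    show ?thesis
      unfolding \<rho>_def R_def G
      by (rule *[OF kappa_pos K_pos]) (use x a_pos kappa_pos in linarith)
  qed
  have "?s * B d k = ?x * B (d - 1) k + ?s * \<rho> ?x"
    using B_rec[of d k] assms B0 unfolding w_k y src_eq by simp
  moreover have "?s * h ?x \<kappa> - ?x * h (?x - 1) \<kappa> = ?s * (1 + \<kappa> / (?x + 1))"
    using x kappa_pos by (simp add: h_def divide_simps) (simp add: algebra_simps)
  ultimately show ?thesis
    unfolding \<theta>_def w w_k by (simp add: algebra_simps)
qed

definition lower :: real where "lower = - 4 + 2 / (1 + \<kappa>)"

text \<open>\<open>a * \<kappa> * upper_at x\<close> majorises the inhomogeneous term of the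
  boundary recurrence and decreases along the boundary; \<open>upper\<close> is its value, divided
  by \<open>\<kappa>\<close>, at the first point \<open>w (Suc k) = \<kappa> + 1\<close>.\<close>

definition upper_at :: "real \<Rightarrow> real" where
  "upper_at x = Gamma x * Gamma (x + \<kappa> + a + 2) / (Gamma (x + \<kappa> + 1) * Gamma (x + a + 1))"

definition upper :: real where "upper = a * upper_at (\<kappa> + 1)"

text \<open>In the graph: an edge between two blocks is received by the older one, whose degree then
  exceeds \<open>k\<close>.\<close>

lemma c_base: "c k k = 0"
proof -
  have "(w k + w k + a + 1) * c k k = 0"
    using c_rec[of k k] k_pos by (simp add: c_eq_0 src_def g_def)
  moreover have "w k + w k + a + 1 > 0" using w_pos[of k] a_pos by simp
  ultimately show ?thesis by simp
qed

text \<open>As \<open>c k k = 0\<close>, this is \<open>- h \<kappa> \<kappa>\<close>; the lower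
  bound is attained.\<close>

lemma theta_base: "\<theta> k k = lower"
proof -
  have "(m + m + 1) * (m + m + 2) / ((m + 1) * (m + 1)) = 4 - 2 / (1 + m)" if "m > 0" for m :: real
    using that by (simp add: divide_simps) (simp add: algebra_simps)
  from this[OF kappa_pos] show ?thesis
    by (simp add: \<theta>_def B_def c_base h_def w_k lower_def)
qed

lemma upper_at_pos: "x > 0 \<Longrightarrow> upper_at x > 0"
  unfolding upper_at_def using kappa_pos a_pos
  by (intro divide_pos_pos mult_pos_pos Gamma_real_pos) linarith+

lemma upper_at_rho:
  assumes "x > 0"
  shows "upper_at x = \<rho> x * (x + \<kappa> + a + 1) / x"
proof -
  have G: "Gamma (x + 1) = x * Gamma x" by (rule Gamma_real_plus1[OF assms])
  have "x + \<kappa> + a + 2 = (x + \<kappa> + a + 1) + 1" by simp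
  then have G2: "Gamma (x + \<kappa> + a + 2) = (x + \<kappa> + a + 1) * Gamma (x + \<kappa> + a + 1)"
    using Gamma_real_plus1[of "x + \<kappa> + a + 1"] kappa_pos a_pos assms by (metis add_pos_pos zero_less_one)
  have "g1 * (q * g2) / (g3 * g4) = x * g1 * g2 / (g4 * g3) * q / x" for g1 g2 g3 g4 q :: real
    using assms by (simp add: mult_ac)
  then show ?thesis unfolding upper_at_def \<rho>_def G G2 .
qed

lemma upper_at_Suc:
  assumes "x > 0"
  shows "upper_at (x + 1) \<le> upper_at x"
proof -
  have e: "x + 1 + \<kappa> + a + 2 = (x + \<kappa> + a + 2) + 1" "x + 1 + \<kappa> + 1 = (x + \<kappa> + 1) + 1"
    "x + 1 + a + 1 = (x + a + 1) + 1" by simp_all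
  have pos: "x + \<kappa> + a + 2 > 0" "x + \<kappa> + 1 > 0" "x + a + 1 > 0"
    using assms kappa_pos a_pos by linarith+
  have "upper_at (x + 1) = upper_at x * (x * (x + \<kappa> + a + 2) / ((x + \<kappa> + 1) * (x + a + 1)))"
    unfolding upper_at_def e Gamma_real_plus1[OF assms] Gamma_real_plus1[OF pos(1)]
      Gamma_real_plus1[OF pos(2)] Gamma_real_plus1[OF pos(3)] by (simp add: mult_ac)
  also have "\<dots> \<le> upper_at x * 1"
  proof (intro mult_left_mono)
    have "x * (x + m + a + 2) \<le> (x + m + 1) * (x + a + 1)" if "m > 0" for m
      using that a_pos by (simp add: algebra_simps)
    from this[OF kappa_pos] show "x * (x + \<kappa> + a + 2) / ((x + \<kappa> + 1) * (x + a + 1)) \<le> 1"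
      using pos by simp
  qed (use upper_at_pos[OF assms] in simp)
  finally show ?thesis by simp
qed

lemma w_Suc: "w (Suc d) = w d + 1"
  by (simp add: w_def)

lemma upper_at_le: "Suc k \<le> d \<Longrightarrow> upper_at (w d) \<le> upper_at (\<kappa> + 1)"
proof (induction d rule: dec_induct)
  case base
  then show ?case by (simp only: w_Suc w_k order_refl)
next
  case (step d)
  have "upper_at (w (Suc d)) \<le> upper_at (w d)"
    unfolding w_Suc using step.hyps by (intro upper_at_Suc w_pos) simp
  then show ?case using step.IH by linarith
qed

lemma lower_le: "lower \<le> - 2"
proof -
  have "2 / (1 + m) \<le> 2" if "m > 0" for m :: real using that by (simp add: divide_simps)
  from this[OF kappa_pos] show ?thesis by (simp add: lower_def)
qed

lemma upper_pos: "upper > 0"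
  unfolding upper_def using a_pos kappa_pos by (intro mult_pos_pos upper_at_pos) auto

text \<open>With \<open>x = w (Suc d)\<close> the recurrence makes \<open>\<theta> (Suc d) k\<close>
  the mean, with weights \<open>x\<close> and \<open>\<kappa>\<close>, of
  \<open>\<theta> d k\<close> and the inhomogeneous term divided by \<open>\<kappa>\<close>; it is
  enough to keep the latter between \<open>lower\<close> and \<open>upper\<close>.\<close>

lemma theta_boundary_bounds: "k \<le> d \<Longrightarrow> lower \<le> \<theta> d k \<and> \<theta> d k \<le> upper"
proof (induction d rule: dec_induct)
  case base
  then show ?case using theta_base lower_le upper_pos by simp
next
  case (step d)
  define x where "x = w (Suc d)"
  define s where "s = x + \<kappa>"
  have x: "x > \<kappa>" "x > 0" using w_ge[OF step.hyps(1)] kappa_pos by (auto simp: x_def w_Suc)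
  have s: "s > 0" using x kappa_pos by (simp add: s_def)
  have rec: "s * \<theta> (Suc d) k = x * \<theta> d k + s * (\<rho> x - 1 - \<kappa> / (x + 1))"
    using theta_boundary[of "Suc d"] step.hyps by (simp add: x_def s_def)
  have rho: "1 \<le> \<rho> x" "\<rho> x - 1 \<le> \<rho> x * (a * \<kappa> / x)"
    using Gamma_cross_ratio_bounds[OF x(2) a_pos kappa_pos] unfolding \<rho>_def by auto
  have "s * lower \<le> s * \<theta> (Suc d) k"
  proof -
    have "s \<le> 2 * (x + 1)" using x by (simp add: s_def)
    also have "\<dots> \<le> - lower * (x + 1)" using lower_le x by (intro mult_right_mono) auto
    finally have "s * \<kappa> / (x + 1) \<le> - lower * \<kappa>"
      using x mult_right_mono[of s "- lower * (x + 1)" \<kappa>] kappa_pos by (simp add: pos_divide_le_eq mult_ac)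
    moreover have "x * lower \<le> x * \<theta> d k" using step.IH x by (intro mult_left_mono) auto
    moreover have "0 \<le> s * (\<rho> x - 1)" using s rho by simp
    moreover have "s * (\<rho> x - 1 - \<kappa> / (x + 1)) = s * (\<rho> x - 1) - s * \<kappa> / (x + 1)"
      by (simp add: right_diff_distrib)
    moreover have "s * lower = x * lower + lower * \<kappa>" by (simp add: s_def algebra_simps)
    ultimately show ?thesis unfolding rec by linarith
  qed
  moreover have "s * \<theta> (Suc d) k \<le> s * upper"
  proof -
    have "\<rho> x - 1 - \<kappa> / (x + 1) \<le> \<rho> x * (a * \<kappa> / x)"
      using rho(2) x kappa_pos divide_nonneg_nonneg[of \<kappa> "x + 1"] by linarith
    then have "s * (\<rho> x - 1 - \<kappa> / (x + 1)) \<le> s * (\<rho> x * (a * \<kappa> / x))"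
      using s by (intro mult_left_mono) auto
    also have "\<dots> = a * \<kappa> * (\<rho> x * s / x)" by simp
    \<comment> \<open>Enlarging \<open>s\<close> to \<open>x + \<kappa> + a + 1\<close> turns the
      bound into a single quotient of Gamma values.\<close>
    also have "\<dots> \<le> a * \<kappa> * (\<rho> x * (x + \<kappa> + a + 1) / x)"
      using a_pos x rho(1) kappa_pos unfolding s_def
      by (intro mult_left_mono divide_right_mono) auto
    also have "\<dots> = a * \<kappa> * upper_at x" using upper_at_rho[OF x(2)] by simp
    also have "\<dots> \<le> a * \<kappa> * upper_at (\<kappa> + 1)"
      using upper_at_le[of "Suc d"] step.hyps a_pos by (intro mult_left_mono) (auto simp: x_def)
    also have "\<dots> = \<kappa> * upper" by (simp add: upper_def)
    finally have "s * (\<rho> x - 1 - \<kappa> / (x + 1)) \<le> \<kappa> * upper" .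
    moreover have "x * \<theta> d k \<le> x * upper" using step.IH x by (intro mult_left_mono) auto
    ultimately show ?thesis unfolding rec by (simp add: s_def distrib_right)
  qed
  ultimately show ?case using s by simp
qed

lemma theta_commute: "\<theta> d1 d2 = \<theta> d2 d1"
  by (simp add: \<theta>_def B_def h_def c_commute[of d1] mult.commute[of "w d1"] add.commute[of "w d1"]
      mult.commute[of "w d1 + 1"])

lemma theta_bounds:
  assumes "k \<le> d1" "k \<le> d2"
  shows "lower \<le> \<theta> d1 d2 \<and> \<theta> d1 d2 \<le> upper"
  using assms
proof (induction "d1 + d2" arbitrary: d1 d2 rule: less_induct)
  case less
  show ?case
  proof (cases "d1 = k \<or> d2 = k")
    case True
    then show ?thesis
      using theta_boundary_bounds[of d1] theta_boundary_bounds[of d2] less.prems theta_commute[of d1 d2] by auto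
  next
    case False
    then have d: "k < d1" "k < d2" using less.prems by auto
    have w: "w d1 > 0" "w d2 > 0" using w_pos less.prems by auto
    have IH: "lower \<le> \<theta> (d1 - 1) d2" "\<theta> (d1 - 1) d2 \<le> upper" "lower \<le> \<theta> d1 (d2 - 1)" "\<theta> d1 (d2 - 1) \<le> upper"
      using less.hyps[of "d1 - 1" d2] less.hyps[of d1 "d2 - 1"] d by auto
    have "w d1 * lower \<le> w d1 * \<theta> (d1 - 1) d2" "w d2 * lower \<le> w d2 * \<theta> d1 (d2 - 1)"
      "w d1 * \<theta> (d1 - 1) d2 \<le> w d1 * upper" "w d2 * \<theta> d1 (d2 - 1) \<le> w d2 * upper"
      using IH w by (intro mult_left_mono; simp)+
    then have "(w d1 + w d2) * lower \<le> (w d1 + w d2) * \<theta> d1 d2" "(w d1 + w d2) * \<theta> d1 d2 \<le> (w d1 + w d2) * upper"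
      unfolding theta_harmonic[OF d] by (simp_all add: distrib_right)
    moreover have "w d1 + w d2 > 0" using w by simp
    ultimately show ?thesis by simp
  qed
qed

text \<open>The last fraction is \<open>1 / h\<close>, and
  \<open>B = h * (1 + \<theta> / h)\<close>; the factor \<open>h\<close> supplies the additional
  linear factors.\<close>

lemma c_eq_theta:
  assumes d: "k \<le> d1" "k \<le> d2"
  shows "c d1 d2 = K * \<kappa> * (R (w d1 + w d2) * (w d1 + w d2 + 1) * (w d1 + w d2 + 2))
      / (w d1 * (w d1 + 1) * (w d2 * (w d2 + 1)))
    * (1 + \<theta> d1 d2 * ((w d1 + 1) * (w d2 + 1) / ((w d1 + w d2 + 1) * (w d1 + w d2 + 2))))"
proof -
  have "b * q / (u * v) = q * ((u + v + 1) * (u + v + 2)) / (u * (u + 1) * (v * (v + 1)))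
      * (1 + (b - h u v) * ((u + 1) * (v + 1) / ((u + v + 1) * (u + v + 2))))" if "u > 0" "v > 0" for b q u v
  proof -
    have "h u v * ((u + 1) * (v + 1) / ((u + v + 1) * (u + v + 2))) = 1"
      using that by (simp add: h_def)
    then have "1 + (b - h u v) * ((u + 1) * (v + 1) / ((u + v + 1) * (u + v + 2)))
      = b * ((u + 1) * (v + 1) / ((u + v + 1) * (u + v + 2)))"
      by (simp only: left_diff_distrib)
    then show ?thesis using that by simp
  qed
  from this[OF w_pos[OF d(1)] w_pos[OF d(2)]] show ?thesis
    unfolding c_eq_B[OF d] \<theta>_def by (simp only: mult.assoc)
qed

section \<open>Asymptotics of the coefficients\<close>

lemma degree_factor_deviation:
  "\<exists>C\<ge>0. \<forall>d\<ge>k. \<bar>(real d)\<^sup>2 / (w d * (w d + 1)) - 1\<bar> \<le> C / real d"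
proof -
  define \<delta> where "\<delta> = \<kappa> - real k"
  let ?f = "\<lambda>n. (real n)\<^sup>2 / ((real n + \<delta>) * (real n + \<delta> + 1))"
  have "(\<lambda>n. real n * (?f n - 1)) \<longlonglongrightarrow> - (2 * \<delta> + 1)"
    by real_asymp
  from deviation_bound_from_limits[OF this this] obtain C where
    "C \<ge> 0" "\<And>n. n \<ge> 1 \<Longrightarrow> \<bar>?f n - 1\<bar> \<le> C / real n" by blast
  moreover have "w d = real d + \<delta>" for d by (simp add: w_def \<delta>_def)
  ultimately show ?thesis using k_pos by (intro exI[of _ C]) auto
qed

lemma sum_factor_deviation:
  "\<exists>C\<ge>0. \<forall>d1\<ge>k. \<forall>d2\<ge>k.
    \<bar>R (w d1 + w d2) * (w d1 + w d2 + 1) * (w d1 + w d2 + 2) * (real d1 + real d2) powr (a - 1) - 1\<bar>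
      \<le> C / (real d1 + real d2)"
proof -
  \<comment> \<open>All terms depend on \<open>n = d1 + d2\<close> alone; \<open>\<eta>\<close> is
    chosen so that \<open>n + \<eta> = w d1 + w d2 + 2\<close>, and \<open>l\<close>,
    \<open>u\<close> come from the two bounds of \<open>Gamma_ratio_bounds\<close> at
    \<open>x = w d1 + w d2 + 1\<close>.\<close>
  define \<eta> where "\<eta> = 2 * (\<kappa> - real k) + 2"
  define l where "l n = (real n + \<eta>) / (real n + \<eta> + a) powr a * real n powr (a - 1)" for n
  define u where "u n = (real n + \<eta>) / (real n + \<eta> - 1) powr a * real n powr (a - 1)" for n
  have l_lim: "(\<lambda>n. real n * (l n - 1)) \<longlonglongrightarrow> \<eta> - a * (\<eta> + a)"
    unfolding l_def using a_pos by real_asymp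
  have u_lim: "(\<lambda>n. real n * (u n - 1)) \<longlonglongrightarrow> \<eta> - a * (\<eta> - 1)"
    unfolding u_def using a_pos by real_asymp
  obtain C where C: "C \<ge> 0"
    "\<And>n x. n \<ge> 1 \<Longrightarrow> l n \<le> x \<Longrightarrow> x \<le> u n \<Longrightarrow> \<bar>x - 1\<bar> \<le> C / real n"
    using deviation_bound_from_limits[OF l_lim u_lim] by blast
  have "\<bar>R (w d1 + w d2) * (w d1 + w d2 + 1) * (w d1 + w d2 + 2) * (real d1 + real d2) powr (a - 1) - 1\<bar>
      \<le> C / (real d1 + real d2)" if d: "k \<le> d1" "k \<le> d2" for d1 d2
  proof -
    define s where "s = w d1 + w d2"
    have s: "s > 0" using w_pos d by (simp add: s_def add_pos_pos)
    have n: "real (d1 + d2) + \<eta> = s + 2" by (simp add: s_def w_def \<eta>_def)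
    have G: "Gamma (s + 2) = (s + 1) * Gamma (s + 1)"
      using Gamma_real_plus1[of "s + 1"] s by (simp add: add_ac)
    define q where "q = Gamma (s + 2 + a) / Gamma (s + 2)"
    have q: "(s + 1) powr a \<le> q" "q \<le> (s + 2 + a) powr a"
    proof -
      have e: "s + 2 = s + 1 + 1" by simp
      show "(s + 1) powr a \<le> q" "q \<le> (s + 2 + a) powr a"
        unfolding q_def e by (rule Gamma_ratio_bounds; use s a_pos in linarith)+
    qed
    have R: "R s * (s + 1) * (s + 2) = (s + 2) / q"
      unfolding R_def q_def G by (simp add: add_ac mult_ac)
    have "0 < (s + 1) powr a" using s by simp
    then have "(s + 2) / (s + 2 + a) powr a \<le> (s + 2) / q" "(s + 2) / q \<le> (s + 2) / (s + 1) powr a"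
      using q s by (intro frac_le; linarith)+
    moreover have "s + 2 - 1 = s + 1" by simp
    ultimately have "l (d1 + d2) \<le> R s * (s + 1) * (s + 2) * real (d1 + d2) powr (a - 1)"
      "R s * (s + 1) * (s + 2) * real (d1 + d2) powr (a - 1) \<le> u (d1 + d2)"
      unfolding l_def u_def n R by (metis mult_right_mono powr_ge_zero)+
    then show ?thesis
      using C(2)[of "d1 + d2"] d k_pos by (simp add: s_def)
  qed
  then show ?thesis using C(1) by blast
qed

lemma w_ge_mult: "k \<le> d \<Longrightarrow> min 1 a * real d \<le> w d"
proof (cases "a \<le> 1")
  case True
  assume "k \<le> d"
  then have "0 \<le> (1 - a) * (real d - real k)" using True by simp
  then show ?thesis using True by (simp add: w_def algebra_simps)
next
  case False
  then have "real k * 1 \<le> real k * a" by (intro mult_left_mono) auto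
  then show ?thesis using False by (simp add: w_def)
qed

lemma theta_factor_deviation:
  "\<exists>C\<ge>0. \<forall>d1\<ge>k. \<forall>d2\<ge>k.
    \<bar>\<theta> d1 d2 * ((w d1 + 1) * (w d2 + 1) / ((w d1 + w d2 + 1) * (w d1 + w d2 + 2)))\<bar>
      \<le> C * (real d1 * real d2 / (real d1 + real d2)\<^sup>2)"
proof -
  \<comment> \<open>Since \<open>lower < 0 < upper\<close>, the width of the interval bounds the
    absolute value of \<open>\<theta>\<close>.\<close>
  define T where "T = upper - lower"
  have T: "T \<ge> 0" using upper_pos lower_le by (simp add: T_def)
  define m where "m = min 1 a"
  have m: "m > 0" using a_pos by (simp add: m_def)
  define q where "q = \<kappa> + 1"
  have q: "q \<ge> 1" using kappa_pos unfolding q_def by linarith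
  have "\<bar>\<theta> d1 d2 * ((w d1 + 1) * (w d2 + 1) / ((w d1 + w d2 + 1) * (w d1 + w d2 + 2)))\<bar>
      \<le> T * q\<^sup>2 / m\<^sup>2 * (real d1 * real d2 / (real d1 + real d2)\<^sup>2)" if d: "k \<le> d1" "k \<le> d2" for d1 d2
  proof -
    have w: "w d1 > 0" "w d2 > 0" using w_pos d by auto
    have le: "w d + 1 \<le> q * real d" if "k \<le> d" for d
    proof -
      have "\<kappa> * 1 \<le> \<kappa> * real d" using that k_pos kappa_pos by (intro mult_left_mono) auto
      moreover have "1 \<le> real k" using k_pos by simp
      moreover have "q * real d = \<kappa> * real d + real d" by (simp add: q_def distrib_right)
      ultimately show ?thesis unfolding w_def by linarith
    qed
    have "m * real d1 + m * real d2 \<le> w d1 + w d2"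
      using w_ge_mult d unfolding m_def by (intro add_mono) auto
    then have s: "m * (real d1 + real d2) \<le> w d1 + w d2" by (simp add: distrib_left)
    have t: "0 < real d1 + real d2" using d k_pos by simp
    have "(m * (real d1 + real d2)) * (m * (real d1 + real d2)) \<le> (w d1 + w d2 + 1) * (w d1 + w d2 + 2)"
      using s w m t by (intro mult_mono) auto
    then have den: "m\<^sup>2 * (real d1 + real d2)\<^sup>2 \<le> (w d1 + w d2 + 1) * (w d1 + w d2 + 2)"
      by (simp add: power2_eq_square mult_ac)
    have num: "(w d1 + 1) * (w d2 + 1) \<le> (q * real d1) * (q * real d2)"
      using le[OF d(1)] le[OF d(2)] w q by (intro mult_mono) auto
    have "(w d1 + 1) * (w d2 + 1) / ((w d1 + w d2 + 1) * (w d1 + w d2 + 2))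
      \<le> (q * real d1) * (q * real d2) / (m\<^sup>2 * (real d1 + real d2)\<^sup>2)"
      using num den w m t q by (intro frac_le) auto
    also have "\<dots> = q\<^sup>2 / m\<^sup>2 * (real d1 * real d2 / (real d1 + real d2)\<^sup>2)"
      by (simp add: power2_eq_square mult_ac)
    finally have frac: "(w d1 + 1) * (w d2 + 1) / ((w d1 + w d2 + 1) * (w d1 + w d2 + 2))
      \<le> q\<^sup>2 / m\<^sup>2 * (real d1 * real d2 / (real d1 + real d2)\<^sup>2)" .
    have "\<bar>\<theta> d1 d2\<bar> \<le> T"
      using theta_bounds[OF d] upper_pos lower_le unfolding T_def by linarith
    then have "\<bar>\<theta> d1 d2\<bar> * \<bar>(w d1 + 1) * (w d2 + 1) / ((w d1 + w d2 + 1) * (w d1 + w d2 + 2))\<bar>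
      \<le> T * (q\<^sup>2 / m\<^sup>2 * (real d1 * real d2 / (real d1 + real d2)\<^sup>2))"
      using frac w T by (intro mult_mono) auto
    then show ?thesis unfolding abs_mult by (simp add: mult_ac)
  qed
  moreover have "T * q\<^sup>2 / m\<^sup>2 \<ge> 0" using T by simp
  ultimately show ?thesis by blast
qed

text \<open>The exact formula for \<open>c\<close> is the main term times \<open>F d1\<close>,
  \<open>F d2\<close>, \<open>G\<close> and \<open>V\<close>, each of which differs from 1 by at
  most a multiple of the error term.\<close>

lemma c_asymptotics:
  "\<exists>C. \<exists>\<epsilon>. \<forall>d1\<ge>k. \<forall>d2\<ge>k.
    c d1 d2 = \<kappa> * K * ((real d1 + real d2) powr (1 - a) / ((real d1)\<^sup>2 * (real d2)\<^sup>2)) * (1 + \<epsilon> d1 d2) \<and>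
    \<bar>\<epsilon> d1 d2\<bar> \<le> C * (1 / real d1 + 1 / real d2 + real d1 * real d2 / (real d1 + real d2)\<^sup>2)"
proof -
  obtain C1 where C1: "C1 \<ge> 0" "\<And>d. k \<le> d \<Longrightarrow> \<bar>(real d)\<^sup>2 / (w d * (w d + 1)) - 1\<bar> \<le> C1 / real d"
    using degree_factor_deviation by blast
  obtain C2 where C2: "C2 \<ge> 0" "\<And>d1 d2. k \<le> d1 \<Longrightarrow> k \<le> d2 \<Longrightarrow>
    \<bar>R (w d1 + w d2) * (w d1 + w d2 + 1) * (w d1 + w d2 + 2) * (real d1 + real d2) powr (a - 1) - 1\<bar>
      \<le> C2 / (real d1 + real d2)"
    using sum_factor_deviation by blast
  obtain C3 where C3: "C3 \<ge> 0" "\<And>d1 d2. k \<le> d1 \<Longrightarrow> k \<le> d2 \<Longrightarrow>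
    \<bar>\<theta> d1 d2 * ((w d1 + 1) * (w d2 + 1) / ((w d1 + w d2 + 1) * (w d1 + w d2 + 2)))\<bar>
      \<le> C3 * (real d1 * real d2 / (real d1 + real d2)\<^sup>2)"
    using theta_factor_deviation by blast
  define F where "F d = (real d)\<^sup>2 / (w d * (w d + 1))" for d
  define G where "G d1 d2 = R (w d1 + w d2) * (w d1 + w d2 + 1) * (w d1 + w d2 + 2) * (real d1 + real d2) powr (a - 1)"
    for d1 d2
  define V where "V d1 d2 = 1 + \<theta> d1 d2 * ((w d1 + 1) * (w d2 + 1) / ((w d1 + w d2 + 1) * (w d1 + w d2 + 2)))"
    for d1 d2
  \<comment> \<open>The 3 is the a priori bound on the error term, whose three summands are at most
    1 each.\<close>
  define A where "A = C1 + C1 + 3 * C1 * C1"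
  define A' where "A' = A + C2 + 3 * A * C2"
  define A'' where "A'' = A' + C3 + 3 * A' * C3"
  have A: "A \<ge> 0" "A' \<ge> 0" using C1(1) C2(1) by (auto simp: A_def A'_def)
  define \<epsilon> where "\<epsilon> d1 d2 = F d1 * F d2 * G d1 d2 * V d1 d2 - 1" for d1 d2
  have "c d1 d2 = \<kappa> * K * ((real d1 + real d2) powr (1 - a) / ((real d1)\<^sup>2 * (real d2)\<^sup>2)) * (1 + \<epsilon> d1 d2)"
    (is "_ = ?r") and "\<bar>\<epsilon> d1 d2\<bar> \<le> A'' * (1 / real d1 + 1 / real d2 + real d1 * real d2 / (real d1 + real d2)\<^sup>2)"
    (is "_ \<le> A'' * ?E") if d: "k \<le> d1" "k \<le> d2" for d1 d2
  proof -
    have pos: "1 \<le> real d1" "1 \<le> real d2" using d k_pos by auto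
    have powr: "(real d1 + real d2) powr (1 - a) * (real d1 + real d2) powr (a - 1) = 1"
      using pos by (simp add: powr_add [symmetric])
    have *: "m * kk * (x / (u1 * u2)) * (1 + ((u1 / v1) * (u2 / v2) * (r * x') * t - 1)) = kk * m * r / (v1 * v2) * t"
      if "x * x' = 1" "u1 > 0" "u2 > 0" for kk m x x' u1 u2 v1 v2 r t :: real
    proof -
      have "m * kk * (x / (u1 * u2)) * (1 + ((u1 / v1) * (u2 / v2) * (r * x') * t - 1))
        = (x * x') * (kk * m * r / (v1 * v2) * t)"
        using that(2,3) by (simp add: mult_ac)
      then show ?thesis using that(1) by simp
    qed
    have "?r = K * \<kappa> * (R (w d1 + w d2) * (w d1 + w d2 + 1) * (w d1 + w d2 + 2))
        / (w d1 * (w d1 + 1) * (w d2 * (w d2 + 1))) * V d1 d2"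
      unfolding \<epsilon>_def F_def G_def by (rule *[OF powr]) (use pos in auto)
    then show "c d1 d2 = ?r"
      unfolding c_eq_theta[OF d] V_def by simp
    have E: "0 \<le> real d1 * real d2 / (real d1 + real d2)\<^sup>2" "real d1 * real d2 / (real d1 + real d2)\<^sup>2 \<le> 1"
      "0 \<le> 1 / real d1" "0 \<le> 1 / real d2" "1 / real d1 \<le> 1" "1 / real d2 \<le> 1"
    proof -
      have "real d1 * real d2 \<le> (real d1 + real d2)\<^sup>2"
        using pos by (simp add: power2_eq_square algebra_simps)
      then show "real d1 * real d2 / (real d1 + real d2)\<^sup>2 \<le> 1"
        using pos by (simp add: divide_le_eq_1)
    qed (use pos in auto)
    have F1: "\<bar>F d1 - 1\<bar> \<le> C1 * ?E"
    proof -
      have "\<bar>F d1 - 1\<bar> \<le> C1 * (1 / real d1)" using C1(2)[OF d(1)] by (simp add: F_def)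
      also have "\<dots> \<le> C1 * ?E" using E by (intro mult_left_mono C1(1)) linarith
      finally show ?thesis .
    qed
    have F2: "\<bar>F d2 - 1\<bar> \<le> C1 * ?E"
    proof -
      have "\<bar>F d2 - 1\<bar> \<le> C1 * (1 / real d2)" using C1(2)[OF d(2)] by (simp add: F_def)
      also have "\<dots> \<le> C1 * ?E" using E by (intro mult_left_mono C1(1)) linarith
      finally show ?thesis .
    qed
    have G: "\<bar>G d1 d2 - 1\<bar> \<le> C2 * ?E"
    proof -
      have "\<bar>G d1 d2 - 1\<bar> \<le> C2 * (1 / (real d1 + real d2))" using C2(2)[OF d] by (simp add: G_def)
      also have "\<dots> \<le> C2 * ?E"
      proof (intro mult_left_mono C2(1))
        have "1 / (real d1 + real d2) \<le> 1 / real d1" using pos by (intro divide_left_mono) auto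
        then show "1 / (real d1 + real d2) \<le> ?E" using E by linarith
      qed
      finally show ?thesis .
    qed
    have V: "\<bar>V d1 d2 - 1\<bar> \<le> C3 * ?E"
    proof -
      have "\<bar>V d1 d2 - 1\<bar> \<le> C3 * (real d1 * real d2 / (real d1 + real d2)\<^sup>2)" using C3(2)[OF d] by (simp add: V_def)
      also have "\<dots> \<le> C3 * ?E" using E by (intro mult_left_mono C3(1)) linarith
      finally show ?thesis .
    qed
    have E3: "0 \<le> ?E" "?E \<le> 3" using E by linarith+
    have "\<bar>F d1 * F d2 - 1\<bar> \<le> A * ?E"
      unfolding A_def by (rule abs_mult_minus_one_le[OF F1 F2 E3 C1(1) C1(1)])
    then have "\<bar>F d1 * F d2 * G d1 d2 - 1\<bar> \<le> A' * ?E"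
      unfolding A'_def by (rule abs_mult_minus_one_le[OF _ G E3 A(1) C2(1)])
    then have "\<bar>F d1 * F d2 * G d1 d2 * V d1 d2 - 1\<bar> \<le> A'' * ?E"
      unfolding A''_def by (rule abs_mult_minus_one_le[OF _ V E3 A(2) C3(1)])
    then show "\<bar>\<epsilon> d1 d2\<bar> \<le> A'' * ?E" by (simp only: \<epsilon>_def)
  qed
  then show ?thesis by blast
qed

lemma c_eq_Gamma:
  assumes d: "k \<le> d1" "k \<le> d2"
  shows "c d1 d2 = Gamma (w d1) * Gamma (w d2) * Gamma (w d1 + w d2 + 3)
      / (Gamma (w d1 + 2) * Gamma (w d2 + 2) * Gamma (w d1 + w d2 + a + 2))
    * (\<kappa> * K)
    * (1 + \<theta> d1 d2 * ((w d1 + 1) * (w d2 + 1) / ((w d1 + w d2 + 1) * (w d1 + w d2 + 2))))"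
proof -
  define s where "s = w d1 + w d2"
  have w: "w d1 > 0" "w d2 > 0" using w_pos d by auto
  have Gamma_plus2: "Gamma (x + 2) = (x + 1) * (x * Gamma x)" if "x > 0" for x :: real
  proof -
    have e: "x + 2 = (x + 1) + 1" by simp
    show ?thesis
      unfolding e using Gamma_real_plus1[OF that] Gamma_real_plus1[of "x + 1"] that by simp
  qed
  have G3: "Gamma (s + 3) = (s + 2) * ((s + 1) * Gamma (s + 1))"
  proof -
    have e: "s + 3 = s + 1 + 2" "s + 2 = s + 1 + 1" by simp_all
    show ?thesis unfolding e by (intro Gamma_plus2) (use w s_def in linarith)
  qed
  have G: "Gamma (w d1) > 0" "Gamma (w d2) > 0" using w by (auto intro: Gamma_real_pos)
  have "kk * m * (g3 / g4 * (s + 1) * (s + 2)) / (x * (x + 1) * (v * (v + 1))) * t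
    = g1 * g2 * ((s + 2) * ((s + 1) * g3)) / ((x + 1) * (x * g1) * ((v + 1) * (v * g2)) * g4) * (m * kk) * t"
    if "g1 > 0" "g2 > 0" for kk m g1 g2 g3 g4 x v t :: real
    using that by (simp add: mult_ac)
  from this[OF G] show ?thesis
    unfolding c_eq_theta[OF d] Gamma_plus2[OF w(1)] Gamma_plus2[OF w(2)] s_def [symmetric] G3 R_def .
qed

end

theorem theorem3:
  fixes a :: real and k :: nat
  assumes "a > 0" and "k \<ge> 1"
  shows "\<exists>c_X :: nat \<Rightarrow> nat \<Rightarrow> real.
    (\<exists>C. \<forall>d1\<ge>k. \<forall>d2\<ge>k. \<forall>t\<ge>1.
        \<bar>expected_X a k d1 d2 t - c_X d1 d2 * real t\<bar> \<le> C) \<and>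
    (\<exists>\<theta> :: nat \<Rightarrow> nat \<Rightarrow> real. \<forall>d1\<ge>k. \<forall>d2\<ge>k.
        c_X d1 d2 =
          (Gamma (real d1 - real k + real k * a) * Gamma (real d2 - real k + real k * a)
             * Gamma (real d1 + real d2 - 2 * real k + 2 * real k * a + 3))
          / (Gamma (real d1 - real k + real k * a + 2) * Gamma (real d2 - real k + real k * a + 2)
             * Gamma (real d1 + real d2 - 2 * real k + 2 * real k * a + a + 2))
          * (real k * a * (a + 1) * (Gamma (real k * a + a + 1) / Gamma (real k * a)))
          * (1 + \<theta> d1 d2 *
               (((real d1 - real k + real k * a + 1) * (real d2 - real k + real k * a + 1))
                / ((real d1 + real d2 - 2 * real k + 2 * real k * a + 1)
                   * (real d1 + real d2 - 2 * real k + 2 * real k * a + 2)))) \<and>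
        - 4 + 2 / (1 + real k * a) \<le> \<theta> d1 d2 \<and>
        \<theta> d1 d2 \<le> a * ((Gamma (real k * a + 1) * Gamma (2 * real k * a + a + 3))
                         / (Gamma (2 * real k * a + 2) * Gamma (real k * a + a + 2)))) \<and>
    (\<exists>C. \<exists>\<epsilon> :: nat \<Rightarrow> nat \<Rightarrow> real. \<forall>d1\<ge>k. \<forall>d2\<ge>k.
        c_X d1 d2 =
          real k * a * (a + 1) * (Gamma (real k * a + a + 1) / Gamma (real k * a))
          * ((real d1 + real d2) powr (1 - a) / ((real d1)\<^sup>2 * (real d2)\<^sup>2))
          * (1 + \<epsilon> d1 d2) \<and>
        \<bar>\<epsilon> d1 d2\<bar> \<le> C * (1 / real d1 + 1 / real d2
                        + real d1 * real d2 / (real d1 + real d2)\<^sup>2))"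
proof -
  interpret buckley_osthus a k by unfold_locales (fact assms)+
  have w_eq: "w d = real d - real k + real k * a" for d by (simp add: w_def)
  have s_eq: "real d1 + real d2 - 2 * real k + 2 * real k * a = w d1 + w d2" for d1 d2
    by (simp add: w_def)
  have K_eq: "real k * a * (a + 1) * (Gamma (real k * a + a + 1) / Gamma (real k * a)) = \<kappa> * K"
    by (simp only: K_def mult.assoc)
  have upper_eq: "a * ((Gamma (real k * a + 1) * Gamma (2 * real k * a + a + 3))
      / (Gamma (2 * real k * a + 2) * Gamma (real k * a + a + 2))) = upper"
  proof -
    have "\<kappa> + 1 + \<kappa> + a + 2 = 2 * real k * a + a + 3" "\<kappa> + 1 + \<kappa> + 1 = 2 * real k * a + 2"
      "\<kappa> + 1 + a + 1 = real k * a + a + 2" by simp_all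
    then show ?thesis unfolding upper_def upper_at_def by metis
  qed
  show ?thesis
    unfolding K_eq upper_eq s_eq w_eq [symmetric] lower_def [symmetric]
  proof (rule exI[of _ c], intro conjI)
    show "\<exists>C. \<forall>d1\<ge>k. \<forall>d2\<ge>k. \<forall>t\<ge>1. \<bar>expected_X a k d1 d2 t - c d1 d2 * real t\<bar> \<le> C"
      using expected_X_asymptotics by blast
    show "\<exists>C. \<exists>\<epsilon>. \<forall>d1\<ge>k. \<forall>d2\<ge>k.
        c d1 d2 = \<kappa> * K * ((real d1 + real d2) powr (1 - a) / ((real d1)\<^sup>2 * (real d2)\<^sup>2)) * (1 + \<epsilon> d1 d2) \<and>
        \<bar>\<epsilon> d1 d2\<bar> \<le> C * (1 / real d1 + 1 / real d2 + real d1 * real d2 / (real d1 + real d2)\<^sup>2)"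
      by (rule c_asymptotics)
  qed (rule exI[of _ \<theta>], use c_eq_Gamma theta_bounds in blast)
qed

end
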